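(* Let $M=(m_1,\dots,m_q,n)$ be a semidominant ideal, where $\{m_1,\dots,m_q,n\}$ is the minimal generating set, $m_1,\dots,m_q$ are dominant and $n$ is nondominant. Let $$A=\{([m_{i_1},\dots,m_{i_j},n],[m_{i_1},\dots,m_{i_j}]) : n\mid \operatorname{lcm}(m_{i_1},\dots,m_{i_j})\}.$$ Then the minimal free resolution of $S/M$ can be obtained from $\mathbb{T}_M$ by doing all standard cancellations $0\to S[\sigma]\to S[\tau]\to 0$ with $([\sigma],[\tau])\in A$. In other words, if $\mathbb{F}$ is the minimal free resolution of $S/M$, then $$\mathbb{T}_M=\mathbb{F}\oplus\Big(\bigoplus_{([\sigma],[\tau])\in A}0\to S[\sigma]\to S[\tau]\to 0\Big).$$
   Context: $S$ is a polynomial ring in finitely many variables over an arbitrary field. For a monomial ideal $M$ of $S$ with minimal generating set $G=\{l_1,\dots,l_p\}$, the Taylor resolution $\mathbb{T}_M$ is the multigraded free resolution of $S/M$ whose free module in homological degree $j$ has basis the symbols $[l_{r_1},\dots,l_{r_j}]$, $r_1<\dots<r_j$ (one for each $j$-element subset of $G$), with $\operatorname{mdeg}[l_{r_1},\dots,l_{r_j}]=\operatorname{lcm}(l_{r_1},\dots,l_{r_j})$, and differential $f_j([l_{r_1},\dots,l_{r_j}])=\sum_{i=1}^j(-1)^{i+1}\frac{\operatorname{mdeg}[l_{r_1},\dots,l_{r_j}]}{\operatorname{mdeg}[l_{r_1},\dots,\widehat{l_{r_i}},\dots,l_{r_j}]}[l_{r_1},\dots,\widehat{l_{r_i}},\dots,l_{r_j}]$.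 Given a set $G$ of monomials, $m\in G$ is dominant (with respect to $G$) if there are a variable $x$ and an integer $k\ge1$ with $x^k\mid m$ and $x^k\nmid m'$ for all $m'\in G\setminus\{m\}$. A set of monomials is semidominant if exactly one of its elements is not dominant; a monomial ideal is semidominant if its minimal generating set is semidominant. Standard cancellations. Let $\mathbb{F}$ be a multigraded free resolution of $S/M$ with a chosen multihomogeneous basis labelled by basis elements of $\mathbb{T}_M$ (e.g. $\mathbb{T}_M$ itself), with differentials $f_j$. For $[\sigma]$ in homological degree $j$ and $[\tau]$ in degree $j-1$, let $a_{\tau\sigma}$ be the coefficient of $[\tau]$ in $f_j([\sigma])$. If $a_{\tau\sigma}$ is invertible, the standard change of basis around $a_{\tau\sigma}$ puts $[\sigma]'=[\sigma]$, $[\theta]'=[\theta]-\frac{a_{\tau\theta}}{a_{\tau\sigma}}[\sigma]$ for the other basis elements $[\theta]$ in degree $j$, $[\tau]'=f_j([\sigma])$, and $[\pi]'=[\pi]$ for the other basis elements $[\pi]$ in degree $j-1$. Multidegrees are preserved, and in the new bases the resolution splits as $\mathbb{F}'\oplus(0\to S[\sigma]'\to S[\tau]'\to0)$, with $\mathbb{F}'$ free on the remaining basis elements. Passing from $\mathbb{F}$ to $\mathbb{F}'$ is the standard cancellation $0\to S[\sigma]\to S[\tau]\to0$; it is possible exactly when the entry $a_{\tau\sigma}$ of the current resolution is invertible. Primes are dropped: the remaining basis elements keep their names, so the basis of $\mathbb{F}'$ is identified with a subset of the basis of $\mathbb{T}_M$. The displayed equality is understood with these identifications (i.e. up to the changes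 of basis). *)

theory Defs
  imports "HOL-Library.Poly_Mapping" HOL.Modules
begin

section \<open>Monomials and monomial ideals\<close>

text \<open>A monomial is its exponent vector, so that monomials multiply by addition of exponents and
  the unit monomial is \<open>0\<close>.  The order \<open>\<le>\<close> of the library on \<open>\<Rightarrow>\<^sub>0\<close> is lexicographic and is not used.\<close>

type_synonym 'v mon = "'v \<Rightarrow>\<^sub>0 nat"
type_synonym ('v, 'k) mpol = "'v mon \<Rightarrow>\<^sub>0 'k"

definition monom :: "'v mon \<Rightarrow> ('v, 'k::field) mpol" where
  "monom m = Poly_Mapping.single m 1"

definition mdvd :: "'v mon \<Rightarrow> 'v mon \<Rightarrow> bool" (infix \<open>mdvd\<close> 50) where
  "s mdvd t \<longleftrightarrow> (\<exists>u. t = s + u)"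

definition lcm_mon :: "('v::finite) mon set \<Rightarrow> 'v mon" where
  "lcm_mon X = Abs_poly_mapping (\<lambda>x. Max (insert 0 ((\<lambda>m. Poly_Mapping.lookup m x) ` X)))"

abbreviation ideal_gen :: "('v, 'k::field) mpol set \<Rightarrow> ('v, 'k) mpol set" where
  "ideal_gen X \<equiv> module.span (*) X"

definition min_gen_set :: "('v, 'k::field) mpol set \<Rightarrow> 'v mon set \<Rightarrow> bool" where
  "min_gen_set M G \<longleftrightarrow> ideal_gen (monom ` G) = M \<and> (\<forall>H. H \<subset> G \<longrightarrow> ideal_gen (monom ` H) \<noteq> M)"

definition dominant :: "'v mon set \<Rightarrow> 'v mon \<Rightarrow> bool" where
  "dominant G m \<longleftrightarrow> (\<exists>x k. k \<ge> 1 \<and> Poly_Mapping.single x k mdvd m \<and>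
     (\<forall>m' \<in> G - {m}. \<not> Poly_Mapping.single x k mdvd m'))"

definition semidominant :: "'v mon set \<Rightarrow> bool" where
  "semidominant G \<longleftrightarrow> (\<exists>!m. m \<in> G \<and> \<not> dominant G m)"

definition semidominant_ideal :: "('v, 'k::field) mpol set \<Rightarrow> bool" where
  "semidominant_ideal M \<longleftrightarrow> (\<exists>G. min_gen_set M G \<and> semidominant G)"

definition max_ideal :: "('v, 'k::field) mpol set" where
  "max_ideal = ideal_gen (range (\<lambda>x. monom (Poly_Mapping.single x 1)))"


section \<open>Multigraded free complexes with a chosen multihomogeneous basis\<close>

text \<open>Each basis element carries its homological degree and its multidegree; \<open>coef F \<tau> \<sigma>\<close> is the
  coefficient $a_{\tau\sigma}$ of \<open>\<tau>\<close> in the differential of \<open>\<sigma>\<close>, and is only ever read for basis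
  elements \<open>\<tau>\<close>, \<open>\<sigma>\<close> in consecutive homological degrees.\<close>

record (overloaded) ('l, 'v, 'k) mgcomplex =
  basis :: "'l set"
  hdeg :: "'l \<Rightarrow> nat"
  mdeg :: "'l \<Rightarrow> 'v mon"
  coef :: "'l \<Rightarrow> 'l \<Rightarrow> ('v, 'k) mpol"

definition basis_in :: "('l, 'v, 'k) mgcomplex \<Rightarrow> nat \<Rightarrow> 'l set" where
  "basis_in F j = {b \<in> basis F. hdeg F b = j}"

text \<open>The free module \<open>F\<^sub>j\<close>, as coordinate vectors.\<close>

definition chains :: "('l, 'v, 'k::field) mgcomplex \<Rightarrow> nat \<Rightarrow> ('l \<Rightarrow> ('v, 'k) mpol) set" where
  "chains F j = {v. \<forall>b. b \<notin> basis_in F j \<longrightarrow> v b = 0}"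

text \<open>The differential \<open>f\<^sub>j : F\<^sub>j \<rightarrow> F\<^sub>j\<^sub>-\<^sub>1\<close>; meaningful only for \<open>j \<ge> 1\<close>.\<close>

definition diff ::
    "('l, 'v, 'k::field) mgcomplex \<Rightarrow> nat \<Rightarrow> ('l \<Rightarrow> ('v, 'k) mpol) \<Rightarrow> 'l \<Rightarrow> ('v, 'k) mpol" where
  "diff F j v = (\<lambda>\<tau>. if \<tau> \<in> basis_in F (j - 1)
                      then \<Sum>\<sigma>\<in>basis_in F j. coef F \<tau> \<sigma> * v \<sigma> else 0)"

definition multigraded :: "('l, 'v, 'k::field) mgcomplex \<Rightarrow> bool" where
  "multigraded F \<longleftrightarrow>
     (\<forall>j. finite (basis_in F j)) \<and>
     (\<forall>j. \<forall>\<sigma>\<in>basis_in F (Suc j). \<forall>\<tau>\<in>basis_in F j.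
        \<forall>e\<in>Poly_Mapping.keys (coef F \<tau> \<sigma>). mdeg F \<tau> + e = mdeg F \<sigma>)"

text \<open>\<open>F\<close> resolves \<open>S/M\<close>: there is an augmentation \<open>F\<^sub>0 \<rightarrow> S/M\<close>, sending each basis element \<open>b\<close>
  to the class of a polynomial \<open>e b\<close> homogeneous of multidegree \<open>mdeg F b\<close>, for which the augmented
  complex is exact.\<close>

definition augment ::
    "('l, 'v, 'k::field) mgcomplex \<Rightarrow> ('l \<Rightarrow> ('v, 'k) mpol) \<Rightarrow> ('l \<Rightarrow> ('v, 'k) mpol) \<Rightarrow> ('v, 'k) mpol"
  where "augment F e v = (\<Sum>b\<in>basis_in F 0. v b * e b)"

definition free_resolution :: "('l, 'v, 'k::field) mgcomplex \<Rightarrow> ('v, 'k) mpol set \<Rightarrow> bool" where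
  "free_resolution F M \<longleftrightarrow> multigraded F \<and>
     (\<exists>e. (\<forall>b\<in>basis_in F 0. Poly_Mapping.keys (e b) \<subseteq> {mdeg F b}) \<and>
          (\<forall>s. \<exists>v\<in>chains F 0. s - augment F e v \<in> M) \<and>
          {v \<in> chains F 0. augment F e v \<in> M} = diff F 1 ` chains F 1) \<and>
     (\<forall>j\<ge>1. {v \<in> chains F j. diff F j v = (\<lambda>_. 0)} = diff F (Suc j) ` chains F (Suc j))"

text \<open>Minimality is the condition \<open>f\<^sub>j(F\<^sub>j) \<subseteq> \<mm> F\<^sub>j\<^sub>-\<^sub>1\<close> for \<open>j \<ge> 1\<close>, \<open>\<mm>\<close> being the ideal generated by the
  variables.\<close>

definition minimal_free_resolution ::
    "('l, 'v, 'k::field) mgcomplex \<Rightarrow> ('v, 'k) mpol set \<Rightarrow> bool" where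
  "minimal_free_resolution F M \<longleftrightarrow> free_resolution F M \<and>
     (\<forall>j. \<forall>v\<in>chains F (Suc j). \<forall>\<tau>. diff F (Suc j) v \<tau> \<in> max_ideal)"


section \<open>The Taylor resolution\<close>

text \<open>The symbol $[l_{r_1},\dots,l_{r_j}]$ is the set \<open>{r\<^sub>1,\<dots>,r\<^sub>j}\<close> of positions (counted from 0) in
  the list of generators.  The \<open>i\<close>-th element \<open>r\<close> of \<open>\<sigma>\<close> has \<open>i - 1\<close> smaller elements in \<open>\<sigma>\<close>,
  which gives the sign $(-1)^{i+1}$.\<close>

definition taylor_mdeg :: "('v::finite) mon list \<Rightarrow> nat set \<Rightarrow> 'v mon" where
  "taylor_mdeg ls \<sigma> = lcm_mon ((\<lambda>r. ls ! r) ` \<sigma>)"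

definition taylor :: "('v::finite) mon list \<Rightarrow> (nat set, 'v, 'k::field) mgcomplex" where
  "taylor ls =
     \<lparr>basis = Pow {..<length ls},
      hdeg = card,
      mdeg = taylor_mdeg ls,
      coef = (\<lambda>\<tau> \<sigma>. \<Sum>r | r \<in> \<sigma> \<and> \<tau> = \<sigma> - {r}.
                (- 1) ^ card {s \<in> \<sigma>. s < r} * monom (taylor_mdeg ls \<sigma> - taylor_mdeg ls \<tau>))\<rparr>"


section \<open>Standard cancellations\<close>

definition unit_vec :: "'l \<Rightarrow> 'l \<Rightarrow> ('v, 'k::field) mpol" where
  "unit_vec \<theta> = (\<lambda>b. if b = \<theta> then 1 else 0)"

text \<open>The primed basis of the standard change of basis around $a_{\tau\sigma}$, in the old
  coordinates; \<open>u\<close> is the inverse of $a_{\tau\sigma}$.\<close>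

definition std_basis ::
    "('l, 'v, 'k::field) mgcomplex \<Rightarrow> 'l \<Rightarrow> 'l \<Rightarrow> ('v, 'k) mpol \<Rightarrow> 'l \<Rightarrow> 'l \<Rightarrow> ('v, 'k) mpol" where
  "std_basis F \<sigma> \<tau> u \<theta> =
     (if \<theta> = \<sigma> then unit_vec \<sigma>
      else if \<theta> = \<tau> then diff F (hdeg F \<sigma>) (unit_vec \<sigma>)
      else if hdeg F \<theta> = hdeg F \<sigma> then (\<lambda>b. unit_vec \<theta> b - coef F \<tau> \<theta> * u * unit_vec \<sigma> b)
      else unit_vec \<theta>)"

text \<open>\<open>F'\<close> arises from \<open>F\<close> by the standard cancellation $0\to S[\sigma]\to S[\tau]\to 0$.  The last
  clause says that in the primed bases the differential maps the span of the remaining elements to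
  itself, with matrix \<open>coef F'\<close>; since the primed elements form a basis, it determines \<open>coef F'\<close> on
  the basis of \<open>F'\<close>.\<close>

definition std_cancellation ::
    "('l, 'v, 'k::field) mgcomplex \<Rightarrow> 'l \<Rightarrow> 'l \<Rightarrow> ('l, 'v, 'k) mgcomplex \<Rightarrow> bool" where
  "std_cancellation F \<sigma> \<tau> F' \<longleftrightarrow>
     \<sigma> \<in> basis F \<and> \<tau> \<in> basis F \<and> hdeg F \<sigma> = Suc (hdeg F \<tau>) \<and>
     basis F' = basis F - {\<sigma>, \<tau>} \<and> hdeg F' = hdeg F \<and> mdeg F' = mdeg F \<and>
     (\<exists>u. coef F \<tau> \<sigma> * u = 1 \<and>
        (\<forall>j. \<forall>\<theta>\<in>basis_in F' (Suc j).
           diff F (Suc j) (std_basis F \<sigma> \<tau> u \<theta>) =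
             (\<lambda>b. \<Sum>\<pi>\<in>basis_in F' j. coef F' \<pi> \<theta> * std_basis F \<sigma> \<tau> u \<pi> b)))"

inductive std_cancellations ::
    "('l, 'v, 'k::field) mgcomplex \<Rightarrow> ('l \<times> 'l) list \<Rightarrow> ('l, 'v, 'k) mgcomplex \<Rightarrow> bool" where
  Nil: "std_cancellations F [] F"
| Cons: "std_cancellation F \<sigma> \<tau> F' \<Longrightarrow> std_cancellations F' ps F'' \<Longrightarrow>
           std_cancellations F ((\<sigma>, \<tau>) # ps) F''"


section \<open>Direct sums and isomorphism of complexes\<close>

definition short_complex ::
    "('l, 'v, 'k::field) mgcomplex \<Rightarrow> 'l \<times> 'l \<Rightarrow> ('l, 'v, 'k) mgcomplex" where
  "short_complex T = (\<lambda>(\<sigma>, \<tau>).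
     T\<lparr>basis := {\<sigma>, \<tau>}, coef := (\<lambda>\<pi> \<theta>. if \<pi> = \<tau> \<and> \<theta> = \<sigma> then 1 else 0)\<rparr>)"

definition big_dsum ::
    "'i set \<Rightarrow> ('i \<Rightarrow> ('l, 'v, 'k::field) mgcomplex) \<Rightarrow> ('i \<times> 'l, 'v, 'k) mgcomplex" where
  "big_dsum I C =
     \<lparr>basis = (SIGMA i:I. basis (C i)),
      hdeg = (\<lambda>(i, b). hdeg (C i) b),
      mdeg = (\<lambda>(i, b). mdeg (C i) b),
      coef = (\<lambda>(i, \<tau>) (i', \<sigma>). if i = i' then coef (C i) \<tau> \<sigma> else 0)\<rparr>"

definition dsum ::
    "('a, 'v, 'k::field) mgcomplex \<Rightarrow> ('b, 'v, 'k) mgcomplex \<Rightarrow> ('a + 'b, 'v, 'k) mgcomplex" where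
  "dsum F G =
     \<lparr>basis = basis F <+> basis G,
      hdeg = case_sum (hdeg F) (hdeg G),
      mdeg = case_sum (mdeg F) (mdeg G),
      coef = (\<lambda>\<tau> \<sigma>. case (\<tau>, \<sigma>) of
                (Inl t, Inl s) \<Rightarrow> coef F t s
              | (Inr t, Inr s) \<Rightarrow> coef G t s
              | _ \<Rightarrow> 0)\<rparr>"

definition homogeneous ::
    "('l, 'v, 'k::field) mgcomplex \<Rightarrow> 'v mon \<Rightarrow> ('l \<Rightarrow> ('v, 'k) mpol) \<Rightarrow> bool" where
  "homogeneous F d v \<longleftrightarrow> (\<forall>b. \<forall>e\<in>Poly_Mapping.keys (v b). mdeg F b + e = d)"

text \<open>Isomorphism of multigraded complexes of \<open>S\<close>-modules, i.e. equality up to a multihomogeneous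
  change of basis in each homological degree.\<close>

definition mg_iso ::
    "('a, 'v, 'k::field) mgcomplex \<Rightarrow> ('b, 'v, 'k) mgcomplex \<Rightarrow> bool" (infix \<open>\<cong>\<^sub>m\<close> 50) where
  "F \<cong>\<^sub>m G \<longleftrightarrow> (\<exists>\<phi>. \<forall>j.
     bij_betw (\<phi> j) (chains F j) (chains G j) \<and>
     (\<forall>v\<in>chains F j. \<forall>w\<in>chains F j. \<phi> j (\<lambda>b. v b + w b) = (\<lambda>b. \<phi> j v b + \<phi> j w b)) \<and>
     (\<forall>s. \<forall>v\<in>chains F j. \<phi> j (\<lambda>b. s * v b) = (\<lambda>b. s * \<phi> j v b)) \<and>
     (\<forall>d. \<forall>v\<in>chains F j. homogeneous F d v \<longrightarrow> homogeneous G d (\<phi> j v)) \<and>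
     (\<forall>v\<in>chains F (Suc j). \<phi> j (diff F (Suc j) v) = diff G (Suc j) (\<phi> (Suc j) v)))"

end

theory Submission
  imports Defs
begin

text \<open>
Let \<open>q\<close> be the position of the nondominant generator \<open>n\<close>, so that the symbols of the Taylor
resolution are the subsets of \<open>{0..q}\<close>, and split them into those that contain \<open>q\<close> and those
that do not.  The only facet of a symbol \<open>\<theta>\<close> with \<open>q \<in> \<theta>\<close> that avoids \<open>q\<close> is \<open>\<theta> - {q}\<close>.  So the
block of the differential from the first kind to the second is diagonal, and the pairs in \<open>A\<close> are
the diagonal positions at which the entry is a unit.

\<^emph>\<open>All cancellations can be done, in any order.\<close>  Cancelling around \<open>a\<^sub>\<tau>\<^sub>\<sigma>\<close> replaces each entry
\<open>a\<^sub>\<pi>\<^sub>\<theta>\<close> by \<open>a\<^sub>\<pi>\<^sub>\<theta> - a\<^sub>\<pi>\<^sub>\<sigma> a\<^sub>\<tau>\<^sub>\<theta> / a\<^sub>\<tau>\<^sub>\<sigma>\<close>.  For \<open>(\<sigma>, \<tau>) \<in> A\<close> the correction vanishes unless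
\<open>q \<notin> \<theta>\<close> and \<open>q \<in> \<pi>\<close>, because the diagonal block has no other nonzero entry in the row of \<open>\<tau>\<close> or
in the column of \<open>\<sigma>\<close>.  In particular the diagonal block itself never changes, and every later
pivot is still a sign when its turn comes (\<open>partly_cancelled_cancel\<close>, \<open>cancel_all\<close>).

\<^emph>\<open>The result is minimal.\<close>  An entry with a nonzero constant term joins symbols of the same
multidegree.  Leaving out a dominant generator lowers the exponent of some variable in the least
common multiple, so in the Taylor resolution such entries sit exactly at the pairs in \<open>A\<close>
(\<open>TR_const_term\<close>), and those are all removed.  The corrections contain a factor \<open>a\<^sub>\<tau>\<^sub>\<theta>\<close> between
symbols that avoid \<open>q\<close>, hence have no constant term, and create no new unit.

\<^emph>\<open>The result is a resolution.\<close>  The Taylor complex is exact because in each multidegree it is the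
augmented chain complex of a full simplex, which contracts to any of its vertices
(\<open>taylor_cycle_is_boundary\<close>).  A cancellation splits off a short complex
(\<open>cancellation.iso\<close>), and a direct summand of an exact complex is exact.

\<^emph>\<open>The decomposition holds for every minimal free resolution.\<close>  Collecting the split summands gives
the decomposition with the complex that the cancellations leave behind, and any two minimal
multigraded free resolutions of the same module are isomorphic
(\<open>minimal_free_resolution_unique\<close>).
\<close>

section \<open>Homogeneous entries and constant terms\<close>

interpretation ideal: module "(*) :: ('v, 'k::field) mpol \<Rightarrow> ('v, 'k) mpol \<Rightarrow> ('v, 'k) mpol"
  by unfold_locales (simp_all add: algebra_simps)

(* This rule re-associates products in the direction opposite to mult.assoc. *)
declare ideal.scale_scale [simp del]

text \<open>Here \<open>x\<close> and \<open>y\<close> are the multidegrees of two basis elements, and \<open>p\<close> is the coefficient of the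
  first in a multihomogeneous image of the second.  Read as arrows from \<open>y\<close> to \<open>x\<close>, such
  coefficients are closed under composition; homogeneity of all maps below reduces to this.\<close>

definition entry :: "'v mon \<Rightarrow> 'v mon \<Rightarrow> ('v, 'k::field) mpol \<Rightarrow> bool" where
  "entry x y p \<longleftrightarrow> (\<forall>k. Poly_Mapping.lookup p k \<noteq> 0 \<longrightarrow> x + k = y)"

lemma entry_keys: "entry x y p \<longleftrightarrow> (\<forall>k\<in>Poly_Mapping.keys p. x + k = y)"
  by (auto simp: entry_def lookup_not_eq_zero_eq_in_keys)

lemma entry_0 [simp]: "entry x y 0"
  by (simp add: entry_def)

lemma entry_1 [simp]: "entry x x 1"
  by (simp add: entry_def lookup_one when_def)

lemma entry_add: "entry x y p \<Longrightarrow> entry x y q \<Longrightarrow> entry x y (p + q)"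
  unfolding entry_def lookup_add by (metis add.right_neutral)

lemma entry_uminus [simp]: "entry x y (- p) \<longleftrightarrow> entry x y p"
  by (auto simp: entry_def)

lemma entry_diff: "entry x y p \<Longrightarrow> entry x y q \<Longrightarrow> entry x y (p - q)"
  unfolding entry_def lookup_minus by (metis diff_self)

lemma entry_sum: "(\<And>i. i \<in> I \<Longrightarrow> entry x y (f i)) \<Longrightarrow> entry x y (sum f I)"
  by (induction I rule: infinite_finite_induct) (auto intro: entry_add)

lemma entry_mult:
  assumes "entry x y p" "entry y z q"
  shows "entry x z (p * q)"
  unfolding entry_keys
proof
  fix k assume "k \<in> Poly_Mapping.keys (p * q)"
  then obtain a b where "k = a + b" "a \<in> Poly_Mapping.keys p" "b \<in> Poly_Mapping.keys q"
    using keys_mult[of p q] by blast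
  then show "x + k = z"
    using assms unfolding entry_keys by (metis add.assoc)
qed

lemma entry_mult_commuted: "entry y z p \<Longrightarrow> entry x y q \<Longrightarrow> entry x z (p * q)"
  by (subst mult.commute) (rule entry_mult)

lemma entry_minus_one_power [simp]: "entry x x ((- 1) ^ i)"
  by (induction i) (use entry_mult entry_1 entry_uminus in \<open>auto\<close>)

text \<open>If \<open>p\<close> is the coordinate of a vector at a basis element of multidegree \<open>x\<close>, this is the
  corresponding coordinate of the component of the vector in multidegree \<open>d\<close>.\<close>

definition part :: "'v mon \<Rightarrow> 'v mon \<Rightarrow> ('v, 'k::field) mpol \<Rightarrow> ('v, 'k) mpol" where
  "part x d p = Abs_poly_mapping (\<lambda>k. Poly_Mapping.lookup p k when x + k = d)"

lemma lookup_part: "Poly_Mapping.lookup (part x d p) k = (Poly_Mapping.lookup p k when x + k = d)"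
proof -
  have "finite {k. (Poly_Mapping.lookup p k when x + k = d) \<noteq> 0}"
    by (rule finite_subset[OF _ finite_lookup[of p]]) auto
  then show ?thesis
    by (simp add: part_def)
qed

lemma entry_part [simp]: "entry x d (part x d p)"
  by (auto simp: entry_def lookup_part)

lemma part_add: "part x d (p + q) = part x d p + part x d q"
  by (rule poly_mapping_eqI) (simp add: lookup_part lookup_add when_add_distrib)

lemma part_0 [simp]: "part x d 0 = 0"
  by (rule poly_mapping_eqI) (simp add: lookup_part)

lemma part_sum: "part x d (sum f I) = (\<Sum>i\<in>I. part x d (f i))"
  by (induction I rule: infinite_finite_induct) (auto simp: part_add)

lemma part_entry: "entry x d p \<Longrightarrow> part x d p = p"
  by (rule poly_mapping_eqI) (auto simp: lookup_part entry_def when_def)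

text \<open>Multiplication by a homogeneous coefficient shifts all degrees by the same amount and
  therefore commutes with taking parts.  This is why differentials and augmentations respect
  homogeneous components.\<close>

lemma part_mult:
  assumes a: "entry x y a"
  shows "part x d (a * q) = a * part y d q"
proof -
  define r where "r = q - part y d q"
  have q: "q = part y d q + r"
    by (simp add: r_def)
  have "part x d (a * r) = 0"
  proof (rule poly_mapping_eqI)
    fix k
    have "x + k \<noteq> d" if k: "k \<in> Poly_Mapping.keys (a * r)"
    proof -
      obtain i j where ij: "k = i + j" "i \<in> Poly_Mapping.keys a" "j \<in> Poly_Mapping.keys r"
        using keys_mult[of a r] k by blast
      then have "x + i = y"
        using a by (auto simp: entry_keys)
      moreover have "y + j \<noteq> d"
        using ij(3) by (auto simp: in_keys_iff r_def lookup_minus lookup_part)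
      ultimately show ?thesis
        by (metis ij(1) add.assoc)
    qed
    then show "Poly_Mapping.lookup (part x d (a * r)) k = Poly_Mapping.lookup 0 k"
      by (auto simp: lookup_part in_keys_iff when_def)
  qed
  moreover have "part x d (a * part y d q) = a * part y d q"
    by (rule part_entry) (rule entry_mult[OF a entry_part])
  ultimately show ?thesis
    by (subst (1) q) (simp add: distrib_left part_add)
qed

lemma part_mult_commuted: "entry x y a \<Longrightarrow> part x d (q * a) = part y d q * a"
  using part_mult[of x y a d q] by (simp add: mult.commute)

lemma part_sum_all:
  assumes "finite D" "(\<lambda>k. x + k) ` Poly_Mapping.keys p \<subseteq> D"
  shows "(\<Sum>d\<in>D. part x d p) = p"
proof (rule poly_mapping_eqI)
  fix k
  show "Poly_Mapping.lookup (\<Sum>d\<in>D. part x d p) k = Poly_Mapping.lookup p k"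
    using assms by (cases "Poly_Mapping.lookup p k = 0")
      (auto simp: lookup_sum lookup_part when_def in_keys_iff sum.delta)
qed

lemma entry_monom: "x + m = y \<Longrightarrow> entry x y (monom m)"
  by (auto simp: entry_def monom_def lookup_single when_def)

definition const_term :: "('v, 'k::field) mpol \<Rightarrow> 'k" where
  "const_term p = Poly_Mapping.lookup p 0"

lemma mon_add_eq_0: "(a :: 'v mon) + b = 0 \<longleftrightarrow> a = 0 \<and> b = 0"
  by (auto simp: poly_mapping_eq_iff lookup_add fun_eq_iff)

lemma const_term_simps [simp]:
  "const_term 0 = 0" "const_term 1 = 1" "const_term (- p) = - const_term p"
  "const_term (p + q) = const_term p + const_term q"
  "const_term (p - q) = const_term p - const_term q"
  by (simp_all add: const_term_def lookup_add lookup_minus)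

lemma const_term_sum [simp]: "const_term (sum f I) = (\<Sum>i\<in>I. const_term (f i))"
  by (simp add: const_term_def lookup_sum)

lemma const_term_mult [simp]:
  fixes p q :: "('v, 'k::field) mpol"
  shows "const_term (p * q) = const_term p * const_term q"
proof -
  define p' where "p' = p - Poly_Mapping.single 0 (const_term p)"
  define q' where "q' = q - Poly_Mapping.single 0 (const_term q)"
  have z: "const_term (a * b) = 0" if "const_term a = 0 \<or> const_term b = 0" for a b :: "('v, 'k) mpol"
  proof (rule ccontr)
    assume "const_term (a * b) \<noteq> 0"
    then have "0 \<in> Poly_Mapping.keys (a * b)"
      by (simp add: const_term_def in_keys_iff)
    then obtain i j where "0 = i + j" "i \<in> Poly_Mapping.keys a" "j \<in> Poly_Mapping.keys b"
      using keys_mult[of a b] by blast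
    moreover from this(1) have "i = 0" "j = 0"
      using mon_add_eq_0[of i j] by auto
    ultimately show False
      using that by (auto simp: const_term_def in_keys_iff)
  qed
  have z': "const_term p' = 0" "const_term q' = 0"
    by (simp_all add: p'_def q'_def) (simp_all add: const_term_def)
  let ?P = "Poly_Mapping.single 0 (const_term p) :: ('v, 'k) mpol"
  let ?Q = "Poly_Mapping.single 0 (const_term q) :: ('v, 'k) mpol"
  have pq: "p * q = ?P * ?Q + (?P * q' + p' * q)"
    by (simp add: p'_def q'_def algebra_simps)
  have "const_term (p * q) = const_term (?P * ?Q)"
    unfolding pq by (simp add: z z')
  also have "\<dots> = const_term p * const_term q"
    by (simp add: mult_single) (simp add: const_term_def)
  finally show ?thesis .
qed

lemma poly_eq_sum_terms: "p = (\<Sum>k\<in>Poly_Mapping.keys p. Poly_Mapping.single k (Poly_Mapping.lookup p k))"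
  by (rule poly_mapping_eqI)
    (auto simp: lookup_sum lookup_single when_def sum.delta in_keys_iff)

text \<open>The ideal generated by the variables is the kernel of the ring homomorphism \<open>const_term\<close>, so
  minimality of a complex is a statement about constant terms of matrix entries.\<close>

lemma in_max_ideal_iff: "p \<in> max_ideal \<longleftrightarrow> const_term p = 0"
proof
  assume "p \<in> max_ideal"
  then show "const_term p = 0"
    unfolding max_ideal_def
  proof (induction rule: ideal.span_induct_alt)
    case base
    then show ?case by simp
  next
    case (step c a b)
    then obtain x where "a = monom (Poly_Mapping.single x 1)"
      by auto
    moreover have "Poly_Mapping.single x 1 \<noteq> (0 :: 'a mon)"
      by (metis lookup_single_eq lookup_zero zero_neq_one)
    ultimately have "const_term a = 0"
      by (simp add: const_term_def monom_def lookup_single when_def)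
    with step show ?case
      by simp
  qed
next
  assume *: "const_term p = 0"
  have "Poly_Mapping.single k (Poly_Mapping.lookup p k) \<in> max_ideal" if "k \<in> Poly_Mapping.keys p" for k
  proof -
    have "k \<noteq> 0"
      using * that by (auto simp: const_term_def in_keys_iff)
    then obtain x where "Poly_Mapping.lookup k x \<noteq> 0"
      by (metis poly_mapping_eqI lookup_zero)
    then have k: "k = (k - Poly_Mapping.single x 1) + Poly_Mapping.single x 1"
      by (intro poly_mapping_eqI) (auto simp: lookup_add lookup_minus lookup_single when_def)
    have "Poly_Mapping.single k (Poly_Mapping.lookup p k) =
        Poly_Mapping.single (k - Poly_Mapping.single x 1) (Poly_Mapping.lookup p k) * monom (Poly_Mapping.single x 1)"
      unfolding monom_def mult_single mult_1_right by (simp only: k[symmetric])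
    then show ?thesis
      unfolding max_ideal_def by (simp add: ideal.span_scale ideal.span_base)
  qed
  then show "p \<in> max_ideal"
    by (subst poly_eq_sum_terms) (auto simp: max_ideal_def intro: ideal.span_sum)
qed

text \<open>The generators are homogeneous, so a monomial ideal contains the homogeneous parts of its
  elements.  It allows all choices of preimages modulo the ideal to be made homogeneous.\<close>

lemma monomial_ideal_part:
  assumes "p \<in> ideal_gen (monom ` G)"
  shows "part 0 d p \<in> ideal_gen (monom ` G)"
  using assms
proof (induction rule: ideal.span_induct_alt)
  case base
  then show ?case by (simp add: ideal.span_zero)
next
  case (step c a b)
  then obtain g where g: "a = monom g" "a \<in> monom ` G"
    by auto
  have "part 0 d (a * c) = a * part g d c"
    by (rule part_mult) (auto simp: g entry_monom)
  then have "part 0 d (c * a) = part g d c * a"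
    by (simp add: mult.commute)
  with step g show ?case
    by (auto simp: part_add intro: ideal.span_add ideal.span_scale ideal.span_base)
qed


section \<open>Homogeneous module maps\<close>

text \<open>Chains are the coordinate functions that vanish off the basis; a map is constrained on chains
  only and may do anything elsewhere.\<close>

definition module_map :: "('a, 'v, 'k::field) mgcomplex \<Rightarrow> nat \<Rightarrow> ('b, 'v, 'k) mgcomplex \<Rightarrow> nat \<Rightarrow>
    (('a \<Rightarrow> ('v, 'k) mpol) \<Rightarrow> 'b \<Rightarrow> ('v, 'k) mpol) \<Rightarrow> bool" where
  "module_map F i G j \<phi> \<longleftrightarrow>
     (\<forall>v\<in>chains F i. \<phi> v \<in> chains G j) \<and>
     (\<forall>v\<in>chains F i. \<forall>w\<in>chains F i. \<phi> (\<lambda>b. v b + w b) = (\<lambda>b. \<phi> v b + \<phi> w b)) \<and>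
     (\<forall>s. \<forall>v\<in>chains F i. \<phi> (\<lambda>b. s * v b) = (\<lambda>b. s * \<phi> v b))"

definition graded_map :: "('a, 'v, 'k::field) mgcomplex \<Rightarrow> nat \<Rightarrow> ('b, 'v, 'k) mgcomplex \<Rightarrow>
    (('a \<Rightarrow> ('v, 'k) mpol) \<Rightarrow> 'b \<Rightarrow> ('v, 'k) mpol) \<Rightarrow> bool" where
  "graded_map F i G \<phi> \<longleftrightarrow>
     (\<forall>d. \<forall>v\<in>chains F i. homogeneous F d v \<longrightarrow> homogeneous G d (\<phi> v))"

lemma chains_0: "(\<lambda>b. 0) \<in> chains F j"
  and chains_minus: "v \<in> chains F j \<Longrightarrow> w \<in> chains F j \<Longrightarrow> (\<lambda>b. v b - w b) \<in> chains F j"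
  and chains_scale: "v \<in> chains F j \<Longrightarrow> (\<lambda>b. s * v b) \<in> chains F j"
  and chains_unit_vec: "b \<in> basis_in F j \<Longrightarrow> unit_vec b \<in> chains F j"
  by (auto simp: chains_def unit_vec_def)

lemma chains_sum: "(\<And>i. i \<in> I \<Longrightarrow> v i \<in> chains F j) \<Longrightarrow> (\<lambda>b. \<Sum>i\<in>I. v i b) \<in> chains F j"
  by (auto simp: chains_def intro!: sum.neutral)

lemma chains_eq_0: "v \<in> chains F j \<Longrightarrow> b \<notin> basis_in F j \<Longrightarrow> v b = 0"
  by (auto simp: chains_def)

lemma diff_in_chains: "diff F (Suc j) v \<in> chains F j"
  by (auto simp: chains_def diff_def)

lemma module_mapD:
  assumes "module_map F i G j \<phi>"
  shows "v \<in> chains F i \<Longrightarrow> \<phi> v \<in> chains G j"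
    and "v \<in> chains F i \<Longrightarrow> w \<in> chains F i \<Longrightarrow> \<phi> (\<lambda>b. v b + w b) = (\<lambda>b. \<phi> v b + \<phi> w b)"
    and "v \<in> chains F i \<Longrightarrow> \<phi> (\<lambda>b. s * v b) = (\<lambda>b. s * \<phi> v b)"
  using assms by (auto simp: module_map_def)

lemma module_map_0:
  assumes "module_map F i G j \<phi>"
  shows "\<phi> (\<lambda>b. 0) = (\<lambda>b. 0)"
  using module_mapD(3)[OF assms chains_0, of 0] by simp

lemma module_map_minus:
  assumes \<phi>: "module_map F i G j \<phi>" and v: "v \<in> chains F i" and w: "w \<in> chains F i"
  shows "\<phi> (\<lambda>b. v b - w b) = (\<lambda>b. \<phi> v b - \<phi> w b)"
proof -
  have "\<phi> (\<lambda>b. v b + (- 1) * w b) = (\<lambda>b. \<phi> v b + (- 1) * \<phi> w b)"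
    using module_mapD(2)[OF \<phi> v chains_scale[OF w], of "- 1"] module_mapD(3)[OF \<phi> w, of "- 1"]
    by simp
  then show ?thesis by simp
qed

lemma module_map_id: "module_map F i F i (\<lambda>v. v)"
  by (simp add: module_map_def)

lemma module_map_comp:
  assumes "module_map F i G j \<phi>" "module_map G j H k \<psi>"
  shows "module_map F i H k (\<lambda>v. \<psi> (\<phi> v))"
  using assms by (simp add: module_map_def)

lemma module_map_difference:
  assumes "module_map F i G j \<phi>" "module_map F i G j \<psi>"
  shows "module_map F i G j (\<lambda>v b. \<phi> v b - \<psi> v b)"
  unfolding module_map_def
  by (auto simp: module_mapD[OF assms(1)] module_mapD[OF assms(2)] chains_minus right_diff_distrib)

lemma graded_map_comp:
  assumes "module_map F i G j \<phi>" "graded_map F i G \<phi>" "graded_map G j H \<psi>"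
  shows "graded_map F i H (\<lambda>v. \<psi> (\<phi> v))"
  using assms by (simp add: module_map_def graded_map_def)

lemma module_map_sum:
  assumes \<phi>: "module_map F i G j \<phi>" and "finite I" and "\<And>k. k \<in> I \<Longrightarrow> v k \<in> chains F i"
  shows "\<phi> (\<lambda>b. \<Sum>k\<in>I. v k b) = (\<lambda>b. \<Sum>k\<in>I. \<phi> (v k) b)"
  using assms(2,3)
proof (induction I rule: finite_induct)
  case empty
  then show ?case by (simp add: module_map_0[OF \<phi>])
next
  case (insert k I)
  then show ?case
    by (simp add: module_mapD(2)[OF \<phi>] chains_sum)
qed

lemma chain_expand:
  assumes "finite (basis_in F i)" "v \<in> chains F i"
  shows "(\<lambda>c. \<Sum>b\<in>basis_in F i. v b * unit_vec b c) = v"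
proof
  fix c
  have "(\<Sum>b\<in>basis_in F i. v b * unit_vec b c) = (\<Sum>b\<in>basis_in F i. if b = c then v b else 0)"
    by (rule sum.cong) (auto simp: unit_vec_def)
  then show "(\<Sum>b\<in>basis_in F i. v b * unit_vec b c) = v c"
    using assms by (auto simp: chains_def)
qed

lemma module_map_expand:
  assumes fin: "finite (basis_in F i)" and \<phi>: "module_map F i G j \<phi>" and v: "v \<in> chains F i"
  shows "\<phi> v = (\<lambda>c. \<Sum>b\<in>basis_in F i. v b * \<phi> (unit_vec b) c)"
proof -
  have "\<phi> v = \<phi> (\<lambda>c. \<Sum>b\<in>basis_in F i. v b * unit_vec b c)"
    by (simp add: chain_expand[OF fin v])
  also have "\<dots> = (\<lambda>c. \<Sum>b\<in>basis_in F i. \<phi> (\<lambda>c. v b * unit_vec b c) c)"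
    by (rule module_map_sum[OF \<phi> fin]) (intro chains_scale chains_unit_vec)
  also have "\<dots> = (\<lambda>c. \<Sum>b\<in>basis_in F i. v b * \<phi> (unit_vec b) c)"
    using module_mapD(3)[OF \<phi> chains_unit_vec] by auto
  finally show ?thesis .
qed

lemma module_map_extension:
  assumes "\<And>b. b \<in> basis_in F i \<Longrightarrow> y b \<in> chains G j"
  shows "module_map F i G j (\<lambda>v c. \<Sum>b\<in>basis_in F i. v b * y b c)"
  unfolding module_map_def
proof (intro conjI ballI allI)
  fix v
  show "(\<lambda>c. \<Sum>b\<in>basis_in F i. v b * y b c) \<in> chains G j"
    by (intro chains_sum chains_scale assms)
next
  fix v w
  show "(\<lambda>c. \<Sum>b\<in>basis_in F i. (v b + w b) * y b c) =
      (\<lambda>c. (\<Sum>b\<in>basis_in F i. v b * y b c) + (\<Sum>b\<in>basis_in F i. w b * y b c))"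
    by (simp add: distrib_right sum.distrib)
next
  fix s v
  show "(\<lambda>c. \<Sum>b\<in>basis_in F i. s * v b * y b c) = (\<lambda>c. s * (\<Sum>b\<in>basis_in F i. v b * y b c))"
    by (simp add: sum_distrib_left mult.assoc)
qed

lemma homogeneous_entry: "homogeneous F d v \<longleftrightarrow> (\<forall>b. entry (mdeg F b) d (v b))"
  by (simp add: homogeneous_def entry_keys)

lemma homogeneous_unit_vec: "homogeneous F (mdeg F b) (unit_vec b)"
  by (simp add: homogeneous_entry unit_vec_def)

lemma graded_map_extension:
  fixes F :: "('a, 'v, 'k::field) mgcomplex" and G :: "('b, 'v, 'k) mgcomplex"
  assumes "\<And>b. b \<in> basis_in F i \<Longrightarrow> homogeneous G (mdeg F b) (y b)"
  shows "graded_map F i G (\<lambda>v c. \<Sum>b\<in>basis_in F i. v b * y b c)"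
  unfolding graded_map_def homogeneous_entry
proof (intro allI ballI impI entry_sum)
  fix d c b and v :: "'a \<Rightarrow> ('v, 'k) mpol"
  assume "\<forall>b. entry (mdeg F b) d (v b)" "b \<in> basis_in F i"
  then show "entry (mdeg G c) d (v b * y b c)"
    using assms[of b] by (intro entry_mult_commuted[of "mdeg F b"]) (auto simp: homogeneous_entry)
qed

lemma diff_module_map: "module_map F (Suc j) F j (diff F (Suc j))"
  unfolding module_map_def
  by (auto simp: diff_in_chains) 
    (auto simp: diff_def fun_eq_iff algebra_simps sum.distrib sum_distrib_left)

lemmas diff_0 = module_map_0[OF diff_module_map]
  and diff_minus = module_map_minus[OF diff_module_map]

lemma multigradedD:
  assumes "multigraded F"
  shows "finite (basis_in F j)"
    and "\<sigma> \<in> basis_in F (Suc j) \<Longrightarrow> \<tau> \<in> basis_in F j \<Longrightarrow> entry (mdeg F \<tau>) (mdeg F \<sigma>) (coef F \<tau> \<sigma>)"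
  using assms by (auto simp: multigraded_def entry_keys)

lemma diff_graded:
  assumes "multigraded F" "homogeneous F d v"
  shows "homogeneous F d (diff F (Suc j) v)"
  unfolding homogeneous_entry diff_def
proof
  fix \<tau>
  have "entry (mdeg F \<tau>) d (coef F \<tau> \<sigma> * v \<sigma>)"
    if "\<sigma> \<in> basis_in F (Suc j)" "\<tau> \<in> basis_in F j" for \<sigma>
    using multigradedD(2)[OF assms(1) that] assms(2) unfolding homogeneous_entry by (blast intro: entry_mult)
  then show "entry (mdeg F \<tau>) d
      (if \<tau> \<in> basis_in F (Suc j - 1) then \<Sum>\<sigma>\<in>basis_in F (Suc j). coef F \<tau> \<sigma> * v \<sigma> else 0)"
    by (simp add: entry_sum)
qed

definition component :: "('l, 'v, 'k::field) mgcomplex \<Rightarrow> 'v mon \<Rightarrow> ('l \<Rightarrow> ('v, 'k) mpol) \<Rightarrow> 'l \<Rightarrow> ('v, 'k) mpol" where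
  "component F d v = (\<lambda>b. part (mdeg F b) d (v b))"

lemma component_in_chains: "v \<in> chains F j \<Longrightarrow> component F d v \<in> chains F j"
  by (auto simp: component_def chains_def)

lemma homogeneous_component: "homogeneous F d (component F d v)"
  by (simp add: homogeneous_entry component_def)

lemma component_homogeneous: "homogeneous F d v \<Longrightarrow> component F d v = v"
  by (simp add: homogeneous_entry component_def part_entry)

lemma diff_component:
  assumes "multigraded F"
  shows "diff F (Suc j) (component F d v) = component F d (diff F (Suc j) v)"
proof
  fix \<tau>
  have "coef F \<tau> \<sigma> * part (mdeg F \<sigma>) d (v \<sigma>) = part (mdeg F \<tau>) d (coef F \<tau> \<sigma> * v \<sigma>)"
    if "\<sigma> \<in> basis_in F (Suc j)" "\<tau> \<in> basis_in F j" for \<sigma>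
    using part_mult[OF multigradedD(2)[OF assms that]] by simp
  then show "diff F (Suc j) (component F d v) \<tau> = component F d (diff F (Suc j) v) \<tau>"
    by (simp add: diff_def component_def part_sum)
qed

abbreviation (input) boundaries where
  "boundaries F j \<equiv> diff F (Suc j) ` chains F (Suc j)"

text \<open>The component of degree \<open>d\<close> of any preimage is a homogeneous preimage.\<close>

lemma homogeneous_boundary:
  assumes "multigraded F" "v \<in> boundaries F j" "homogeneous F d v"
  obtains w where "w \<in> chains F (Suc j)" "homogeneous F d w" "diff F (Suc j) w = v"
proof -
  obtain w where "w \<in> chains F (Suc j)" "v = diff F (Suc j) w"
    using assms by auto
  then show thesis
    using that[of "component F d w"] assms
    by (simp add: component_in_chains homogeneous_component diff_component component_homogeneous)
qed

text \<open>Free modules are projective: preimages of the images of the basis elements can be chosen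
  freely, and homogeneously if the map to be lifted is homogeneous.\<close>

lemma lift_through_diff:
  assumes fin: "finite (basis_in F i)" and G: "multigraded G"
    and \<phi>: "module_map F i G j \<phi>" and bd: "\<forall>v\<in>chains F i. \<phi> v \<in> boundaries G j"
  shows "\<exists>\<psi>. module_map F i G (Suc j) \<psi> \<and> (graded_map F i G \<phi> \<longrightarrow> graded_map F i G \<psi>) \<and>
    (\<forall>v\<in>chains F i. diff G (Suc j) (\<psi> v) = \<phi> v)"
proof -
  have "\<forall>b\<in>basis_in F i. \<exists>w\<in>chains G (Suc j). diff G (Suc j) w = \<phi> (unit_vec b) \<and>
      (graded_map F i G \<phi> \<longrightarrow> homogeneous G (mdeg F b) w)"
  proof
    fix b assume b: "b \<in> basis_in F i"
    show "\<exists>w\<in>chains G (Suc j). diff G (Suc j) w = \<phi> (unit_vec b) \<and>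
      (graded_map F i G \<phi> \<longrightarrow> homogeneous G (mdeg F b) w)"
    proof (cases "graded_map F i G \<phi>")
      case True
      then have "homogeneous G (mdeg F b) (\<phi> (unit_vec b))"
        using b by (simp add: graded_map_def chains_unit_vec homogeneous_unit_vec)
      then show ?thesis
        using homogeneous_boundary[OF G bspec[OF bd chains_unit_vec[OF b]]] by metis
    next
      case False
      then show ?thesis
        using bspec[OF bd chains_unit_vec[OF b]] by force
    qed
  qed
  then obtain y where y: "\<forall>b\<in>basis_in F i. y b \<in> chains G (Suc j) \<and> diff G (Suc j) (y b) = \<phi> (unit_vec b) \<and>
      (graded_map F i G \<phi> \<longrightarrow> homogeneous G (mdeg F b) (y b))"
    by metis
  define \<psi> where "\<psi> = (\<lambda>v c. \<Sum>b\<in>basis_in F i. v b * y b c)"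
  show ?thesis
  proof (intro exI conjI impI ballI)
    show "module_map F i G (Suc j) \<psi>"
      unfolding \<psi>_def using y by (intro module_map_extension) auto
    show "graded_map F i G \<psi>" if "graded_map F i G \<phi>"
      unfolding \<psi>_def using y that by (intro graded_map_extension) auto
    show "diff G (Suc j) (\<psi> v) = \<phi> v" if v: "v \<in> chains F i" for v
    proof -
      have "diff G (Suc j) (\<psi> v) = (\<lambda>c. \<Sum>b\<in>basis_in F i. diff G (Suc j) (\<lambda>c. v b * y b c) c)"
        unfolding \<psi>_def using y by (intro module_map_sum[OF diff_module_map fin] chains_scale) auto
      also have "\<dots> = (\<lambda>c. \<Sum>b\<in>basis_in F i. v b * \<phi> (unit_vec b) c)"
      proof (intro ext sum.cong)
        fix b c assume "b \<in> basis_in F i"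
        then show "diff G (Suc j) (\<lambda>c. v b * y b c) c = v b * \<phi> (unit_vec b) c"
          using module_mapD(3)[OF diff_module_map[of G j], of "y b" "v b"] y by simp
      qed simp
      also have "\<dots> = \<phi> v"
        using module_map_expand[OF fin \<phi> v] by simp
      finally show ?thesis .
    qed
  qed
qed

section \<open>Uniqueness of the minimal multigraded resolution\<close>

text \<open>The part of \<open>free_resolution\<close> that concerns homological degree 0, for a given augmentation;
  the remaining part is \<open>exact_complex\<close>.\<close>

definition augmentation ::
    "('l, 'v, 'k::field) mgcomplex \<Rightarrow> ('v, 'k) mpol set \<Rightarrow> ('l \<Rightarrow> ('v, 'k) mpol) \<Rightarrow> bool" where
  "augmentation F M e \<longleftrightarrow>
     (\<forall>b\<in>basis_in F 0. entry 0 (mdeg F b) (e b)) \<and>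
     (\<forall>s. \<exists>v\<in>chains F 0. s - augment F e v \<in> M) \<and>
     {v \<in> chains F 0. augment F e v \<in> M} = boundaries F 0"

definition exact_complex :: "('l, 'v, 'k::field) mgcomplex \<Rightarrow> bool" where
  "exact_complex F \<longleftrightarrow>
     (\<forall>j. {v \<in> chains F (Suc j). diff F (Suc j) v = (\<lambda>_. 0)} = boundaries F (Suc j))"

lemma free_resolution_iff:
  fixes F :: "('a, 'b, 'c::field) mgcomplex"
  shows "free_resolution F M \<longleftrightarrow> multigraded F \<and> (\<exists>e. augmentation F M e) \<and> exact_complex F"
proof -
  have "(\<forall>j\<ge>1. P j) \<longleftrightarrow> (\<forall>j. P (Suc j))" for P :: "nat \<Rightarrow> bool"
    by (metis One_nat_def Suc_le_mono le0 not0_implies_Suc not_one_le_zero)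
  moreover have "Poly_Mapping.keys p \<subseteq> {d} \<longleftrightarrow> entry 0 d p" for d and p :: "('b, 'c) mpol"
    by (auto simp: entry_keys)
  ultimately show ?thesis
    unfolding free_resolution_def augmentation_def exact_complex_def by simp
qed

lemma exact_complexD:
  assumes "exact_complex F"
  shows "v \<in> chains F (Suc j) \<Longrightarrow> diff F (Suc j) v = (\<lambda>_. 0) \<Longrightarrow> v \<in> boundaries F (Suc j)"
    and "v \<in> chains F (Suc (Suc j)) \<Longrightarrow> diff F (Suc j) (diff F (Suc (Suc j)) v) = (\<lambda>_. 0)"
  using assms unfolding exact_complex_def by blast+

lemma augment_minus: "augment F e (\<lambda>b. v b - w b) = augment F e v - augment F e w"
  and augment_scale: "augment F e (\<lambda>b. s * v b) = s * augment F e v"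
  unfolding augment_def by (simp_all add: algebra_simps sum.distrib sum_subtractf sum_distrib_left)

lemma augment_sum: "augment F e (\<lambda>b. \<Sum>i\<in>I. s i * u i b) = (\<Sum>i\<in>I. s i * augment F e (u i))"
  unfolding augment_def sum_distrib_left sum_distrib_right mult.assoc by (rule sum.swap)

lemma augment_component:
  assumes "\<forall>b\<in>basis_in F 0. entry 0 (mdeg F b) (e b)"
  shows "augment F e (component F d v) = part 0 d (augment F e v)"
  unfolding augment_def part_sum component_def
proof (rule sum.cong)
  fix b assume "b \<in> basis_in F 0"
  then show "part (mdeg F b) d (v b) * e b = part 0 d (v b * e b)"
    using assms part_mult_commuted by fastforce
qed simp

text \<open>The chain map is built degree by degree by lifting.  The property carried along is that the
  map built so far sends boundaries to boundaries.  In positive degrees it follows from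
  commutation with the differentials and exactness, in degree 0 from compatibility with the
  augmentations, since the boundaries there are the chains with augmentation in \<open>M\<close>.\<close>

lemma comparison:
  assumes M: "M = ideal_gen (monom ` X)"
    and F: "multigraded F" "exact_complex F" "augmentation F M e"
    and G: "multigraded G" "exact_complex G" "augmentation G M e'"
  obtains \<phi> where "\<And>j. module_map F j G j (\<phi> j)" "\<And>j. graded_map F j G (\<phi> j)"
    "\<And>j v. v \<in> chains F (Suc j) \<Longrightarrow> \<phi> j (diff F (Suc j) v) = diff G (Suc j) (\<phi> (Suc j) v)"
    "\<And>v. v \<in> chains F 0 \<Longrightarrow> augment F e v - augment G e' (\<phi> 0 v) \<in> M"
proof -
  note fin = multigradedD(1)[OF F(1)]
  define P where "P = (\<lambda>j \<phi>. module_map F j G j \<phi> \<and> graded_map F j G \<phi> \<and>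
    (\<forall>v\<in>chains F (Suc j). \<phi> (diff F (Suc j) v) \<in> boundaries G j) \<and>
    (j = 0 \<longrightarrow> (\<forall>v\<in>chains F 0. augment F e v - augment G e' (\<phi> v) \<in> M)))"
  define Q where "Q = (\<lambda>j \<phi> \<psi>.
    \<forall>v\<in>chains F (Suc j). \<phi> (diff F (Suc j) v) = diff G (Suc j) (\<psi> v))"
  have base: "\<exists>\<phi>. P 0 \<phi>"
  proof -
    have "\<forall>b\<in>basis_in F 0. \<exists>w\<in>chains G 0. homogeneous G (mdeg F b) w \<and> e b - augment G e' w \<in> M"
    proof
      fix b assume b: "b \<in> basis_in F 0"
      obtain v where v: "v \<in> chains G 0" "e b - augment G e' v \<in> M"
        using G(3) unfolding augmentation_def by blast
      have "part 0 (mdeg F b) (e b - augment G e' v) \<in> M"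
        using v(2) monomial_ideal_part M by auto
      moreover have "part 0 (mdeg F b) (e b - augment G e' v)
          = e b - augment G e' (component G (mdeg F b) v)"
      proof -
        have "part 0 (mdeg F b) (e b) = e b"
          using F(3) b by (intro part_entry) (auto simp: augmentation_def)
        moreover have "part 0 (mdeg F b) (e b - augment G e' v) =
            part 0 (mdeg F b) (e b) - part 0 (mdeg F b) (augment G e' v)"
          using part_add[of 0 "mdeg F b" "e b - augment G e' v" "augment G e' v"] by simp
        ultimately show ?thesis
          using augment_component[of G e' "mdeg F b" v] G(3) by (simp add: augmentation_def)
      qed
      ultimately show "\<exists>w\<in>chains G 0. homogeneous G (mdeg F b) w \<and> e b - augment G e' w \<in> M"
        using component_in_chains[OF v(1)] homogeneous_component by metis
    qed
    then obtain y where y: "\<And>b. b \<in> basis_in F 0 \<Longrightarrow> y b \<in> chains G 0"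
      "\<And>b. b \<in> basis_in F 0 \<Longrightarrow> homogeneous G (mdeg F b) (y b)"
      "\<And>b. b \<in> basis_in F 0 \<Longrightarrow> e b - augment G e' (y b) \<in> M"
      by metis
    define \<phi> where "\<phi> = (\<lambda>v c. \<Sum>b\<in>basis_in F 0. v b * y b c)"
    have mm: "module_map F 0 G 0 \<phi>"
      unfolding \<phi>_def using y by (intro module_map_extension)
    have aug: "augment F e v - augment G e' (\<phi> v) \<in> M" for v
    proof -
      have "augment F e v - augment G e' (\<phi> v) = (\<Sum>b\<in>basis_in F 0. v b * (e b - augment G e' (y b)))"
        unfolding \<phi>_def augment_sum by (simp add: augment_def algebra_simps sum_subtractf)
      also have "\<dots> \<in> M"
        using y(3) unfolding M by (intro ideal.span_sum ideal.span_scale)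
      finally show ?thesis .
    qed
    have "\<phi> (diff F (Suc 0) v) \<in> boundaries G 0" if v: "v \<in> chains F (Suc 0)" for v
    proof -
      have "augment F e (diff F (Suc 0) v) \<in> M"
        using F(3) v unfolding augmentation_def by blast
      with aug[of "diff F (Suc 0) v"] have "augment G e' (\<phi> (diff F (Suc 0) v)) \<in> M"
        unfolding M using ideal.span_diff by fastforce
      moreover have "\<phi> (diff F (Suc 0) v) \<in> chains G 0"
        using module_mapD(1)[OF mm diff_in_chains] .
      ultimately show ?thesis
        using G(3) unfolding augmentation_def by blast
    qed
    moreover have "graded_map F 0 G \<phi>"
      unfolding \<phi>_def using y by (intro graded_map_extension)
    ultimately show ?thesis
      using mm aug unfolding P_def by blast
  qed
  have step: "\<exists>\<psi>. P (Suc j) \<psi> \<and> Q j \<phi> \<psi>" if P: "P j \<phi>" for j \<phi>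
  proof -
    have mm: "module_map F (Suc j) G j (\<lambda>v. \<phi> (diff F (Suc j) v))"
      by (rule module_map_comp[OF diff_module_map]) (use P in \<open>simp add: P_def\<close>)
    have gr: "graded_map F (Suc j) G (\<lambda>v. \<phi> (diff F (Suc j) v))"
      using P diff_graded[OF F(1)] unfolding P_def graded_map_def by (simp add: diff_in_chains)
    have bd: "\<forall>v\<in>chains F (Suc j). \<phi> (diff F (Suc j) v) \<in> boundaries G j"
      using P unfolding P_def by (elim conjE)
    obtain \<psi> where \<psi>: "module_map F (Suc j) G (Suc j) \<psi>"
        "graded_map F (Suc j) G (\<lambda>v. \<phi> (diff F (Suc j) v)) \<longrightarrow> graded_map F (Suc j) G \<psi>"
        "\<forall>v\<in>chains F (Suc j). diff G (Suc j) (\<psi> v) = \<phi> (diff F (Suc j) v)"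
      using lift_through_diff[OF fin G(1) mm bd] by (elim exE conjE) (rule that)
    have "\<psi> (diff F (Suc (Suc j)) v) \<in> boundaries G (Suc j)" if v: "v \<in> chains F (Suc (Suc j))" for v
    proof (rule exact_complexD(1)[OF G(2)])
      show "\<psi> (diff F (Suc (Suc j)) v) \<in> chains G (Suc j)"
        by (rule module_mapD(1)[OF \<psi>(1) diff_in_chains])
      have "module_map F j G j \<phi>"
        using P by (simp add: P_def)
      then show "diff G (Suc j) (\<psi> (diff F (Suc (Suc j)) v)) = (\<lambda>_. 0)"
        using v by (simp add: bspec[OF \<psi>(3)] diff_in_chains exact_complexD(2)[OF F(2)] module_map_0)
    qed
    then have "P (Suc j) \<psi>"
      unfolding P_def using \<psi>(1) mp[OF \<psi>(2) gr] by simp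
    moreover have "Q j \<phi> \<psi>"
      using \<psi>(3) by (simp add: Q_def)
    ultimately show ?thesis
      by blast
  qed
  obtain \<phi> where PQ: "P j (\<phi> j)" "Q j (\<phi> j) (\<phi> (Suc j))" for j
    using dependent_nat_choice[of P Q, OF base step] by blast
  show thesis
  proof (rule that[of \<phi>])
    show "module_map F j G j (\<phi> j)" "graded_map F j G (\<phi> j)" for j
      using PQ(1)[of j] by (simp_all add: P_def)
    show "\<phi> j (diff F (Suc j) v) = diff G (Suc j) (\<phi> (Suc j) v)" if "v \<in> chains F (Suc j)" for j v
      using PQ(2)[of j] that unfolding Q_def by (rule bspec)
    show "augment F e v - augment G e' (\<phi> 0 v) \<in> M" if "v \<in> chains F 0" for v
      using PQ(1)[of 0] that by (simp add: P_def)
  qed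
qed

text \<open>In each degree, \<open>f - id - h d\<close> takes values in cycles by the choice of the preceding \<open>h\<close>; by
  exactness these are boundaries, and lifting gives the next \<open>h\<close>.\<close>

lemma homotopic_to_identity:
  assumes F: "multigraded F" "exact_complex F" "augmentation F M e"
    and f: "\<And>j. module_map F j F j (f j)"
    and chain: "\<And>j v. v \<in> chains F (Suc j) \<Longrightarrow> f j (diff F (Suc j) v) = diff F (Suc j) (f (Suc j) v)"
    and aug: "\<And>v. v \<in> chains F 0 \<Longrightarrow> augment F e (f 0 v) - augment F e v \<in> M"
  obtains h where "\<And>j. module_map F j F (Suc j) (h j)"
    "\<And>v. v \<in> chains F 0 \<Longrightarrow> (\<lambda>b. f 0 v b - v b) = diff F 1 (h 0 v)"
    "\<And>j v. v \<in> chains F (Suc j) \<Longrightarrow> (\<lambda>b. f (Suc j) v b - v b) =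
       (\<lambda>b. diff F (Suc (Suc j)) (h (Suc j) v) b + h j (diff F (Suc j) v) b)"
proof -
  note fin = multigradedD(1)[OF F(1)]
  define P where "P = (\<lambda>j h. module_map F j F (Suc j) h \<and>
    (\<forall>v\<in>chains F (Suc j). diff F (Suc j) (h (diff F (Suc j) v)) =
        (\<lambda>b. f j (diff F (Suc j) v) b - diff F (Suc j) v b)) \<and>
    (j = 0 \<longrightarrow> (\<forall>v\<in>chains F 0. (\<lambda>b. f 0 v b - v b) = diff F 1 (h v))))"
  define Q where "Q = (\<lambda>j h h'. \<forall>v\<in>chains F (Suc j). (\<lambda>b. f (Suc j) v b - v b) =
       (\<lambda>b. diff F (Suc (Suc j)) (h' v) b + h (diff F (Suc j) v) b))"
  have base: "\<exists>h. P 0 h"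
  proof -
    have mm: "module_map F 0 F 0 (\<lambda>v b. f 0 v b - v b)"
      by (rule module_map_difference[OF f module_map_id])
    have bd: "\<forall>v\<in>chains F 0. (\<lambda>b. f 0 v b - v b) \<in> boundaries F 0"
    proof
      fix v assume v: "v \<in> chains F 0"
      have "augment F e (\<lambda>b. f 0 v b - v b) \<in> M"
        using aug[OF v] by (simp add: augment_minus)
      then show "(\<lambda>b. f 0 v b - v b) \<in> boundaries F 0"
        using F(3) module_mapD(1)[OF mm v] unfolding augmentation_def by blast
    qed
    from lift_through_diff[OF fin F(1) mm bd] obtain h where "module_map F 0 F (Suc 0) h"
      "\<forall>v\<in>chains F 0. diff F (Suc 0) (h v) = (\<lambda>b. f 0 v b - v b)"
      by (elim exE conjE) (rule that)
    then have "P 0 h"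
      by (simp add: P_def diff_in_chains)
    then show ?thesis by blast
  qed
  have step: "\<exists>h'. P (Suc j) h' \<and> Q j h h'" if P: "P j h" for j h
  proof -
    have h: "module_map F j F (Suc j) h"
      using P by (simp add: P_def)
    define g where "g = (\<lambda>v b. f (Suc j) v b - v b - h (diff F (Suc j) v) b)"
    have mm: "module_map F (Suc j) F (Suc j) g"
      unfolding g_def
      by (intro module_map_difference f module_map_id module_map_comp[OF diff_module_map h])
    have bd: "\<forall>v\<in>chains F (Suc j). g v \<in> boundaries F (Suc j)"
    proof (rule ballI, rule exact_complexD(1)[OF F(2)])
      fix v assume v: "v \<in> chains F (Suc j)"
      show "g v \<in> chains F (Suc j)"
        using mm v by (rule module_mapD(1))
      have fv: "f (Suc j) v \<in> chains F (Suc j)" and hv: "h (diff F (Suc j) v) \<in> chains F (Suc j)"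
        using v by (auto intro!: module_mapD(1)[OF f] module_mapD(1)[OF h] diff_in_chains)
      have "diff F (Suc j) (g v) =
          (\<lambda>b. diff F (Suc j) (f (Suc j) v) b - diff F (Suc j) v b - diff F (Suc j) (h (diff F (Suc j) v)) b)"
        unfolding g_def using v fv hv by (simp add: diff_minus chains_minus)
      then show "diff F (Suc j) (g v) = (\<lambda>_. 0)"
        using P v by (simp add: P_def chain)
    qed
    from lift_through_diff[OF fin F(1) mm bd] obtain h' where h': "module_map F (Suc j) F (Suc (Suc j)) h'"
      "\<forall>v\<in>chains F (Suc j). diff F (Suc (Suc j)) (h' v) = g v"
      by (elim exE conjE) (rule that)
    have "diff F (Suc (Suc j)) (h' (diff F (Suc (Suc j)) v)) =
        (\<lambda>b. f (Suc j) (diff F (Suc (Suc j)) v) b - diff F (Suc (Suc j)) v b)"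
      if "v \<in> chains F (Suc (Suc j))" for v
      using that by (simp add: bspec[OF h'(2)] diff_in_chains g_def exact_complexD(2)[OF F(2)] module_map_0[OF h])
    then have "P (Suc j) h'"
      using h' by (simp add: P_def)
    moreover have "Q j h h'"
      by (simp add: Q_def bspec[OF h'(2)] g_def)
    ultimately show ?thesis by blast
  qed
  obtain h where PQ: "P j (h j)" "Q j (h j) (h (Suc j))" for j
    using dependent_nat_choice[of P Q, OF base step] by blast
  show thesis
  proof (rule that[of h])
    show "module_map F j F (Suc j) (h j)" for j
      using PQ(1)[of j] by (simp add: P_def)
    show "(\<lambda>b. f 0 v b - v b) = diff F 1 (h 0 v)" if "v \<in> chains F 0" for v
      using PQ(1)[of 0] that by (simp add: P_def)
    show "(\<lambda>b. f (Suc j) v b - v b) =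
        (\<lambda>b. diff F (Suc (Suc j)) (h (Suc j) v) b + h j (diff F (Suc j) v) b)"
      if "v \<in> chains F (Suc j)" for j v
      using PQ(2)[of j] that unfolding Q_def by (rule bspec)
  qed
qed

definition tdeg :: "('v::finite) mon \<Rightarrow> nat" where
  "tdeg m = (\<Sum>x\<in>UNIV. Poly_Mapping.lookup m x)"

lemma tdeg_add: "tdeg (a + b) = tdeg a + tdeg b"
  by (simp add: tdeg_def lookup_add sum.distrib)

lemma tdeg_eq_0: "tdeg a = 0 \<longleftrightarrow> a = 0"
proof -
  have "tdeg a = 0 \<longleftrightarrow> (\<forall>x. Poly_Mapping.lookup a x = 0)"
    by (simp add: tdeg_def)
  then show ?thesis
    by (metis poly_mapping_eqI lookup_zero)
qed

text \<open>Write \<open>f = id + N\<close>.  A nonzero entry of \<open>N\<close> is homogeneous without constant term, so it leads from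
  a basis element to one of strictly smaller total degree.  Hence \<open>N\<close> is strictly triangular with
  respect to the total degree, and the equation \<open>v + N v = w\<close> is solved by iteration.\<close>

lemma perturbed_identity_bij:
  fixes F :: "('l, 'v::finite, 'k::field) mgcomplex"
  assumes fin: "finite (basis_in F j)"
    and f: "module_map F j F j f" and gr: "graded_map F j F f"
    and small: "\<And>v b. v \<in> chains F j \<Longrightarrow> const_term (f v b - v b) = 0"
  shows "bij_betw f (chains F j) (chains F j)"
proof -
  define N where "N = (\<lambda>v b. f v b - v b)"
  have N: "module_map F j F j N"
    unfolding N_def by (rule module_map_difference[OF f module_map_id])
  define deg where "deg = (\<lambda>b. tdeg (mdeg F b))"
  define D where "D = Max (insert 0 (deg ` basis_in F j))"
  have D: "deg b \<le> D" if "b \<in> basis_in F j" for b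
    unfolding D_def using fin that by (intro Max_ge) auto
  have raise: "N (unit_vec b) c = 0" if b: "b \<in> basis_in F j" and le: "deg b \<le> deg c" for b c
  proof (rule ccontr)
    assume "N (unit_vec b) c \<noteq> 0"
    then obtain k where k: "Poly_Mapping.lookup (N (unit_vec b) c) k \<noteq> 0"
      by (metis poly_mapping_eqI lookup_zero)
    have "k \<noteq> 0"
      using k small[OF chains_unit_vec[OF b], of c] by (auto simp: N_def const_term_def)
    have "homogeneous F (mdeg F b) (f (unit_vec b))"
      using gr chains_unit_vec[OF b] homogeneous_unit_vec[of F b] unfolding graded_map_def by blast
    then have "entry (mdeg F c) (mdeg F b) (N (unit_vec b) c)"
      unfolding N_def using homogeneous_unit_vec[of F b] by (simp add: homogeneous_entry entry_diff)
    then have "mdeg F c + k = mdeg F b"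
      using k by (simp add: entry_def)
    then have "deg b = deg c + tdeg k"
      by (metis deg_def tdeg_add)
    with le \<open>k \<noteq> 0\<close> show False
      by (simp add: tdeg_eq_0)
  qed
  \<comment> \<open>\<open>V n v\<close> says that \<open>v\<close> vanishes in the \<open>n\<close> highest total degrees; \<open>N\<close> improves this by one degree.\<close>
  define V where "V = (\<lambda>n (v :: 'l \<Rightarrow> ('v, 'k) mpol). \<forall>b\<in>basis_in F j. D < deg b + n \<longrightarrow> v b = 0)"
  have V0: "V 0 v" for v
    using D by (fastforce simp: V_def)
  have VN: "V (Suc n) (N v)" if v: "v \<in> chains F j" and "V n v" for n v
    unfolding V_def
  proof safe
    fix c assume "c \<in> basis_in F j" "D < deg c + Suc n"
    then have "v b * N (unit_vec b) c = 0" if b: "b \<in> basis_in F j" for b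
      using raise[OF b, of c] \<open>V n v\<close> b unfolding V_def
      by (cases "deg b \<le> deg c") auto
    then show "N v c = 0"
      by (subst module_map_expand[OF fin N v]) simp
  qed
  have V_end: "v b = 0" if "v \<in> chains F j" "V (Suc D) v" for v b
    using that by (cases "b \<in> basis_in F j") (auto simp: V_def chains_def)
  have f_N: "f v = (\<lambda>b. v b + N v b)" for v
    by (simp add: N_def)
  have ker: "x = (\<lambda>_. 0)" if x: "x \<in> chains F j" "f x = (\<lambda>_. 0)" for x
  proof -
    have eq: "x b = - N x b" for b
      using fun_cong[OF x(2), of b] by (simp add: f_N eq_neg_iff_add_eq_0)
    have "V n x" for n
    proof (induction n)
      case 0
      show ?case by (rule V0)
    next
      case (Suc n)
      from VN[OF x(1) this] show ?case
        unfolding V_def using eq by simp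
    qed
    then show ?thesis
      using V_end[OF x(1)] by auto
  qed
  have "inj_on f (chains F j)"
  proof (rule inj_onI)
    fix v w assume vw: "v \<in> chains F j" "w \<in> chains F j" "f v = f w"
    then have "f (\<lambda>b. v b - w b) = (\<lambda>_. 0)"
      by (simp add: module_map_minus[OF f])
    from ker[OF _ this] vw show "v = w"
      by (simp add: chains_minus fun_eq_iff)
  qed
  moreover have "f ` chains F j = chains F j"
  proof safe
    fix v assume "v \<in> chains F j" then show "f v \<in> chains F j"
      by (rule module_mapD(1)[OF f])
  next
    fix w assume w: "w \<in> chains F j"
    \<comment> \<open>Successive approximations to a solution of \<open>v + N v = w\<close>; by \<open>VN\<close> they become stationary.\<close>
    define s where "s = (\<lambda>n. ((\<lambda>v b. w b - N v b) ^^ n) w)"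
    have s_Suc: "s (Suc n) = (\<lambda>b. w b - N (s n) b)" for n
      by (simp add: s_def)
    have s_chains: "s n \<in> chains F j" for n
    proof (induction n)
      case 0
      show ?case using w by (simp add: s_def)
    next
      case (Suc n)
      then show ?case
        unfolding s_Suc using w module_mapD(1)[OF N] by (intro chains_minus)
    qed
    have "V n (\<lambda>b. s n b - s (Suc n) b)" for n
    proof (induction n)
      case 0
      show ?case by (rule V0)
    next
      case (Suc n)
      have "N (\<lambda>b. s n b - s (Suc n) b) = (\<lambda>b. s (Suc (Suc n)) b - s (Suc n) b)"
        unfolding module_map_minus[OF N s_chains s_chains] s_Suc[of "Suc n"]
        by (subst (2) s_Suc) (simp add: fun_eq_iff)
      with VN[OF chains_minus[OF s_chains s_chains] Suc] show ?case
        by (simp add: V_def)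
    qed
    then have "s (Suc D) b = s (Suc (Suc D)) b" for b
      using V_end[OF chains_minus[OF s_chains s_chains]] by (metis right_minus_eq)
    then have "f (s (Suc D)) = w"
      unfolding f_N by (auto simp: fun_eq_iff s_Suc[of "Suc D"])
    then show "w \<in> f ` chains F j"
      using s_chains by blast
  qed
  ultimately show ?thesis
    by (simp add: bij_betw_def)
qed

text \<open>By the homotopy, \<open>f - id = d h + h d\<close>, and over a minimal complex every value of \<open>d\<close> lies in the
  maximal ideal times the module.  So \<open>f\<close> is the identity up to entries without constant term.\<close>

lemma minimal_endomorphism_bij:
  fixes F :: "('l, 'v::finite, 'k::field) mgcomplex"
  assumes F: "multigraded F" "exact_complex F" "augmentation F M e"
    and min: "minimal_free_resolution F M"
    and f: "\<And>j. module_map F j F j (f j)" "\<And>j. graded_map F j F (f j)"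
    and chain: "\<And>j v. v \<in> chains F (Suc j) \<Longrightarrow> f j (diff F (Suc j) v) = diff F (Suc j) (f (Suc j) v)"
    and aug: "\<And>v. v \<in> chains F 0 \<Longrightarrow> augment F e (f 0 v) - augment F e v \<in> M"
  shows "bij_betw (f j) (chains F j) (chains F j)"
proof (rule perturbed_identity_bij[OF multigradedD(1)[OF F(1)] f])
  note fin = multigradedD(1)[OF F(1)]
  obtain h where h: "\<And>j. module_map F j F (Suc j) (h j)"
    "\<And>v. v \<in> chains F 0 \<Longrightarrow> (\<lambda>b. f 0 v b - v b) = diff F 1 (h 0 v)"
    "\<And>j v. v \<in> chains F (Suc j) \<Longrightarrow> (\<lambda>b. f (Suc j) v b - v b) =
       (\<lambda>b. diff F (Suc (Suc j)) (h (Suc j) v) b + h j (diff F (Suc j) v) b)"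
    using homotopic_to_identity[OF F f(1) chain aug] by blast
  have dm: "const_term (diff F (Suc j) v b) = 0" if "v \<in> chains F (Suc j)" for j v b
    using min that by (auto simp: minimal_free_resolution_def in_max_ideal_iff)
  fix v b assume v: "v \<in> chains F j"
  show "const_term (f j v b - v b) = 0"
  proof (cases j)
    case 0
    then show ?thesis
      using fun_cong[OF h(2), of v b] v dm[OF module_mapD(1)[OF h(1)], of v 0] by simp
  next
    case (Suc i)
    have "const_term (h i (diff F (Suc i) v) b) = 0"
      by (subst module_map_expand[OF fin h(1) diff_in_chains]) (use v dm Suc in simp)
    then show ?thesis
      using fun_cong[OF h(3), of v i b] v dm[OF module_mapD(1)[OF h(1)], of v "Suc i"] Suc by simp
  qed
qed

text \<open>Both composites of the comparison maps in the two directions are endomorphisms over the identity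
  of \<open>S/M\<close>, hence bijective.\<close>

lemma minimal_free_resolution_unique:
  fixes F :: "('l, 'v::finite, 'k::field) mgcomplex" and G :: "('m, 'v, 'k) mgcomplex"
  assumes M: "M = ideal_gen (monom ` X)"
    and F: "minimal_free_resolution F M" and G: "minimal_free_resolution G M"
  shows "F \<cong>\<^sub>m G"
proof -
  obtain e where F': "multigraded F" "exact_complex F" "augmentation F M e"
    using F by (auto simp: minimal_free_resolution_def free_resolution_iff)
  obtain e' where G': "multigraded G" "exact_complex G" "augmentation G M e'"
    using G by (auto simp: minimal_free_resolution_def free_resolution_iff)
  obtain \<phi> where \<phi>: "\<And>j. module_map F j G j (\<phi> j)" "\<And>j. graded_map F j G (\<phi> j)"
    "\<And>j v. v \<in> chains F (Suc j) \<Longrightarrow> \<phi> j (diff F (Suc j) v) = diff G (Suc j) (\<phi> (Suc j) v)"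
    "\<And>v. v \<in> chains F 0 \<Longrightarrow> augment F e v - augment G e' (\<phi> 0 v) \<in> M"
    using comparison[OF M F' G'] by metis
  obtain \<psi> where \<psi>: "\<And>j. module_map G j F j (\<psi> j)" "\<And>j. graded_map G j F (\<psi> j)"
    "\<And>j v. v \<in> chains G (Suc j) \<Longrightarrow> \<psi> j (diff G (Suc j) v) = diff F (Suc j) (\<psi> (Suc j) v)"
    "\<And>v. v \<in> chains G 0 \<Longrightarrow> augment G e' v - augment F e (\<psi> 0 v) \<in> M"
    using comparison[OF M G' F'] by metis
  have neg: "p - q \<in> M \<Longrightarrow> q - r \<in> M \<Longrightarrow> r - p \<in> M" for p q r
    using ideal.span_neg[OF ideal.span_add, of "p - q" "monom ` X" "q - r"] by (simp add: M)
  have \<psi>\<phi>: "bij_betw (\<lambda>v. \<psi> j (\<phi> j v)) (chains F j) (chains F j)" for j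
  proof (rule minimal_endomorphism_bij[OF F' F])
    fix v assume "v \<in> chains F 0"
    then show "augment F e (\<psi> 0 (\<phi> 0 v)) - augment F e v \<in> M"
      by (intro neg[OF \<phi>(4) \<psi>(4)] module_mapD(1)[OF \<phi>(1)])
  qed (simp_all add: module_map_comp[OF \<phi>(1) \<psi>(1)] graded_map_comp[OF \<phi>(1,2) \<psi>(2)]
        \<phi>(3) \<psi>(3) module_mapD(1)[OF \<phi>(1)])
  have \<phi>\<psi>: "bij_betw (\<lambda>v. \<phi> j (\<psi> j v)) (chains G j) (chains G j)" for j
  proof (rule minimal_endomorphism_bij[OF G' G])
    fix v assume "v \<in> chains G 0"
    then show "augment G e' (\<phi> 0 (\<psi> 0 v)) - augment G e' v \<in> M"
      by (intro neg[OF \<psi>(4) \<phi>(4)] module_mapD(1)[OF \<psi>(1)])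
  qed (simp_all add: module_map_comp[OF \<psi>(1) \<phi>(1)] graded_map_comp[OF \<psi>(1,2) \<phi>(2)]
        \<phi>(3) \<psi>(3) module_mapD(1)[OF \<psi>(1)])
  have "bij_betw (\<phi> j) (chains F j) (chains G j)" for j
    unfolding bij_betw_def
  proof
    show "inj_on (\<phi> j) (chains F j)"
      using \<psi>\<phi>[of j] unfolding bij_betw_def inj_on_def by metis
    show "\<phi> j ` chains F j = chains G j"
    proof
      show "\<phi> j ` chains F j \<subseteq> chains G j"
        using module_mapD(1)[OF \<phi>(1)] by auto
      show "chains G j \<subseteq> \<phi> j ` chains F j"
      proof
        fix w assume "w \<in> chains G j"
        then have "w \<in> (\<lambda>v. \<phi> j (\<psi> j v)) ` chains G j"
          using \<phi>\<psi>[of j] by (simp add: bij_betw_def)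
        then show "w \<in> \<phi> j ` chains F j"
          using module_mapD(1)[OF \<psi>(1)] by auto
      qed
    qed
  qed
  then show ?thesis
    unfolding mg_iso_def using \<phi>(1-3) by (intro exI[of _ \<phi>]) (simp add: module_map_def graded_map_def)
qed


section \<open>Isomorphisms and direct sums\<close>

definition mg_iso_family :: "('a, 'v, 'k::field) mgcomplex \<Rightarrow> ('b, 'v, 'k) mgcomplex \<Rightarrow>
    (nat \<Rightarrow> ('a \<Rightarrow> ('v, 'k) mpol) \<Rightarrow> 'b \<Rightarrow> ('v, 'k) mpol) \<Rightarrow> bool" where
  "mg_iso_family F G \<phi> \<longleftrightarrow> (\<forall>j. module_map F j G j (\<phi> j) \<and> graded_map F j G (\<phi> j) \<and>
     bij_betw (\<phi> j) (chains F j) (chains G j) \<and>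
     (\<forall>v\<in>chains F (Suc j). \<phi> j (diff F (Suc j) v) = diff G (Suc j) (\<phi> (Suc j) v)))"

lemma mg_iso_iff: "F \<cong>\<^sub>m G \<longleftrightarrow> (\<exists>\<phi>. mg_iso_family F G \<phi>)"
proof -
  have "bij_betw \<phi> (chains F j) (chains G j) \<Longrightarrow> \<forall>v\<in>chains F j. \<phi> v \<in> chains G j" for \<phi> j
    by (auto dest: bij_betw_apply)
  then show ?thesis
    unfolding mg_iso_def mg_iso_family_def module_map_def graded_map_def
    by (intro ex_cong1 all_cong1) meson
qed

lemma mg_isoI:
  assumes "\<And>j. module_map F j G j (\<phi> j)" "\<And>j. graded_map F j G (\<phi> j)"
    "\<And>j. bij_betw (\<phi> j) (chains F j) (chains G j)"
    "\<And>j v. v \<in> chains F (Suc j) \<Longrightarrow> \<phi> j (diff F (Suc j) v) = diff G (Suc j) (\<phi> (Suc j) v)"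
  shows "F \<cong>\<^sub>m G"
  unfolding mg_iso_iff mg_iso_family_def using assms by (intro exI[of _ \<phi>]) simp

lemma mg_iso_familyD:
  assumes "mg_iso_family F G \<phi>"
  shows "module_map F j G j (\<phi> j)" "graded_map F j G (\<phi> j)"
    "bij_betw (\<phi> j) (chains F j) (chains G j)"
    "v \<in> chains F (Suc j) \<Longrightarrow> \<phi> j (diff F (Suc j) v) = diff G (Suc j) (\<phi> (Suc j) v)"
  using assms by (simp_all add: mg_iso_family_def)

lemma mg_iso_trans [trans]:
  assumes "F \<cong>\<^sub>m G" "G \<cong>\<^sub>m H"
  shows "F \<cong>\<^sub>m H"
proof -
  obtain \<phi> where "mg_iso_family F G \<phi>"
    using assms(1) by (auto simp: mg_iso_iff)
  note \<phi> = mg_iso_familyD[OF this]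
  obtain \<psi> where "mg_iso_family G H \<psi>"
    using assms(2) by (auto simp: mg_iso_iff)
  note \<psi> = mg_iso_familyD[OF this]
  show ?thesis
  proof (rule mg_isoI[of F H "\<lambda>j v. \<psi> j (\<phi> j v)"])
    fix j
    show "bij_betw (\<lambda>v. \<psi> j (\<phi> j v)) (chains F j) (chains H j)"
      using bij_betw_trans[OF \<phi>(3) \<psi>(3)] by (simp add: o_def)
  qed (simp_all add: module_map_comp[OF \<phi>(1) \<psi>(1)] graded_map_comp[OF \<phi>(1,2) \<psi>(2)]
      \<phi>(4) \<psi>(4) module_mapD(1)[OF \<phi>(1)])
qed

text \<open>Direct sums nested in different ways have different types of labels; this lemma identifies them.\<close>

lemma mg_iso_relabel:
  fixes F :: "('a, 'v, 'k::field) mgcomplex" and G :: "('b, 'v, 'k) mgcomplex"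
  assumes \<beta>: "bij_betw \<beta> (basis G) (basis F)"
    and h: "\<And>g. g \<in> basis G \<Longrightarrow> hdeg F (\<beta> g) = hdeg G g"
    and m: "\<And>g. g \<in> basis G \<Longrightarrow> mdeg F (\<beta> g) = mdeg G g"
    and c: "\<And>g g'. g \<in> basis G \<Longrightarrow> g' \<in> basis G \<Longrightarrow> coef F (\<beta> g) (\<beta> g') = coef G g g'"
  shows "F \<cong>\<^sub>m G"
proof -
  have \<beta>j: "bij_betw \<beta> (basis_in G j) (basis_in F j)" for j
    unfolding bij_betw_def
  proof
    show "inj_on \<beta> (basis_in G j)"
      by (rule inj_on_subset[OF bij_betw_imp_inj_on[OF \<beta>]]) (simp add: basis_in_def)
    have "basis F = \<beta> ` basis G"
      using \<beta> by (simp add: bij_betw_def)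
    then show "\<beta> ` basis_in G j = basis_in F j"
      by (auto simp: basis_in_def h)
  qed
  then have in_basis: "\<beta> g \<in> basis_in F j" if "g \<in> basis_in G j" for g j
    using that bij_betw_apply by metis
  define \<phi> where "\<phi> = (\<lambda>(v :: 'a \<Rightarrow> ('v, 'k) mpol) g. if g \<in> basis G then v (\<beta> g) else 0)"
  show ?thesis
  proof (rule mg_isoI[of F G "\<lambda>_. \<phi>"])
    fix j
    show mm: "module_map F j G j \<phi>"
      unfolding module_map_def
    proof (intro conjI ballI allI)
      fix v assume v: "v \<in> chains F j"
      have "v (\<beta> g) = 0" if "g \<in> basis G" "g \<notin> basis_in G j" for g
        using chains_eq_0[OF v, of "\<beta> g"] that h[OF that(1)] by (simp add: basis_in_def)
      then show "\<phi> v \<in> chains G j"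
        by (simp add: chains_def \<phi>_def)
    qed (simp_all add: \<phi>_def fun_eq_iff)
    show "graded_map F j G \<phi>"
      unfolding graded_map_def
    proof (intro allI ballI impI)
      fix d v assume "homogeneous F d v"
      then have "entry (mdeg F (\<beta> g)) d (v (\<beta> g))" for g
        by (simp add: homogeneous_entry)
      then show "homogeneous G d (\<phi> v)"
        by (simp add: homogeneous_entry \<phi>_def m[symmetric])
    qed
    show "bij_betw \<phi> (chains F j) (chains G j)"
    proof (rule bij_betw_imageI)
      show "inj_on \<phi> (chains F j)"
      proof (rule inj_onI, rule ext)
        fix v w b assume vw: "v \<in> chains F j" "w \<in> chains F j" "\<phi> v = \<phi> w"
        show "v b = w b"
        proof (cases "b \<in> basis_in F j")
          case True
          then obtain g where "g \<in> basis_in G j" "b = \<beta> g"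
            using \<beta>j[of j] by (auto simp: bij_betw_def)
          then show ?thesis
            using fun_cong[OF vw(3), of g] by (simp add: \<phi>_def basis_in_def)
        qed (use vw in \<open>simp add: chains_def\<close>)
      qed
      show "\<phi> ` chains F j = chains G j"
      proof
        show "\<phi> ` chains F j \<subseteq> chains G j"
          using module_mapD(1)[OF mm] by blast
        show "chains G j \<subseteq> \<phi> ` chains F j"
        proof
          fix w assume w: "w \<in> chains G j"
          define v where "v = (\<lambda>b. if b \<in> basis_in F j then w (inv_into (basis_in G j) \<beta> b) else 0)"
          have "\<phi> v = w"
          proof
            fix g
            show "\<phi> v g = w g"
            proof (cases "g \<in> basis_in G j")
              case True
              then have "inv_into (basis_in G j) \<beta> (\<beta> g) = g"
                using \<beta>j[of j] by (auto simp: bij_betw_def)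
              with True show ?thesis
                using in_basis[OF True] by (simp add: \<phi>_def v_def) (simp add: basis_in_def)
            next
              case False
              then have "g \<in> basis G \<Longrightarrow> \<beta> g \<notin> basis_in F j"
                using h by (auto simp: basis_in_def)
              with False w show ?thesis
                by (auto simp: \<phi>_def v_def chains_def)
            qed
          qed
          moreover have "v \<in> chains F j"
            by (simp add: v_def chains_def)
          ultimately show "w \<in> \<phi> ` chains F j"
            by blast
        qed
      qed
    qed
    fix v assume "v \<in> chains F (Suc j)"
    show "\<phi> (diff F (Suc j) v) = diff G (Suc j) (\<phi> v)"
    proof
      fix g
      show "\<phi> (diff F (Suc j) v) g = diff G (Suc j) (\<phi> v) g"
      proof (cases "g \<in> basis_in G j")
        case True
        have "(\<Sum>b\<in>basis_in F (Suc j). coef F (\<beta> g) b * v b) =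
            (\<Sum>g'\<in>basis_in G (Suc j). coef F (\<beta> g) (\<beta> g') * v (\<beta> g'))"
          by (rule sum.reindex_bij_betw[OF \<beta>j, symmetric])
        also have "\<dots> = (\<Sum>g'\<in>basis_in G (Suc j). coef G g g' * \<phi> v g')"
          using True by (intro sum.cong) (auto simp: \<phi>_def basis_in_def c)
        finally show ?thesis
          using True in_basis[OF True] by (simp add: diff_def \<phi>_def) (simp add: basis_in_def)
      next
        case False
        then have "g \<in> basis G \<Longrightarrow> \<beta> g \<notin> basis_in F j"
          using h by (auto simp: basis_in_def)
        with False show ?thesis
          by (auto simp: \<phi>_def diff_def)
      qed
    qed
  qed
qed

lemma basis_in_dsum: "basis_in (dsum F X) j = basis_in F j <+> basis_in X j"
  by (auto simp: basis_in_def dsum_def)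

lemma chains_dsum:
  "v \<in> chains (dsum F X) j \<longleftrightarrow> (\<lambda>b. v (Inl b)) \<in> chains F j \<and> (\<lambda>b. v (Inr b)) \<in> chains X j"
  unfolding chains_def basis_in_dsum by (auto simp: split_sum_all)

lemma homogeneous_dsum:
  "homogeneous (dsum F X) d v \<longleftrightarrow> homogeneous F d (\<lambda>b. v (Inl b)) \<and> homogeneous X d (\<lambda>b. v (Inr b))"
  unfolding homogeneous_def by (auto simp: split_sum_all dsum_def)

lemma diff_dsum:
  assumes "finite (basis_in F (Suc j))" "finite (basis_in X (Suc j))"
  shows "diff (dsum F X) (Suc j) v =
    case_sum (diff F (Suc j) (\<lambda>b. v (Inl b))) (diff X (Suc j) (\<lambda>b. v (Inr b)))"
proof
  fix b show "diff (dsum F X) (Suc j) v b =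
    case_sum (diff F (Suc j) (\<lambda>b. v (Inl b))) (diff X (Suc j) (\<lambda>b. v (Inr b))) b"
    unfolding diff_def basis_in_dsum
    by (cases b) (auto simp: sum.Plus assms dsum_def)
qed

lemma sum_fun_eq: "(\<lambda>b. v (Inl b)) = f \<Longrightarrow> (\<lambda>b. v (Inr b)) = g \<Longrightarrow> v = case_sum f g"
  by (auto simp: fun_eq_iff split: sum.splits)

lemma mg_iso_dsum_left:
  fixes F :: "('a, 'v, 'k::field) mgcomplex" and G :: "('b, 'v, 'k) mgcomplex"
    and X :: "('c, 'v, 'k) mgcomplex"
  assumes "F \<cong>\<^sub>m G"
    and fin: "\<And>j. finite (basis_in F j)" "\<And>j. finite (basis_in G j)" "\<And>j. finite (basis_in X j)"
  shows "dsum F X \<cong>\<^sub>m dsum G X"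
proof -
  obtain \<phi> where "mg_iso_family F G \<phi>"
    using assms(1) by (auto simp: mg_iso_iff)
  note \<phi> = mg_iso_familyD[OF this]
  define \<psi> where "\<psi> = (\<lambda>j (v :: 'a + 'c \<Rightarrow> ('v, 'k) mpol).
    case_sum (\<phi> j (\<lambda>b. v (Inl b))) (\<lambda>b. v (Inr b)))"
  have \<psi>_simps: "(\<lambda>b. \<psi> j v (Inl b)) = \<phi> j (\<lambda>b. v (Inl b))" "(\<lambda>b. \<psi> j v (Inr b)) = (\<lambda>b. v (Inr b))" for j v
    by (simp_all add: \<psi>_def)
  show ?thesis
  proof (rule mg_isoI[of _ _ \<psi>])
    fix j
    show mm: "module_map (dsum F X) j (dsum G X) j (\<psi> j)"
      unfolding module_map_def
    proof (intro conjI ballI allI)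
      fix v assume v: "v \<in> chains (dsum F X) j"
      then show "\<psi> j v \<in> chains (dsum G X) j"
        using module_mapD(1)[OF \<phi>(1)] by (simp add: chains_dsum \<psi>_simps)
      show "\<psi> j (\<lambda>b. s * v b) = (\<lambda>b. s * \<psi> j v b)" for s
        using v by (auto simp: \<psi>_def chains_dsum module_mapD(3)[OF \<phi>(1)] fun_eq_iff split: sum.splits)
      fix w assume "w \<in> chains (dsum F X) j"
      with v show "\<psi> j (\<lambda>b. v b + w b) = (\<lambda>b. \<psi> j v b + \<psi> j w b)"
        by (auto simp: \<psi>_def chains_dsum module_mapD(2)[OF \<phi>(1)] fun_eq_iff split: sum.splits)
    qed
    show "graded_map (dsum F X) j (dsum G X) (\<psi> j)"
      using \<phi>(2)[of j] by (simp add: graded_map_def homogeneous_dsum chains_dsum \<psi>_simps)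
    show "bij_betw (\<psi> j) (chains (dsum F X) j) (chains (dsum G X) j)"
    proof (rule bij_betw_imageI)
      show "inj_on (\<psi> j) (chains (dsum F X) j)"
      proof (rule inj_onI)
        fix v w assume vw: "v \<in> chains (dsum F X) j" "w \<in> chains (dsum F X) j" "\<psi> j v = \<psi> j w"
        have "\<phi> j (\<lambda>b. v (Inl b)) = \<phi> j (\<lambda>b. w (Inl b))" "(\<lambda>b. v (Inr b)) = (\<lambda>b. w (Inr b))"
          unfolding \<psi>_simps(1)[of j, symmetric] \<psi>_simps(2)[of j, symmetric] vw(3) by (rule refl)+
        moreover from this have "(\<lambda>b. v (Inl b)) = (\<lambda>b. w (Inl b))"
          using \<phi>(3)[of j] vw(1,2) by (auto simp: bij_betw_def chains_dsum dest: inj_onD)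
        ultimately show "v = w"
          by (metis sum_fun_eq)
      qed
      show "\<psi> j ` chains (dsum F X) j = chains (dsum G X) j"
      proof
        show "\<psi> j ` chains (dsum F X) j \<subseteq> chains (dsum G X) j"
          using module_mapD(1)[OF mm] by blast
        show "chains (dsum G X) j \<subseteq> \<psi> j ` chains (dsum F X) j"
        proof
          fix w assume w: "w \<in> chains (dsum G X) j"
          then have "(\<lambda>b. w (Inl b)) \<in> \<phi> j ` chains F j"
            using \<phi>(3)[of j] by (simp add: bij_betw_def chains_dsum)
          then obtain v where v: "v \<in> chains F j" "\<phi> j v = (\<lambda>b. w (Inl b))"
            by auto
          have "\<psi> j (case_sum v (\<lambda>b. w (Inr b))) = w"
            using v(2) by (auto simp: \<psi>_def fun_eq_iff split: sum.splits)
          moreover have "case_sum v (\<lambda>b. w (Inr b)) \<in> chains (dsum F X) j"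
            using v(1) w by (simp add: chains_dsum)
          ultimately show "w \<in> \<psi> j ` chains (dsum F X) j"
            by force
        qed
      qed
    qed
    fix v assume "v \<in> chains (dsum F X) (Suc j)"
    then show "\<psi> j (diff (dsum F X) (Suc j) v) = diff (dsum G X) (Suc j) (\<psi> (Suc j) v)"
      by (simp add: diff_dsum fin \<psi>_simps) (simp add: \<psi>_def \<phi>(4) chains_dsum)
  qed
qed

text \<open>A cycle of the summand, padded with zeros, is a cycle of the sum, and the projection of a chain
  that bounds it bounds the original cycle.\<close>

lemma exact_summand:
  fixes F :: "('a, 'v, 'k::field) mgcomplex"
  assumes iso: "F \<cong>\<^sub>m dsum G X" and exact: "exact_complex F"
    and fin: "\<And>j. finite (basis_in G j)" "\<And>j. finite (basis_in X j)"
  shows "exact_complex G"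
proof -
  obtain \<phi> where "mg_iso_family F (dsum G X) \<phi>"
    using iso by (auto simp: mg_iso_iff)
  note \<phi> = mg_iso_familyD[OF this]
  have pre: "\<exists>w\<in>chains F j. \<phi> j w = case_sum v (\<lambda>_. 0)" if "v \<in> chains G j" for v j
  proof -
    have "case_sum v (\<lambda>_. 0) \<in> chains (dsum G X) j"
      using that by (simp add: chains_dsum chains_0)
    then show ?thesis
      using \<phi>(3)[of j] unfolding bij_betw_def by (metis imageE)
  qed
  have d: "diff (dsum G X) (Suc j) (case_sum v (\<lambda>_. 0)) = case_sum (diff G (Suc j) v) (\<lambda>_. 0)" for j v
    by (simp add: diff_dsum fin diff_0)
  have zero: "case_sum v (\<lambda>_. 0) = (\<lambda>_. 0) \<longleftrightarrow> v = (\<lambda>_. 0)" for v :: "'b \<Rightarrow> ('v, 'k) mpol"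
    by (auto simp: fun_eq_iff split_sum_all)
  show ?thesis
    unfolding exact_complex_def
  proof (intro allI equalityI subsetI)
    fix j v assume "v \<in> {v \<in> chains G (Suc j). diff G (Suc j) v = (\<lambda>_. 0)}"
    then have v: "v \<in> chains G (Suc j)" "diff G (Suc j) v = (\<lambda>_. 0)"
      by auto
    obtain w where w: "w \<in> chains F (Suc j)" "\<phi> (Suc j) w = case_sum v (\<lambda>_. 0)"
      using pre[OF v(1)] by blast
    have "\<phi> j (diff F (Suc j) w) = \<phi> j (\<lambda>_. 0)"
      using v(2) by (simp add: \<phi>(4) w d zero module_map_0[OF \<phi>(1)])
    then have "diff F (Suc j) w = (\<lambda>_. 0)"
      using \<phi>(3)[of j] diff_in_chains chains_0 unfolding bij_betw_def inj_on_def by metis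
    then obtain x where x: "x \<in> chains F (Suc (Suc j))" "w = diff F (Suc (Suc j)) x"
      using exact_complexD(1)[OF exact w(1)] by blast
    have "case_sum v (\<lambda>_. 0) = diff (dsum G X) (Suc (Suc j)) (\<phi> (Suc (Suc j)) x)"
      using \<phi>(4)[OF x(1)] w(2) x(2) by simp
    then have "v = diff G (Suc (Suc j)) (\<lambda>b. \<phi> (Suc (Suc j)) x (Inl b))"
      by (auto simp: diff_dsum fin fun_eq_iff split_sum_all)
    moreover have "(\<lambda>b. \<phi> (Suc (Suc j)) x (Inl b)) \<in> chains G (Suc (Suc j))"
      using module_mapD(1)[OF \<phi>(1) x(1)] by (simp add: chains_dsum)
    ultimately show "v \<in> boundaries G (Suc j)"
      by blast
  next
    fix j v assume "v \<in> boundaries G (Suc j)"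
    then obtain x where x: "x \<in> chains G (Suc (Suc j))" "v = diff G (Suc (Suc j)) x"
      by blast
    obtain w where w: "w \<in> chains F (Suc (Suc j))" "\<phi> (Suc (Suc j)) w = case_sum x (\<lambda>_. 0)"
      using pre[OF x(1)] by blast
    have "case_sum (diff G (Suc j) v) (\<lambda>_. 0) =
        diff (dsum G X) (Suc j) (diff (dsum G X) (Suc (Suc j)) (\<phi> (Suc (Suc j)) w))"
      by (simp add: w d x)
    also have "\<dots> = \<phi> j (diff F (Suc j) (diff F (Suc (Suc j)) w))"
      by (simp add: \<phi>(4) w(1) diff_in_chains)
    also have "\<dots> = (\<lambda>_. 0)"
      by (simp add: exact_complexD(2)[OF exact w(1)] module_map_0[OF \<phi>(1)])
    finally show "v \<in> {v \<in> chains G (Suc j). diff G (Suc j) v = (\<lambda>_. 0)}"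
      by (simp add: zero x diff_in_chains)
  qed
qed

lemma dsum_empty_iso:
  fixes C :: "'i \<Rightarrow> ('l, 'v, 'k::field) mgcomplex"
  shows "F \<cong>\<^sub>m dsum F (big_dsum {} C)"
  by (rule mg_iso_relabel[where \<beta> = "case_sum id undefined"])
    (auto simp: bij_betw_def inj_on_def dsum_def big_dsum_def Plus_def image_image)

text \<open>Moves the most recently split summand into the indexed sum; it drives the induction over the list of
  cancellations.\<close>

lemma big_dsum_insert_iso:
  fixes C :: "'i \<Rightarrow> ('l, 'v, 'k::field) mgcomplex" and F :: "('m, 'v, 'k) mgcomplex"
  assumes p: "p \<notin> I"
  shows "dsum (dsum F (big_dsum I C)) (C p) \<cong>\<^sub>m dsum F (big_dsum (insert p I) C)"
proof (rule mg_iso_relabel)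
  define \<beta> :: "'m + 'i \<times> 'l \<Rightarrow> ('m + 'i \<times> 'l) + 'l" where
    "\<beta> = case_sum (\<lambda>b. Inl (Inl b)) (\<lambda>(i, b). if i = p then Inr b else Inl (Inr (i, b)))"
  show "bij_betw \<beta> (basis (dsum F (big_dsum (insert p I) C))) (basis (dsum (dsum F (big_dsum I C)) (C p)))"
    unfolding bij_betw_def
  proof
    show "inj_on \<beta> (basis (dsum F (big_dsum (insert p I) C)))"
      by (auto simp: inj_on_def \<beta>_def dsum_def big_dsum_def split: if_splits)
    show "\<beta> ` basis (dsum F (big_dsum (insert p I) C)) = basis (dsum (dsum F (big_dsum I C)) (C p))"
    proof (intro equalityI subsetI)
      fix x assume "x \<in> \<beta> ` basis (dsum F (big_dsum (insert p I) C))"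
      then show "x \<in> basis (dsum (dsum F (big_dsum I C)) (C p))"
        by (auto simp: \<beta>_def dsum_def big_dsum_def split: if_splits)
    next
      fix x assume x: "x \<in> basis (dsum (dsum F (big_dsum I C)) (C p))"
      then consider b where "x = Inl (Inl b)" "b \<in> basis F"
        | i b where "x = Inl (Inr (i, b))" "i \<in> I" "b \<in> basis (C i)"
        | b where "x = Inr b" "b \<in> basis (C p)"
        by (auto simp: dsum_def big_dsum_def)
      then show "x \<in> \<beta> ` basis (dsum F (big_dsum (insert p I) C))"
      proof cases
        case 1
        then show ?thesis
          by (intro image_eqI[of _ _ "Inl b"]) (auto simp: \<beta>_def dsum_def)
      next
        case 2
        with p have "i \<noteq> p" by auto
        with 2 show ?thesis
          by (intro image_eqI[of _ _ "Inr (i, b)"]) (auto simp: \<beta>_def dsum_def big_dsum_def)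
      next
        case 3
        then show ?thesis
          by (intro image_eqI[of _ _ "Inr (p, b)"]) (auto simp: \<beta>_def dsum_def big_dsum_def)
      qed
    qed
  qed
qed (use p in \<open>auto simp: dsum_def big_dsum_def split: if_splits\<close>)

lemma finite_basis_big_dsum:
  assumes "finite I" "\<And>i. i \<in> I \<Longrightarrow> finite (basis (C i))"
  shows "finite (basis_in (big_dsum I C) j)"
  by (rule finite_subset[of _ "SIGMA i:I. basis (C i)"])
    (use assms in \<open>auto simp: basis_in_def big_dsum_def\<close>)


section \<open>One standard cancellation\<close>

text \<open>The new matrix is the Schur complement of the pivot \<open>a\<^sub>\<tau>\<^sub>\<sigma>\<close>, whose inverse is \<open>u\<close>.  The case
  distinction is needed because only the differential out of the degree of \<open>\<sigma>\<close> is corrected; in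
  the adjacent degrees the change of basis merely drops a row or a column.\<close>

definition cancel :: "('l, 'v, 'k::field) mgcomplex \<Rightarrow> 'l \<Rightarrow> 'l \<Rightarrow> ('v, 'k) mpol \<Rightarrow> ('l, 'v, 'k) mgcomplex" where
  "cancel F \<sigma> \<tau> u = F\<lparr>basis := basis F - {\<sigma>, \<tau>},
     coef := (\<lambda>\<pi> \<theta>. if hdeg F \<theta> = hdeg F \<sigma>
       then coef F \<pi> \<theta> - coef F \<pi> \<sigma> * u * coef F \<tau> \<theta> else coef F \<pi> \<theta>)\<rparr>"

lemma diff_unit_vec:
  assumes "finite (basis_in F (Suc j))" "\<theta> \<in> basis_in F (Suc j)"
  shows "diff F (Suc j) (unit_vec \<theta>) = (\<lambda>b. if b \<in> basis_in F j then coef F b \<theta> else 0)"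
proof
  fix b
  have "(\<Sum>\<sigma>\<in>basis_in F (Suc j). coef F b \<sigma> * unit_vec \<theta> \<sigma>) =
      (\<Sum>\<sigma>\<in>basis_in F (Suc j). if \<sigma> = \<theta> then coef F b \<sigma> else 0)"
    by (rule sum.cong) (auto simp: unit_vec_def)
  then show "diff F (Suc j) (unit_vec \<theta>) b = (if b \<in> basis_in F j then coef F b \<theta> else 0)"
    using assms by (simp add: diff_def)
qed

text \<open>A unit of the polynomial ring is a constant, so a homogeneous pivot joins basis elements of the same
  multidegree and its inverse is constant too; the locale takes both facts as assumptions.\<close>

locale cancellation =
  fixes F :: "('l, 'v, 'k::field) mgcomplex" and \<sigma> \<tau> :: 'l and u :: "('v, 'k) mpol"
    and M :: "('v, 'k) mpol set" and e :: "'l \<Rightarrow> ('v, 'k) mpol" and X :: "'v mon set"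
  assumes M: "M = ideal_gen (monom ` X)"
    and multigraded: "multigraded F" and exact: "exact_complex F" and aug: "augmentation F M e"
    and \<sigma>: "\<sigma> \<in> basis F" and \<tau>: "\<tau> \<in> basis F"
    and hdeg: "hdeg F \<sigma> = Suc (hdeg F \<tau>)" and mdeg: "mdeg F \<sigma> = mdeg F \<tau>"
    and u: "coef F \<tau> \<sigma> * u = 1" and u_const: "entry 0 0 u"
begin

abbreviation (input) "F' \<equiv> cancel F \<sigma> \<tau> u"
abbreviation (input) "S \<equiv> short_complex F (\<sigma>, \<tau>)"

lemmas fin = multigradedD(1)[OF multigraded]

lemma F'_simps [simp]:
  "basis F' = basis F - {\<sigma>, \<tau>}" "hdeg F' = hdeg F" "mdeg F' = mdeg F"
  "coef F' \<pi> \<theta> = (if hdeg F \<theta> = hdeg F \<sigma>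
       then coef F \<pi> \<theta> - coef F \<pi> \<sigma> * u * coef F \<tau> \<theta> else coef F \<pi> \<theta>)"
  by (simp_all add: cancel_def)

lemma S_simps [simp]:
  "basis S = {\<sigma>, \<tau>}" "hdeg S = hdeg F" "mdeg S = mdeg F"
  "coef S \<pi> \<theta> = (if \<pi> = \<tau> \<and> \<theta> = \<sigma> then 1 else 0)"
  by (simp_all add: short_complex_def)

lemma basis_in_F': "basis_in F' j = basis_in F j - {\<sigma>, \<tau>}"
  by (auto simp: basis_in_def)

lemma fin': "finite (basis_in F' j)"
  by (simp add: basis_in_F' fin)

lemma \<sigma>_in: "\<sigma> \<in> basis_in F (Suc (hdeg F \<tau>))" and \<tau>_in: "\<tau> \<in> basis_in F (hdeg F \<tau>)"
  and \<sigma>_\<tau>: "\<sigma> \<noteq> \<tau>"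
  using \<sigma> \<tau> hdeg by (auto simp: basis_in_def)

lemma sum_\<sigma>:
  "(\<Sum>\<theta>\<in>basis_in F (Suc (hdeg F \<tau>)). f \<theta>) = f \<sigma> + (\<Sum>\<theta>\<in>basis_in F' (Suc (hdeg F \<tau>)). f \<theta>)"
proof -
  have "basis_in F' (Suc (hdeg F \<tau>)) = basis_in F (Suc (hdeg F \<tau>)) - {\<sigma>}"
    by (auto simp: basis_in_def)
  then show ?thesis
    by (simp add: sum.remove[OF fin \<sigma>_in])
qed

lemma sum_\<tau>:
  "(\<Sum>\<theta>\<in>basis_in F (hdeg F \<tau>). f \<theta>) = f \<tau> + (\<Sum>\<theta>\<in>basis_in F' (hdeg F \<tau>). f \<theta>)"
proof -
  have "basis_in F' (hdeg F \<tau>) = basis_in F (hdeg F \<tau>) - {\<tau>}"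
    using hdeg by (auto simp: basis_in_def)
  then show ?thesis
    by (simp add: sum.remove[OF fin \<tau>_in])
qed

lemma basis_in_other:
  "j \<noteq> hdeg F \<tau> \<Longrightarrow> j \<noteq> Suc (hdeg F \<tau>) \<Longrightarrow> basis_in F' j = basis_in F j"
  using hdeg by (auto simp: basis_in_def)

lemma coef_coef:
  assumes "\<rho> \<in> basis_in F j" "\<theta> \<in> basis_in F (Suc (Suc j))"
  shows "(\<Sum>\<pi>\<in>basis_in F (Suc j). coef F \<rho> \<pi> * coef F \<pi> \<theta>) = 0"
proof -
  have "diff F (Suc j) (\<lambda>\<pi>. if \<pi> \<in> basis_in F (Suc j) then coef F \<pi> \<theta> else 0) \<rho> = 0"
    using fun_cong[OF exact_complexD(2)[OF exact chains_unit_vec[OF assms(2)]], of \<rho>]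
    unfolding diff_unit_vec[OF fin assms(2)] .
  then show ?thesis
    using assms(1) by (simp add: diff_def cong: sum.cong)
qed

lemma u_left: "u * coef F \<tau> \<sigma> = 1"
  using u by (simp add: mult.commute)

lemma entry_u: "entry x x u"
  using u_const by (simp add: entry_def)

text \<open>The coordinates of a chain in the primed basis, at the elements that remain.  In the degree of \<open>\<tau>\<close>,
  the old \<open>[\<tau>]\<close> equals \<open>u\<close> times \<open>[\<tau>]'\<close> minus a combination of the other elements, which explains the
  correction; in the other degrees the remaining coordinates do not change.\<close>

definition proj :: "nat \<Rightarrow> ('l \<Rightarrow> ('v, 'k) mpol) \<Rightarrow> 'l \<Rightarrow> ('v, 'k) mpol" where
  "proj j w = (\<lambda>b. if b \<in> basis_in F' j
     then w b - (if j = hdeg F \<tau> then coef F b \<sigma> * u * w \<tau> else 0) else 0)"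

lemma proj_module_map: "module_map F j F' j (proj j)"
  unfolding module_map_def
proof (intro conjI ballI allI)
  show "proj j v \<in> chains F' j" for v
    by (simp add: proj_def chains_def)
  show "proj j (\<lambda>b. v b + w b) = (\<lambda>b. proj j v b + proj j w b)" for v w
    by (simp add: proj_def fun_eq_iff distrib_left)
  show "proj j (\<lambda>b. s * v b) = (\<lambda>b. s * proj j v b)" for s v
    by (simp add: proj_def fun_eq_iff right_diff_distrib mult.left_commute[of s])
qed

lemma diff_proj:
  assumes w: "w \<in> chains F (Suc j)"
  shows "proj j (diff F (Suc j) w) = diff F' (Suc j) (proj (Suc j) w)"
proof
  fix b
  consider "b \<notin> basis_in F' j" | "b \<in> basis_in F' j" "j = hdeg F \<tau>"
    | "b \<in> basis_in F' j" "Suc j = hdeg F \<tau>"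
    | "b \<in> basis_in F' j" "j \<noteq> hdeg F \<tau>" "Suc j \<noteq> hdeg F \<tau>"
    by blast
  then show "proj j (diff F (Suc j) w) b = diff F' (Suc j) (proj (Suc j) w) b"
  proof cases
    case 1
    then show ?thesis by (simp add: proj_def diff_def)
  next
    case 2
    then have b: "b \<in> basis_in F j"
      by (simp add: basis_in_F')
    have c: "coef F' b \<theta> = coef F b \<theta> - coef F b \<sigma> * u * coef F \<tau> \<theta>"
      if "\<theta> \<in> basis_in F' (Suc j)" for \<theta>
      using that 2 hdeg by (simp add: basis_in_def)
    have "coef F b \<sigma> * u * (coef F \<tau> \<sigma> * w \<sigma>) = coef F b \<sigma> * (u * coef F \<tau> \<sigma>) * w \<sigma>"
      by (simp only: mult.assoc)
    then have s: "coef F b \<sigma> * u * (coef F \<tau> \<sigma> * w \<sigma>) = coef F b \<sigma> * w \<sigma>"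
      by (simp add: u_left)
    have "diff F' (Suc j) (proj (Suc j) w) b = (\<Sum>\<theta>\<in>basis_in F' (Suc j). coef F' b \<theta> * w \<theta>)"
      using 2 by (simp add: diff_def proj_def del: F'_simps(4) cong: sum.cong)
    also have "\<dots> = (\<Sum>\<theta>\<in>basis_in F' (Suc j). (coef F b \<theta> - coef F b \<sigma> * u * coef F \<tau> \<theta>) * w \<theta>)"
      by (intro sum.cong refl) (simp only: c)
    also have "\<dots> = (\<Sum>\<theta>\<in>basis_in F' (Suc j). coef F b \<theta> * w \<theta>)
        - coef F b \<sigma> * u * (\<Sum>\<theta>\<in>basis_in F' (Suc j). coef F \<tau> \<theta> * w \<theta>)"
      by (simp add: left_diff_distrib sum_subtractf sum_distrib_left mult.assoc)
    also have "\<dots> = proj j (diff F (Suc j) w) b"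
      using 2 b \<tau>_in by (simp add: proj_def diff_def sum_\<sigma> distrib_left s)
    finally show ?thesis ..
  next
    case 3
    then have b: "b \<in> basis_in F j"
      by (simp add: basis_in_F')
    have c: "coef F' b \<theta> = coef F b \<theta>" if "\<theta> \<in> basis_in F' (Suc j)" for \<theta>
      using that 3 hdeg by (simp add: basis_in_def)
    have "(\<Sum>\<pi>\<in>basis_in F (Suc j). coef F b \<pi> * coef F \<pi> \<sigma>) = 0"
      using coef_coef[OF b] \<sigma>_in 3 by simp
    then have s: "(\<Sum>\<pi>\<in>basis_in F' (Suc j). coef F b \<pi> * coef F \<pi> \<sigma>) = - (coef F b \<tau> * coef F \<tau> \<sigma>)"
      using sum_\<tau>[of "\<lambda>\<pi>. coef F b \<pi> * coef F \<pi> \<sigma>"] 3 by (simp add: add_eq_0_iff)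
    have sum_\<tau>': "(\<Sum>\<theta>\<in>basis_in F (Suc j). coef F b \<theta> * w \<theta>) =
        coef F b \<tau> * w \<tau> + (\<Sum>\<theta>\<in>basis_in F' (Suc j). coef F b \<theta> * w \<theta>)"
      using sum_\<tau>[of "\<lambda>\<theta>. coef F b \<theta> * w \<theta>"] 3 by simp
    have "diff F' (Suc j) (proj (Suc j) w) b =
        (\<Sum>\<theta>\<in>basis_in F' (Suc j). coef F b \<theta> * (w \<theta> - coef F \<theta> \<sigma> * u * w \<tau>))"
      using 3(1) 3(2)[symmetric] by (simp add: diff_def proj_def c del: F'_simps(4) cong: sum.cong)
    also have "\<dots> = (\<Sum>\<theta>\<in>basis_in F' (Suc j). coef F b \<theta> * w \<theta>)
        - (\<Sum>\<theta>\<in>basis_in F' (Suc j). coef F b \<theta> * coef F \<theta> \<sigma>) * u * w \<tau>"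
      by (simp add: right_diff_distrib sum_subtractf sum_distrib_right mult.assoc)
    also have "\<dots> = (\<Sum>\<theta>\<in>basis_in F' (Suc j). coef F b \<theta> * w \<theta>) + coef F b \<tau> * w \<tau>"
      by (simp add: s mult.assoc u)
    also have "\<dots> = proj j (diff F (Suc j) w) b"
      using 3(1) 3(2)[symmetric] b by (simp add: proj_def diff_def sum_\<tau>' add.commute)
    finally show ?thesis ..
  next
    case 4
    then have b: "b \<in> basis_in F j"
      by (simp add: basis_in_F')
    have c: "coef F' b \<theta> = coef F b \<theta>" if "\<theta> \<in> basis_in F (Suc j)" for \<theta>
      using that 4 hdeg by (simp add: basis_in_def)
    have "basis_in F' (Suc j) = basis_in F (Suc j)"
      using 4 by (intro basis_in_other) auto
    then show ?thesis
      using 4 b by (simp add: proj_def diff_def c del: F'_simps(4) cong: sum.cong)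
  qed
qed

lemma proj_graded: "graded_map F j F' (proj j)"
  unfolding graded_map_def homogeneous_entry
proof (intro allI ballI impI)
  fix d b and v :: "'l \<Rightarrow> ('v, 'k) mpol" assume v: "\<forall>b. entry (mdeg F b) d (v b)"
  have "entry (mdeg F b) d (coef F b \<sigma> * u * v \<tau>)" if "b \<in> basis_in F' j" "j = hdeg F \<tau>"
  proof (intro entry_mult)
    show "entry (mdeg F b) (mdeg F \<sigma>) (coef F b \<sigma>)"
      using that \<sigma>_in by (intro multigradedD(2)[OF multigraded]) (auto simp: basis_in_F')
    show "entry (mdeg F \<sigma>) (mdeg F \<tau>) u"
      by (simp add: mdeg entry_u)
  qed (simp add: v)
  then show "entry (mdeg F' b) d (proj j v b)"
    using v by (simp add: proj_def entry_diff)
qed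

lemma basis_in_S: "basis_in S j = (if j = hdeg F \<tau> then {\<tau>} else if j = Suc (hdeg F \<tau>) then {\<sigma>} else {})"
  using hdeg by (auto simp: basis_in_def)

lemma diff_S: "diff S (Suc j) x = (\<lambda>b. if b = \<tau> \<and> j = hdeg F \<tau> then x \<sigma> else 0)"
  by (auto simp: diff_def basis_in_S fun_eq_iff)

text \<open>All coordinates in the primed basis, distributed over the two summands.  As \<open>[\<tau>]'\<close> is the only primed
  element that involves \<open>[\<tau>]\<close>, its coordinate is \<open>u * w \<tau>\<close>.  As the primed elements other than \<open>[\<sigma>]'\<close>
  have boundaries without \<open>[\<tau>]\<close>, the coordinate at \<open>[\<sigma>]'\<close> is \<open>u\<close> times the coefficient of \<open>[\<tau>]\<close> in the
  boundary.\<close>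

definition split :: "nat \<Rightarrow> ('l \<Rightarrow> ('v, 'k) mpol) \<Rightarrow> 'l + 'l \<Rightarrow> ('v, 'k) mpol" where
  "split j w = case_sum (proj j w)
     (\<lambda>b. if b = \<tau> \<and> j = hdeg F \<tau> then u * w \<tau>
          else if b = \<sigma> \<and> j = Suc (hdeg F \<tau>) then u * diff F j w \<tau> else 0)"

lemma split_simps:
  "split j w (Inl b) = proj j w b"
  "split j w (Inr b) = (if b = \<tau> \<and> j = hdeg F \<tau> then u * w \<tau>
          else if b = \<sigma> \<and> j = Suc (hdeg F \<tau>) then u * diff F j w \<tau> else 0)"
  by (simp_all add: split_def)

lemma split_module_map: "module_map F j (dsum F' S) j (split j)"
  unfolding module_map_def
proof (intro conjI ballI allI)
  fix v assume v: "v \<in> chains F j"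
  show "split j v \<in> chains (dsum F' S) j"
    using module_mapD(1)[OF proj_module_map v]
    by (simp add: chains_dsum split_simps) (auto simp: chains_def basis_in_S)
  show "split j (\<lambda>b. s * v b) = (\<lambda>b. s * split j v b)" for s
    unfolding fun_eq_iff split_sum_all split_simps
    using v by (auto simp: module_mapD(3)[OF proj_module_map] module_mapD(3)[OF diff_module_map] mult.left_commute)
  fix w assume w: "w \<in> chains F j"
  show "split j (\<lambda>b. v b + w b) = (\<lambda>b. split j v b + split j w b)"
    unfolding fun_eq_iff split_sum_all split_simps
    using v w by (auto simp: module_mapD(2)[OF proj_module_map] module_mapD(2)[OF diff_module_map] distrib_left)
qed

lemma split_graded: "graded_map F j (dsum F' S) (split j)"
  unfolding graded_map_def
proof (intro allI ballI impI)
  fix d v assume v: "v \<in> chains F j" "homogeneous F d v"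
  have "homogeneous F' d (proj j v)"
    using proj_graded[of j] v by (simp add: graded_map_def)
  moreover have "entry (mdeg F \<tau>) d (u * v \<tau>)"
    using v(2) by (intro entry_mult[OF entry_u]) (simp add: homogeneous_entry)
  moreover have "entry (mdeg F \<sigma>) d (u * diff F (Suc (hdeg F \<tau>)) v \<tau>)"
    using diff_graded[OF multigraded v(2)] by (intro entry_mult[OF entry_u]) (simp add: homogeneous_entry mdeg)
  ultimately show "homogeneous (dsum F' S) d (split j v)"
    by (simp add: homogeneous_dsum split_simps) (simp add: homogeneous_entry)
qed

lemma split_kernel:
  assumes w: "w \<in> chains F j" and 0: "split j w = (\<lambda>_. 0)"
  shows "w = (\<lambda>_. 0)"
proof
  fix b
  have p: "proj j w b = 0" for b
    using fun_cong[OF 0, of "Inl b"] by (simp add: split_simps)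
  have \<tau>0: "w \<tau> = 0"
  proof (cases "j = hdeg F \<tau>")
    case True
    then have "coef F \<tau> \<sigma> * (u * w \<tau>) = 0"
      using fun_cong[OF 0, of "Inr \<tau>"] by (simp add: split_simps)
    then show ?thesis
      by (simp add: mult.assoc[symmetric] u)
  next
    case False
    then show ?thesis
      using chains_eq_0[OF w, of \<tau>] by (simp add: basis_in_def)
  qed
  have other: "w b = 0" if "b \<noteq> \<sigma>" "b \<noteq> \<tau>" for b
    using p[of b] that chains_eq_0[OF w, of b] \<tau>0 by (cases "b \<in> basis_in F j") (auto simp: proj_def basis_in_F')
  have "w \<sigma> = 0"
  proof (cases "j = Suc (hdeg F \<tau>)")
    case True
    have "diff F j w \<tau> = coef F \<tau> \<sigma> * w \<sigma>"
      using True \<tau>_in other by (simp add: diff_def sum_\<sigma>) (auto intro!: sum.neutral simp: basis_in_F')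
    then have "u * (coef F \<tau> \<sigma> * w \<sigma>) = 0"
      using True fun_cong[OF 0, of "Inr \<sigma>"] \<sigma>_\<tau> by (simp add: split_simps)
    then show ?thesis
      by (simp add: mult.assoc[symmetric] u_left)
  next
    case False
    then show ?thesis
      using chains_eq_0[OF w, of \<sigma>] hdeg by (simp add: basis_in_def)
  qed
  with \<tau>0 other show "w b = 0"
    by (cases "b = \<sigma>"; cases "b = \<tau>") auto
qed

lemma split_surj:
  assumes v: "v \<in> chains (dsum F' S) j"
  shows "\<exists>w\<in>chains F j. split j w = v"
proof -
  have vl: "(\<lambda>b. v (Inl b)) \<in> chains F' j" and vr: "(\<lambda>b. v (Inr b)) \<in> chains S j"
    using v by (simp_all add: chains_dsum)
  have vl0: "v (Inl b) = 0" if "b \<notin> basis_in F' j" for b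
    using chains_eq_0[OF vl that] .
  have vr0: "v (Inr b) = 0" if "b \<notin> basis_in S j" for b
    using chains_eq_0[OF vr that] .
  consider "j = hdeg F \<tau>" | "j = Suc (hdeg F \<tau>)" | "j \<noteq> hdeg F \<tau>" "j \<noteq> Suc (hdeg F \<tau>)"
    by blast
  then show ?thesis
  proof cases
    case 1
    define w where "w = (\<lambda>b. if b = \<tau> then coef F \<tau> \<sigma> * v (Inr \<tau>)
      else if b \<in> basis_in F' j then v (Inl b) + coef F b \<sigma> * v (Inr \<tau>) else 0)"
    have "w \<in> chains F j"
      using 1 \<tau>_in by (auto simp: chains_def w_def basis_in_F')
    moreover have "split j w x = v x" for x
    proof (cases x)
      case (Inl b)
      have "coef F b \<sigma> * u * (coef F \<tau> \<sigma> * v (Inr \<tau>)) = coef F b \<sigma> * (u * coef F \<tau> \<sigma>) * v (Inr \<tau>)"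
        by (simp only: mult.assoc)
      then show ?thesis
        using 1 vl0[of b] by (auto simp: Inl split_simps proj_def w_def u_left basis_in_F')
    next
      case (Inr b)
      then show ?thesis
        using 1 vr0[of b] by (auto simp: split_simps w_def basis_in_S mult.assoc[symmetric] u_left)
    qed
    ultimately show ?thesis
      by (intro bexI[of _ w]) auto
  next
    case 2
    define w where "w = (\<lambda>b. if b = \<sigma> then
        v (Inr \<sigma>) - u * (\<Sum>\<theta>\<in>basis_in F' j. coef F \<tau> \<theta> * v (Inl \<theta>)) else v (Inl b))"
    have wc: "w \<in> chains F j"
      using 2 \<sigma>_in vl0 by (auto simp: chains_def w_def basis_in_F')
    have "(\<Sum>\<theta>\<in>basis_in F' j. coef F \<tau> \<theta> * w \<theta>) = (\<Sum>\<theta>\<in>basis_in F' j. coef F \<tau> \<theta> * v (Inl \<theta>))"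
      by (rule sum.cong) (auto simp: w_def basis_in_F')
    then have "diff F j w \<tau> = coef F \<tau> \<sigma> * v (Inr \<sigma>) +
        (1 - coef F \<tau> \<sigma> * u) * (\<Sum>\<theta>\<in>basis_in F' j. coef F \<tau> \<theta> * v (Inl \<theta>))"
      using 2 \<tau>_in by (simp add: diff_def sum_\<sigma> left_diff_distrib mult.assoc)
        (simp add: w_def right_diff_distrib mult.assoc)
    then have d: "u * diff F j w \<tau> = v (Inr \<sigma>)"
      by (simp add: u mult.assoc[symmetric] u_left)
    have "split j w x = v x" for x
    proof (cases x)
      case (Inl b)
      then show ?thesis
        using 2 vl0[of b] by (auto simp: split_simps proj_def w_def basis_in_F')
    next
      case (Inr b)
      then show ?thesis
        using 2 vr0[of b] d by (auto simp: split_simps basis_in_S)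
    qed
    with wc show ?thesis
      by (intro bexI[of _ w]) auto
  next
    case 3
    have "split j (\<lambda>b. v (Inl b)) x = v x" for x
      using 3 vl0 vr0 by (cases x) (auto simp: split_simps proj_def basis_in_S)
    moreover have "(\<lambda>b. v (Inl b)) \<in> chains F j"
      using vl 3 by (simp add: chains_def basis_in_other)
    ultimately show ?thesis
      by (intro bexI) auto
  qed
qed

lemma iso: "F \<cong>\<^sub>m dsum F' S"
proof (rule mg_isoI[of _ _ split])
  fix j
  show "bij_betw (split j) (chains F j) (chains (dsum F' S) j)"
    unfolding bij_betw_def
  proof
    show "inj_on (split j) (chains F j)"
    proof (rule inj_onI)
      fix v w assume vw: "v \<in> chains F j" "w \<in> chains F j" "split j v = split j w"
      have "split j (\<lambda>b. v b - w b) = (\<lambda>_. 0)"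
        by (simp add: module_map_minus[OF split_module_map vw(1,2)] vw(3))
      from fun_cong[OF split_kernel[OF chains_minus[OF vw(1,2)] this]] show "v = w"
        by (simp add: fun_eq_iff)
    qed
    show "split j ` chains F j = chains (dsum F' S) j"
    proof
      show "split j ` chains F j \<subseteq> chains (dsum F' S) j"
        using module_mapD(1)[OF split_module_map] by blast
      show "chains (dsum F' S) j \<subseteq> split j ` chains F j"
        using split_surj by blast
    qed
  qed
  fix w assume w: "w \<in> chains F (Suc j)"
  have finS: "finite (basis_in S i)" for i
    by (simp add: basis_in_S)
  show "split j (diff F (Suc j) w) = diff (dsum F' S) (Suc j) (split (Suc j) w)"
  proof
    fix x
    show "split j (diff F (Suc j) w) x = diff (dsum F' S) (Suc j) (split (Suc j) w) x"
    proof (cases x)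
      case (Inl b)
      then show ?thesis
        by (simp add: diff_dsum fin' finS split_simps diff_proj[OF w])
    next
      case (Inr b)
      have "diff F (Suc (hdeg F \<tau>)) (diff F (Suc j) w) \<tau> = 0" if "j = Suc (hdeg F \<tau>)"
        using exact_complexD(2)[OF exact, of w "hdeg F \<tau>"] w that by simp
      then show ?thesis
        using \<sigma>_\<tau> by (auto simp: Inr diff_dsum fin' finS split_simps diff_S)
    qed
  qed
qed (rule split_module_map split_graded)+

lemma multigraded_F': "multigraded F'"
  unfolding multigraded_def entry_keys[symmetric]
proof (intro conjI allI ballI)
  fix j \<theta> \<pi> assume \<theta>: "\<theta> \<in> basis_in F' (Suc j)" and \<pi>: "\<pi> \<in> basis_in F' j"
  then have in_F: "\<theta> \<in> basis_in F (Suc j)" "\<pi> \<in> basis_in F j"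
    by (auto simp: basis_in_F')
  have "entry (mdeg F \<pi>) (mdeg F \<theta>) (coef F \<pi> \<sigma> * u * coef F \<tau> \<theta>)" if "hdeg F \<theta> = hdeg F \<sigma>"
  proof (intro entry_mult)
    have j: "j = hdeg F \<tau>"
      using that \<theta> hdeg by (simp add: basis_in_def)
    show "entry (mdeg F \<pi>) (mdeg F \<sigma>) (coef F \<pi> \<sigma>)"
      using multigradedD(2)[OF multigraded _ in_F(2)] \<sigma>_in j by simp
    show "entry (mdeg F \<sigma>) (mdeg F \<tau>) u"
      by (simp add: mdeg entry_u)
    show "entry (mdeg F \<tau>) (mdeg F \<theta>) (coef F \<tau> \<theta>)"
      using multigradedD(2)[OF multigraded in_F(1)] \<tau>_in j by simp
  qed
  then show "entry (mdeg F' \<pi>) (mdeg F' \<theta>) (coef F' \<pi> \<theta>)"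
    using multigradedD(2)[OF multigraded in_F] by (simp add: entry_diff)
qed (rule fin')

lemma exact_F': "exact_complex F'"
  by (rule exact_summand[OF iso exact]) (simp_all add: fin' basis_in_S)

lemma chains_F'_subset: "chains F' j \<subseteq> chains F j"
  by (auto simp: chains_def basis_in_F')

lemma proj_id: "v \<in> chains F' j \<Longrightarrow> proj j v = v"
  by (auto simp: proj_def chains_def basis_in_F' fun_eq_iff)

lemma boundaries_F': "boundaries F' j = proj j ` boundaries F j"
proof (intro equalityI subsetI)
  fix v assume "v \<in> boundaries F' j"
  then obtain x where x: "x \<in> chains F' (Suc j)" "v = diff F' (Suc j) x"
    by blast
  then have "x \<in> chains F (Suc j)"
    using chains_F'_subset by blast
  then have "v = proj j (diff F (Suc j) x)"
    using x by (simp add: diff_proj proj_id)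
  with \<open>x \<in> chains F (Suc j)\<close> show "v \<in> proj j ` boundaries F j"
    by blast
next
  fix v assume "v \<in> proj j ` boundaries F j"
  then obtain x where x: "x \<in> chains F (Suc j)" "v = proj j (diff F (Suc j) x)"
    by blast
  then have "v = diff F' (Suc j) (proj (Suc j) x)"
    by (simp add: diff_proj)
  with module_mapD(1)[OF proj_module_map x(1)] show "v \<in> boundaries F' j"
    by blast
qed

lemma augment_F': "v \<in> chains F' 0 \<Longrightarrow> augment F' e v = augment F e v"
  unfolding augment_def
  by (rule sum.mono_neutral_left) (auto simp: fin basis_in_F' chains_def)

text \<open>In degree 0, \<open>proj\<close> changes a chain at most by a multiple of the boundary of \<open>[\<sigma>]\<close>, whose
  augmentation lies in \<open>M\<close>; so the old augmentation still serves.\<close>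

lemma augment_proj:
  assumes w: "w \<in> chains F 0"
  shows "augment F e w - augment F' e (proj 0 w) \<in> M"
proof (cases "hdeg F \<tau> = 0")
  case True
  have "diff F (Suc 0) (unit_vec \<sigma>) = (\<lambda>b. if b \<in> basis_in F 0 then coef F b \<sigma> else 0)"
    using \<sigma>_in True by (intro diff_unit_vec fin) simp
  then have "proj 0 w = (\<lambda>b. w b - u * w \<tau> * diff F (Suc 0) (unit_vec \<sigma>) b)"
    unfolding \<open>diff F (Suc 0) (unit_vec \<sigma>) = _\<close>
  proof (intro ext)
    fix b
    have "u * w \<tau> * coef F \<tau> \<sigma> = w \<tau> * (coef F \<tau> \<sigma> * u)"
      by (simp add: ac_simps)
    then have "u * w \<tau> * coef F \<tau> \<sigma> = w \<tau>"
      by (simp add: u)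
    moreover have "coef F b \<sigma> * u * w \<tau> = u * w \<tau> * coef F b \<sigma>"
      by (simp add: ac_simps)
    moreover have "b \<in> basis_in F' 0 \<longleftrightarrow> b \<in> basis_in F 0 \<and> b \<noteq> \<tau>"
      using True hdeg by (auto simp: basis_in_def)
    ultimately show "proj 0 w b = w b - u * w \<tau> * (if b \<in> basis_in F 0 then coef F b \<sigma> else 0)"
      using chains_eq_0[OF w, of b] True \<tau>_in by (cases "b = \<tau>") (simp_all add: proj_def)
  qed
  then have "augment F e w - augment F' e (proj 0 w) = u * w \<tau> * augment F e (diff F (Suc 0) (unit_vec \<sigma>))"
    using augment_F'[OF module_mapD(1)[OF proj_module_map w]] by (simp add: augment_minus augment_scale)
  moreover have "augment F e (diff F (Suc 0) (unit_vec \<sigma>)) \<in> M"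
  proof -
    have "diff F (Suc 0) (unit_vec \<sigma>) \<in> boundaries F 0"
      using chains_unit_vec[OF \<sigma>_in] True by (intro imageI) simp
    also have "boundaries F 0 = {v \<in> chains F 0. augment F e v \<in> M}"
      using aug by (simp add: augmentation_def)
    finally show ?thesis by simp
  qed
  ultimately show ?thesis
    unfolding M by (simp add: ideal.span_scale)
next
  case False
  then have "proj 0 w = w"
    using w by (intro proj_id) (simp add: chains_def basis_in_other)
  then show ?thesis
    using augment_F'[OF module_mapD(1)[OF proj_module_map w]] by (simp add: M ideal.span_zero)
qed

lemma augmentation_F': "augmentation F' M e"
  unfolding augmentation_def
proof (intro conjI)
  have iff: "augment F e w \<in> M \<longleftrightarrow> augment F' e (proj 0 w) \<in> M" if "w \<in> chains F 0" for w
    using augment_proj[OF that] unfolding M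
    by (metis ideal.span_add_eq diff_add_cancel)
  have bd: "boundaries F 0 = {w \<in> chains F 0. augment F e w \<in> M}"
    using aug by (simp add: augmentation_def)
  show "\<forall>b\<in>basis_in F' 0. entry 0 (mdeg F' b) (e b)"
    using aug by (simp add: augmentation_def basis_in_F')
  show "\<forall>s. \<exists>v\<in>chains F' 0. s - augment F' e v \<in> M"
  proof
    fix s
    obtain w where w: "w \<in> chains F 0" "s - augment F e w \<in> M"
      using aug unfolding augmentation_def by blast
    have "s - augment F' e (proj 0 w) \<in> M"
      using w(2) augment_proj[OF w(1)] ideal.span_add[of "s - augment F e w"] unfolding M by fastforce
    then show "\<exists>v\<in>chains F' 0. s - augment F' e v \<in> M"
      using module_mapD(1)[OF proj_module_map w(1)] by blast
  qed
  show "{v \<in> chains F' 0. augment F' e v \<in> M} = boundaries F' 0"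
    unfolding boundaries_F' bd
  proof (intro equalityI subsetI)
    fix v assume v: "v \<in> {v \<in> chains F' 0. augment F' e v \<in> M}"
    then have "v \<in> chains F 0" "proj 0 v = v"
      using chains_F'_subset proj_id by auto
    with v iff[of v] show "v \<in> proj 0 ` {w \<in> chains F 0. augment F e w \<in> M}"
      by force
  next
    fix v assume "v \<in> proj 0 ` {w \<in> chains F 0. augment F e w \<in> M}"
    then show "v \<in> {v \<in> chains F' 0. augment F' e v \<in> M}"
      using iff module_mapD(1)[OF proj_module_map] by auto
  qed
qed

text \<open>The matrix \<open>cancel F \<sigma> \<tau> u\<close> is the one that the definition of a standard cancellation prescribes.
  The coordinates at \<open>\<sigma>\<close> agree because the differential squares to zero.\<close>

lemma std_cancellation: "std_cancellation F \<sigma> \<tau> F'"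
  unfolding std_cancellation_def
proof (intro conjI exI[of _ u] allI ballI)
  fix j \<theta> assume \<theta>: "\<theta> \<in> basis_in F' (Suc j)"
  then have \<theta>': "\<theta> \<in> basis_in F (Suc j)" "\<theta> \<noteq> \<sigma>" "\<theta> \<noteq> \<tau>" "hdeg F \<theta> = Suc j"
    by (auto simp: basis_in_F' basis_in_def)
  have basis: "std_basis F \<sigma> \<tau> u \<pi> =
      (\<lambda>b. unit_vec \<pi> b - (if i = hdeg F \<sigma> then coef F \<tau> \<pi> * u else 0) * unit_vec \<sigma> b)"
    if "\<pi> \<in> basis_in F' i" for \<pi> i
    using that by (auto simp: std_basis_def basis_in_def fun_eq_iff)
  have d\<sigma>: "diff F (Suc j) (unit_vec \<sigma>) b = coef F b \<sigma>" if "Suc j = hdeg F \<sigma>" "b \<in> basis_in F j" for b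
    using that \<sigma>_in hdeg by (simp add: diff_unit_vec fin)
  have lhs: "diff F (Suc j) (std_basis F \<sigma> \<tau> u \<theta>) b = (if b \<in> basis_in F j then coef F' b \<theta> else 0)" for b
  proof (cases "b \<in> basis_in F j")
    case True
    have "diff F (Suc j) (std_basis F \<sigma> \<tau> u \<theta>) b = diff F (Suc j) (unit_vec \<theta>) b
        - (if Suc j = hdeg F \<sigma> then coef F \<tau> \<theta> * u else 0) * diff F (Suc j) (unit_vec \<sigma>) b"
      unfolding basis[OF \<theta>] diff_def using True
      by (simp add: right_diff_distrib sum_subtractf sum_distrib_left mult.left_commute)
    then show ?thesis
      using True \<theta>' d\<sigma> by (auto simp: diff_unit_vec fin mult.commute mult.left_commute)
  qed (simp add: diff_def)
  show "diff F (Suc j) (std_basis F \<sigma> \<tau> u \<theta>) =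
      (\<lambda>b. \<Sum>\<pi>\<in>basis_in F' j. coef F' \<pi> \<theta> * std_basis F \<sigma> \<tau> u \<pi> b)"
  proof
    fix b
    have "(\<Sum>\<pi>\<in>basis_in F' j. coef F' \<pi> \<theta> * std_basis F \<sigma> \<tau> u \<pi> b) =
        (\<Sum>\<pi>\<in>basis_in F' j. coef F' \<pi> \<theta> * unit_vec \<pi> b
          - coef F' \<pi> \<theta> * (if j = hdeg F \<sigma> then coef F \<tau> \<pi> * u else 0) * unit_vec \<sigma> b)"
      by (rule sum.cong) (simp_all add: basis right_diff_distrib mult.assoc)
    also have "\<dots> = (\<Sum>\<pi>\<in>basis_in F' j. coef F' \<pi> \<theta> * unit_vec \<pi> b)
          - (\<Sum>\<pi>\<in>basis_in F' j. coef F' \<pi> \<theta> * (if j = hdeg F \<sigma> then coef F \<tau> \<pi> * u else 0)) * unit_vec \<sigma> b"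
      by (simp only: sum_subtractf sum_distrib_right)
    also have "(\<Sum>\<pi>\<in>basis_in F' j. coef F' \<pi> \<theta> * unit_vec \<pi> b) = (\<Sum>\<pi>\<in>basis_in F' j. if \<pi> = b then coef F' \<pi> \<theta> else 0)"
      by (rule sum.cong) (simp_all add: unit_vec_def)
    also have "\<dots> = (if b \<in> basis_in F' j then coef F' b \<theta> else 0)"
      by (simp add: fin' del: F'_simps(4))
    finally have rhs: "(\<Sum>\<pi>\<in>basis_in F' j. coef F' \<pi> \<theta> * std_basis F \<sigma> \<tau> u \<pi> b) =
        (if b \<in> basis_in F' j then coef F' b \<theta> else 0)
        - (\<Sum>\<pi>\<in>basis_in F' j. coef F' \<pi> \<theta> * (if j = hdeg F \<sigma> then coef F \<tau> \<pi> * u else 0)) * unit_vec \<sigma> b" .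
    show "diff F (Suc j) (std_basis F \<sigma> \<tau> u \<theta>) b =
      (\<Sum>\<pi>\<in>basis_in F' j. coef F' \<pi> \<theta> * std_basis F \<sigma> \<tau> u \<pi> b)"
    proof (cases "b = \<sigma>")
      case b: True
      show ?thesis
      proof (cases "j = hdeg F \<sigma>")
        case True
        have c: "coef F' \<pi> \<theta> = coef F \<pi> \<theta>" for \<pi>
          using \<theta>'(4) True by simp
        have "(\<Sum>\<pi>\<in>basis_in F j. coef F \<tau> \<pi> * coef F \<pi> \<theta>) = 0"
          using coef_coef[OF \<tau>_in, of \<theta>] \<theta>' True hdeg by simp
        then have s: "(\<Sum>\<pi>\<in>basis_in F' j. coef F \<tau> \<pi> * coef F \<pi> \<theta>) = - (coef F \<tau> \<sigma> * coef F \<sigma> \<theta>)"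
          using True hdeg by (simp add: sum_\<sigma> add_eq_0_iff)
        have "(\<Sum>\<pi>\<in>basis_in F' j. coef F' \<pi> \<theta> * (if j = hdeg F \<sigma> then coef F \<tau> \<pi> * u else 0))
            = (\<Sum>\<pi>\<in>basis_in F' j. coef F \<tau> \<pi> * coef F \<pi> \<theta>) * u"
          unfolding c sum_distrib_right using True
          by (intro sum.cong) (simp_all add: mult.commute mult.left_commute)
        also have "\<dots> = - coef F \<sigma> \<theta>"
        proof -
          have "coef F \<tau> \<sigma> * coef F \<sigma> \<theta> * u = (coef F \<tau> \<sigma> * u) * coef F \<sigma> \<theta>"
            by (simp add: ac_simps)
          then show ?thesis
            by (simp add: s u)
        qed
        finally have *: "(\<Sum>\<pi>\<in>basis_in F' j. coef F' \<pi> \<theta> * (if j = hdeg F \<sigma> then coef F \<tau> \<pi> * u else 0))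
            = - coef F \<sigma> \<theta>" .
        have "\<sigma> \<in> basis_in F j"
          using \<sigma>_in True hdeg by simp
        then show ?thesis
          unfolding lhs rhs unfolding * unfolding b c by (simp add: basis_in_F' unit_vec_def)
      next
        case False
        then have "\<sigma> \<notin> basis_in F j"
          by (simp add: basis_in_def)
        then show ?thesis
          unfolding lhs rhs unfolding b using False by (simp add: basis_in_F')
      qed
    next
      case b: False
      have "coef F' \<tau> \<theta> = 0" if "\<tau> \<in> basis_in F j"
        using that \<theta>'(4) hdeg u by (simp add: basis_in_def mult.assoc[symmetric])
      then show ?thesis
        unfolding lhs rhs using b by (auto simp: basis_in_F' unit_vec_def simp del: F'_simps(4))
    qed
  qed
qed (simp_all add: \<sigma> \<tau> hdeg u)

end


section \<open>The Taylor complex is a free resolution\<close>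

lemma lookup_lcm_mon:
  fixes X :: "('v::finite) mon set"
  shows "Poly_Mapping.lookup (lcm_mon X) x = Max (insert 0 ((\<lambda>m. Poly_Mapping.lookup m x) ` X))"
  by (simp add: lcm_mon_def)

lemma lookup_lcm_mon_le_iff:
  assumes "finite X"
  shows "Poly_Mapping.lookup (lcm_mon X) x \<le> n \<longleftrightarrow> (\<forall>m\<in>X. Poly_Mapping.lookup m x \<le> n)"
  using assms by (simp add: lookup_lcm_mon)

lemma mdvd_iff: "s mdvd t \<longleftrightarrow> (\<forall>x. Poly_Mapping.lookup s x \<le> Poly_Mapping.lookup t x)"
proof
  assume "s mdvd t"
  then show "\<forall>x. Poly_Mapping.lookup s x \<le> Poly_Mapping.lookup t x"
    by (auto simp: mdvd_def lookup_add)
next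
  assume "\<forall>x. Poly_Mapping.lookup s x \<le> Poly_Mapping.lookup t x"
  then have "t = s + (t - s)"
    by (intro poly_mapping_eqI) (simp add: lookup_add lookup_minus)
  then show "s mdvd t"
    unfolding mdvd_def by blast
qed

lemma mdvd_add_diff: "s mdvd t \<Longrightarrow> s + (t - s) = t"
  by (auto simp: mdvd_def)

lemma mdvd_refl: "m mdvd m"
  unfolding mdvd_iff by (rule allI) (rule order.refl)

lemma mdvd_trans: "a mdvd b \<Longrightarrow> b mdvd c \<Longrightarrow> a mdvd c"
  unfolding mdvd_iff using le_trans by blast

lemma lcm_mon_mdvd_iff: "finite X \<Longrightarrow> lcm_mon X mdvd t \<longleftrightarrow> (\<forall>m\<in>X. m mdvd t)"
  by (auto simp: mdvd_iff lookup_lcm_mon_le_iff)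

lemma mdvd_lcm_mon: "finite X \<Longrightarrow> m \<in> X \<Longrightarrow> m mdvd lcm_mon X"
  using lcm_mon_mdvd_iff mdvd_refl by blast

text \<open>A chain is the finite sum of its homogeneous components, and the differential acts on each component
  separately.\<close>

lemma exact_complexI_homogeneous:
  fixes F :: "('l, 'v, 'k::field) mgcomplex"
  assumes F: "multigraded F"
    and dd: "\<And>j d v. v \<in> chains F (Suc (Suc j)) \<Longrightarrow> homogeneous F d v \<Longrightarrow>
       diff F (Suc j) (diff F (Suc (Suc j)) v) = (\<lambda>_. 0)"
    and ex: "\<And>j d v. v \<in> chains F (Suc j) \<Longrightarrow> homogeneous F d v \<Longrightarrow> diff F (Suc j) v = (\<lambda>_. 0) \<Longrightarrow>
       v \<in> boundaries F (Suc j)"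
  shows "exact_complex F"
  unfolding exact_complex_def
proof (intro allI equalityI subsetI)
  fix j v assume "v \<in> boundaries F (Suc j)"
  then obtain w where w: "w \<in> chains F (Suc (Suc j))" "v = diff F (Suc (Suc j)) w"
    by blast
  have "component F d (diff F (Suc j) v) = (\<lambda>_. 0)" for d
    using dd[OF component_in_chains[OF w(1)] homogeneous_component, of d] w(2)
    by (simp add: diff_component[OF F])
  then have "part (mdeg F b) d (diff F (Suc j) v b) = 0" for d b
    by (metis component_def)
  then have "Poly_Mapping.lookup (diff F (Suc j) v b) k = 0" for b k
    using lookup_part[of "mdeg F b" "mdeg F b + k" "diff F (Suc j) v b" k] by simp
  then have "diff F (Suc j) v b = 0" for b
    by (intro poly_mapping_eqI) simp
  moreover have "v \<in> chains F (Suc j)"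
    unfolding w(2) by (rule diff_in_chains)
  ultimately show "v \<in> {v \<in> chains F (Suc j). diff F (Suc j) v = (\<lambda>_. 0)}"
    by (simp add: fun_eq_iff)
next
  fix j v assume "v \<in> {v \<in> chains F (Suc j). diff F (Suc j) v = (\<lambda>_. 0)}"
  then have v: "v \<in> chains F (Suc j)" "diff F (Suc j) v = (\<lambda>_. 0)"
    by auto
  define D where "D = (\<Union>b\<in>basis_in F (Suc j). (\<lambda>k. mdeg F b + k) ` Poly_Mapping.keys (v b))"
  have D: "finite D"
    by (simp add: D_def multigradedD(1)[OF F])
  have sum: "(\<lambda>b. \<Sum>d\<in>D. component F d v b) = v"
  proof
    fix b
    have "(\<lambda>k. mdeg F b + k) ` Poly_Mapping.keys (v b) \<subseteq> D"
      using chains_eq_0[OF v(1), of b] by (cases "b \<in> basis_in F (Suc j)") (auto simp: D_def)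
    then show "(\<Sum>d\<in>D. component F d v b) = v b"
      unfolding component_def by (rule part_sum_all[OF D])
  qed
  have "\<exists>w\<in>chains F (Suc (Suc j)). diff F (Suc (Suc j)) w = component F d v" for d
  proof -
    have "diff F (Suc j) (component F d v) = (\<lambda>_. 0)"
      by (simp add: diff_component[OF F] v(2)) (simp add: component_def)
    from ex[OF component_in_chains[OF v(1)] homogeneous_component this] show ?thesis
      by (metis imageE)
  qed
  then obtain w where w: "\<And>d. w d \<in> chains F (Suc (Suc j))"
    "\<And>d. diff F (Suc (Suc j)) (w d) = component F d v"
    by metis
  have "diff F (Suc (Suc j)) (\<lambda>b. \<Sum>d\<in>D. w d b) = v"
    using module_map_sum[OF diff_module_map D, of w F "Suc j"] w sum by simp
  moreover have "(\<lambda>b. \<Sum>d\<in>D. w d b) \<in> chains F (Suc (Suc j))"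
    by (intro chains_sum w)
  ultimately show "v \<in> boundaries F (Suc j)"
    by blast
qed

lemma entry_eq_single:
  "entry x d p \<Longrightarrow> p = Poly_Mapping.single (d - x) (Poly_Mapping.lookup p (d - x))"
  by (rule poly_mapping_eqI) (auto simp: entry_def lookup_single when_def)

text \<open>The sign with which \<open>\<tau>\<close> occurs in the boundary of \<open>insert r \<tau>\<close>.\<close>

definition taylor_sign :: "nat \<Rightarrow> nat set \<Rightarrow> 'a::comm_ring_1" where
  "taylor_sign r \<tau> = (- 1) ^ card {s \<in> \<tau>. s < r}"

lemma taylor_sign_square: "taylor_sign r \<tau> * (taylor_sign r \<tau> * x) = x"
  by (simp add: taylor_sign_def mult.assoc[symmetric] power_add[symmetric])

lemma taylor_sign_insert:
  assumes "finite \<rho>" "r \<notin> \<rho>"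
  shows "taylor_sign s (insert r \<rho>) = (if r < s then - taylor_sign s \<rho> else taylor_sign s \<rho>)"
proof -
  have "{x \<in> insert r \<rho>. x < s} = (if r < s then insert r {x \<in> \<rho>. x < s} else {x \<in> \<rho>. x < s})"
    by auto
  then show ?thesis
    using assms by (simp add: taylor_sign_def)
qed

lemma single_0_minus_one_power: "Poly_Mapping.single 0 ((- 1) ^ i) = ((- 1) ^ i :: ('v, 'k::field) mpol)"
proof (induction i)
  case (Suc i)
  have "Poly_Mapping.single 0 ((- 1) ^ Suc i) = Poly_Mapping.single (0 :: 'v mon) (- ((- 1 :: 'k) ^ i))"
    by simp
  also have "\<dots> = - Poly_Mapping.single 0 ((- 1) ^ i)"
    by (rule single_uminus)
  finally show ?case
    by (simp add: Suc)
qed simp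

text \<open>The terms cancel in pairs.  Antisymmetry of the whole sum would only show that twice the sum
  vanishes, which says nothing in characteristic 2; hence the induction.\<close>

lemma sum_antisymmetric:
  fixes f :: "'i \<Rightarrow> 'i \<Rightarrow> 'a::ab_group_add"
  assumes "finite A" "\<And>r s. r \<in> A \<Longrightarrow> s \<in> A \<Longrightarrow> r \<noteq> s \<Longrightarrow> f r s = - f s r"
  shows "(\<Sum>r\<in>A. \<Sum>s\<in>A - {r}. f r s) = 0"
  using assms
proof (induction A rule: finite_induct)
  case (insert a A)
  note A = insert.hyps
  have "(\<Sum>s\<in>insert a A - {r}. f r s) = f r a + (\<Sum>s\<in>A - {r}. f r s)" if "r \<in> A" for r
  proof -
    have "insert a A - {r} = insert a (A - {r})"
      using that A by auto
    then show ?thesis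
      using A by simp
  qed
  then have "(\<Sum>r\<in>insert a A. \<Sum>s\<in>insert a A - {r}. f r s) =
      (\<Sum>s\<in>A. f a s) + ((\<Sum>r\<in>A. f r a) + (\<Sum>r\<in>A. \<Sum>s\<in>A - {r}. f r s))"
    using A by (simp add: sum.distrib)
  also have "(\<Sum>r\<in>A. \<Sum>s\<in>A - {r}. f r s) = 0"
    by (rule insert.IH) (rule insert.prems, simp_all)
  also have "(\<Sum>s\<in>A. f a s) = (\<Sum>s\<in>A. - f s a)"
    by (rule sum.cong[OF refl], rule insert.prems) (use A in auto)
  finally show ?case
    by (simp add: sum_negf)
qed simp

text \<open>The parameter \<open>K\<close> pins down the coefficient field, so that \<open>Tay\<close> is the same complex in all
  statements and intermediate steps.\<close>

context
  fixes ls :: "('v::finite) mon list" and K :: "'k::field itself"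
begin

abbreviation (input) "Tay \<equiv> taylor ls :: (nat set, 'v, 'k) mgcomplex"
abbreviation (input) "lcmdeg \<equiv> taylor_mdeg ls"

lemma taylor_simps [simp]:
  "basis Tay = Pow {..<length ls}" "hdeg Tay = card" "mdeg Tay = lcmdeg"
  by (simp_all add: taylor_def)

lemma basis_in_taylor: "basis_in Tay j = {\<sigma>. \<sigma> \<subseteq> {..<length ls} \<and> card \<sigma> = j}"
  by (auto simp: basis_in_def)

lemma finite_basis_taylor: "finite (basis_in Tay j)"
  by (rule finite_subset[of _ "Pow {..<length ls}"]) (auto simp: basis_in_taylor)

lemma finite_index: "\<sigma> \<in> basis_in Tay j \<Longrightarrow> finite \<sigma>"
  by (rule finite_subset[of _ "{..<length ls}"]) (simp_all add: basis_in_taylor)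

lemma taylor_mdeg_mdvd_iff: "finite \<sigma> \<Longrightarrow> lcmdeg \<sigma> mdvd t \<longleftrightarrow> (\<forall>r\<in>\<sigma>. ls ! r mdvd t)"
  by (simp add: taylor_mdeg_def lcm_mon_mdvd_iff)

lemma taylor_mdeg_mono: "finite \<sigma> \<Longrightarrow> \<tau> \<subseteq> \<sigma> \<Longrightarrow> lcmdeg \<tau> mdvd lcmdeg \<sigma>"
  by (metis finite_subset mdvd_refl subsetD taylor_mdeg_mdvd_iff)

lemma taylor_coef: "coef Tay \<tau> \<sigma> = (\<Sum>r | r \<in> \<sigma> \<and> \<tau> = \<sigma> - {r}.
    (- 1) ^ card {s \<in> \<sigma>. s < r} * monom (lcmdeg \<sigma> - lcmdeg \<tau>))"
  by (simp add: taylor_def)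

lemma taylor_coef_insert:
  assumes "r \<notin> \<tau>"
  shows "coef Tay \<tau> (insert r \<tau>) = taylor_sign r \<tau> * monom (lcmdeg (insert r \<tau>) - lcmdeg \<tau>)"
proof -
  have "{r'. r' \<in> insert r \<tau> \<and> \<tau> = insert r \<tau> - {r'}} = {r}"
    using assms by auto
  moreover have "{s \<in> insert r \<tau>. s < r} = {s \<in> \<tau>. s < r}"
    by auto
  ultimately show ?thesis
    unfolding taylor_coef by (simp only: sum.insert sum.empty finite.emptyI empty_iff) (simp add: taylor_sign_def)
qed

lemma taylor_coef_eq_0:
  assumes "\<And>r. r \<in> \<sigma> \<Longrightarrow> \<tau> \<noteq> \<sigma> - {r}"
  shows "coef Tay \<tau> \<sigma> = 0"
proof -
  have "{r. r \<in> \<sigma> \<and> \<tau> = \<sigma> - {r}} = {}"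
    using assms by auto
  then show ?thesis
    unfolding taylor_coef by (simp only: sum.empty)
qed

lemma diff_taylor:
  fixes v :: "nat set \<Rightarrow> ('v, 'k) mpol"
  assumes \<tau>: "\<tau> \<in> basis_in Tay j"
  shows "diff Tay (Suc j) v \<tau> = (\<Sum>r\<in>{..<length ls} - \<tau>. coef Tay \<tau> (insert r \<tau>) * v (insert r \<tau>))"
proof -
  let ?I = "(\<lambda>r. insert r \<tau>) ` ({..<length ls} - \<tau>)"
  have inj: "inj_on (\<lambda>r. insert r \<tau>) ({..<length ls} - \<tau>)"
    by (auto simp: inj_on_def)
  have sub: "?I \<subseteq> basis_in Tay (Suc j)"
  proof
    fix \<sigma> assume "\<sigma> \<in> ?I"
    then show "\<sigma> \<in> basis_in Tay (Suc j)"
      using \<tau> finite_index[OF \<tau>] by (auto simp: basis_in_taylor)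
  qed
  have "coef Tay \<tau> \<sigma> = 0" if "\<sigma> \<in> basis_in Tay (Suc j) - ?I" for \<sigma>
  proof (rule taylor_coef_eq_0)
    fix r assume "r \<in> \<sigma>"
    show "\<tau> \<noteq> \<sigma> - {r}"
    proof
      assume "\<tau> = \<sigma> - {r}"
      moreover have "\<sigma> \<subseteq> {..<length ls}"
        using that by (simp add: basis_in_taylor)
      ultimately have "\<sigma> = insert r \<tau>" "r \<in> {..<length ls} - \<tau>"
        using \<open>r \<in> \<sigma>\<close> by auto
      then show False
        using that by blast
    qed
  qed
  then have "(\<Sum>\<sigma>\<in>basis_in Tay (Suc j). coef Tay \<tau> \<sigma> * v \<sigma>) = (\<Sum>\<sigma>\<in>?I. coef Tay \<tau> \<sigma> * v \<sigma>)"
    by (intro sum.mono_neutral_right finite_basis_taylor sub) auto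
  then show ?thesis
    using \<tau> by (simp add: diff_def sum.reindex[OF inj])
qed

lemma multigraded_taylor: "multigraded Tay"
  unfolding multigraded_def entry_keys[symmetric]
proof (intro conjI allI ballI)
  fix j \<sigma> \<tau> assume \<sigma>: "\<sigma> \<in> basis_in Tay (Suc j)" and \<tau>: "\<tau> \<in> basis_in Tay j"
  show "entry (mdeg Tay \<tau>) (mdeg Tay \<sigma>) (coef Tay \<tau> \<sigma>)"
  proof (cases "\<exists>r\<in>\<sigma>. \<tau> = \<sigma> - {r}")
    case True
    then obtain r where r: "r \<notin> \<tau>" "\<sigma> = insert r \<tau>"
      by blast
    then have "lcmdeg \<tau> + (lcmdeg \<sigma> - lcmdeg \<tau>) = lcmdeg \<sigma>"
      using finite_index[OF \<sigma>] by (intro mdvd_add_diff taylor_mdeg_mono) auto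
    then show ?thesis
      unfolding r(2) taylor_coef_insert[OF r(1)] taylor_simps taylor_sign_def
      by (intro entry_mult[OF entry_minus_one_power] entry_monom) (simp add: r(2))
  next
    case False
    then show ?thesis
      by (subst taylor_coef_eq_0) auto
  qed
qed (rule finite_basis_taylor)

text \<open>A homogeneous chain of multidegree \<open>\<mu>\<close> has at each symbol \<open>\<sigma>\<close> a scalar multiple of the monomial
  of exponent \<open>\<mu> - lcmdeg \<sigma>\<close>; these are the scalars.\<close>

abbreviation (input) strand where
  "strand \<mu> v \<equiv> (\<lambda>\<sigma>. Poly_Mapping.lookup (v \<sigma>) (\<mu> - lcmdeg \<sigma>))"

text \<open>In a fixed multidegree all monomials in the Taylor differential can be dropped, and what remains is the
  simplicial boundary, here in the transposed form that collects the cofaces of \<open>\<tau>\<close>.\<close>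

lemma diff_strand:
  fixes v :: "nat set \<Rightarrow> ('v, 'k) mpol"
  assumes v: "homogeneous Tay \<mu> v" and \<tau>: "\<tau> \<in> basis_in Tay j"
  shows "diff Tay (Suc j) v \<tau> = Poly_Mapping.single (\<mu> - lcmdeg \<tau>)
     (\<Sum>r\<in>{..<length ls} - \<tau>. taylor_sign r \<tau> * strand \<mu> v (insert r \<tau>))"
proof -
  have "coef Tay \<tau> (insert r \<tau>) * v (insert r \<tau>) =
      Poly_Mapping.single (\<mu> - lcmdeg \<tau>) (taylor_sign r \<tau> * strand \<mu> v (insert r \<tau>))"
    if r: "r \<in> {..<length ls} - \<tau>" for r
  proof -
    let ?\<sigma> = "insert r \<tau>" and ?c = "strand \<mu> v (insert r \<tau>)"
    have e: "entry (lcmdeg ?\<sigma>) \<mu> (v ?\<sigma>)"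
      using v by (simp add: homogeneous_entry)
    have "coef Tay \<tau> ?\<sigma> * v ?\<sigma> = Poly_Mapping.single 0 (taylor_sign r \<tau>) * Poly_Mapping.single (lcmdeg ?\<sigma> - lcmdeg \<tau>) 1
        * Poly_Mapping.single (\<mu> - lcmdeg ?\<sigma>) ?c"
      using r by (subst entry_eq_single[OF e])
        (simp add: taylor_coef_insert monom_def taylor_sign_def single_0_minus_one_power)
    also have "\<dots> = Poly_Mapping.single (lcmdeg ?\<sigma> - lcmdeg \<tau> + (\<mu> - lcmdeg ?\<sigma>)) (taylor_sign r \<tau> * ?c)"
      by (simp add: mult_single)
    also have "\<dots> = Poly_Mapping.single (\<mu> - lcmdeg \<tau>) (taylor_sign r \<tau> * ?c)"
    proof (cases "?c = 0")
      case False
      then have \<mu>: "lcmdeg ?\<sigma> + (\<mu> - lcmdeg ?\<sigma>) = \<mu>"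
        using e by (simp add: entry_def)
      have "lcmdeg \<tau> + (lcmdeg ?\<sigma> - lcmdeg \<tau>) = lcmdeg ?\<sigma>"
        using finite_index[OF \<tau>] by (intro mdvd_add_diff taylor_mdeg_mono) auto
      then have "lcmdeg \<tau> + (lcmdeg ?\<sigma> - lcmdeg \<tau> + (\<mu> - lcmdeg ?\<sigma>)) = \<mu>"
        using \<mu> by (simp add: add.assoc[symmetric])
      then have "lcmdeg ?\<sigma> - lcmdeg \<tau> + (\<mu> - lcmdeg ?\<sigma>) = \<mu> - lcmdeg \<tau>"
        by (metis add_diff_cancel_left')
      then show ?thesis by simp
    qed simp
    finally show ?thesis .
  qed
  then have "diff Tay (Suc j) v \<tau> = (\<Sum>r\<in>{..<length ls} - \<tau>.
      Poly_Mapping.single (\<mu> - lcmdeg \<tau>) (taylor_sign r \<tau> * strand \<mu> v (insert r \<tau>)))"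
    unfolding diff_taylor[OF \<tau>] by (rule sum.cong[OF refl])
  also have "\<dots> = Poly_Mapping.single (\<mu> - lcmdeg \<tau>)
     (\<Sum>r\<in>{..<length ls} - \<tau>. taylor_sign r \<tau> * strand \<mu> v (insert r \<tau>))"
    by (rule poly_mapping_eqI) (simp add: lookup_sum lookup_single when_def)
  finally show ?thesis .
qed

text \<open>Two vertices can be removed in two orders, with opposite signs.\<close>

lemma taylor_boundary_squared:
  fixes v :: "nat set \<Rightarrow> ('v, 'k) mpol"
  assumes v: "homogeneous Tay \<mu> v"
  shows "diff Tay (Suc j) (diff Tay (Suc (Suc j)) v) = (\<lambda>_. 0)"
proof
  fix \<rho>
  show "diff Tay (Suc j) (diff Tay (Suc (Suc j)) v) \<rho> = 0"
  proof (cases "\<rho> \<in> basis_in Tay j")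
    case True
    note fin = finite_index[OF True]
    let ?A = "{..<length ls} - \<rho>"
    let ?c = "\<lambda>r s. taylor_sign r \<rho> * (taylor_sign s (insert r \<rho>) * strand \<mu> v (insert s (insert r \<rho>)))"
    have "strand \<mu> (diff Tay (Suc (Suc j)) v) (insert r \<rho>) =
        (\<Sum>s\<in>?A - {r}. taylor_sign s (insert r \<rho>) * strand \<mu> v (insert s (insert r \<rho>)))"
      if "r \<in> ?A" for r
    proof -
      have "insert r \<rho> \<in> basis_in Tay (Suc j)"
        using True that fin by (auto simp: basis_in_taylor)
      moreover have "{..<length ls} - insert r \<rho> = ?A - {r}"
        by auto
      ultimately show ?thesis
        using diff_strand[OF v, of "insert r \<rho>"] by simp
    qed
    then have "(\<Sum>r\<in>?A. taylor_sign r \<rho> * strand \<mu> (diff Tay (Suc (Suc j)) v) (insert r \<rho>)) =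
        (\<Sum>r\<in>?A. taylor_sign r \<rho> *
          (\<Sum>s\<in>?A - {r}. taylor_sign s (insert r \<rho>) * strand \<mu> v (insert s (insert r \<rho>))))"
      by (intro sum.cong refl) (simp only:)
    also have "\<dots> = (\<Sum>r\<in>?A. \<Sum>s\<in>?A - {r}. ?c r s)"
      by (simp only: sum_distrib_left)
    also have "\<dots> = 0"
    proof (rule sum_antisymmetric)
      fix r s assume "r \<in> ?A" "s \<in> ?A" "r \<noteq> s"
      then show "?c r s = - ?c s r"
        unfolding insert_commute[of s r \<rho>]
        using fin by (cases "r < s") (simp_all add: taylor_sign_insert mult.left_commute)
    qed simp
    finally show ?thesis
      unfolding diff_strand[OF diff_graded[OF multigraded_taylor v] True] by simp
  qed (simp add: diff_def)
qed

text \<open>The symbols whose multidegree divides \<open>\<mu>\<close> are the faces of the full simplex on the generators that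
  divide \<open>\<mu>\<close>.  For a nonzero chain in positive degree this simplex has a vertex \<open>z\<close>, and the cone with
  apex \<open>z\<close> over a cycle bounds it.\<close>

lemma taylor_cycle_is_boundary:
  fixes v :: "nat set \<Rightarrow> ('v, 'k) mpol"
  assumes v: "v \<in> chains Tay (Suc j)" "homogeneous Tay \<mu> v" and cycle: "diff Tay (Suc j) v = (\<lambda>_. 0)"
  shows "v \<in> boundaries Tay (Suc j)"
proof (cases "v = (\<lambda>_. 0)")
  case True
  then have "v = diff Tay (Suc (Suc j)) (\<lambda>_. 0)"
    by (simp add: diff_0)
  then show ?thesis
    using chains_0 by (rule image_eqI)
next
  case False
  have dvd: "lcmdeg \<sigma> mdvd \<mu>" if nonzero: "v \<sigma> \<noteq> 0" for \<sigma>
  proof -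
    obtain k where "Poly_Mapping.lookup (v \<sigma>) k \<noteq> 0"
      using nonzero by (metis poly_mapping_eqI lookup_zero)
    then have "lcmdeg \<sigma> + k = \<mu>"
      using v(2) by (simp add: homogeneous_entry entry_def)
    then show ?thesis
      unfolding mdvd_def by blast
  qed
  obtain \<sigma> where \<sigma>0: "v \<sigma> \<noteq> 0"
    using False by (auto simp: fun_eq_iff)
  then have \<sigma>: "v \<sigma> \<noteq> 0" "\<sigma> \<in> basis_in Tay (Suc j)"
    using chains_eq_0[OF v(1)] by blast+
  then have "\<sigma> \<subseteq> {..<length ls}" "\<sigma> \<noteq> {}"
    by (auto simp: basis_in_taylor)
  then obtain z where z: "z \<in> \<sigma>" "z < length ls"
    by blast
  have z_dvd: "ls ! z mdvd \<mu>"
    using dvd[OF \<sigma>(1)] z(1) finite_index[OF \<sigma>(2)] by (simp add: taylor_mdeg_mdvd_iff)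
  \<comment> \<open>The cone with apex \<open>z\<close> over \<open>v\<close>, in multidegree \<open>\<mu>\<close>.\<close>
  define w where "w = (\<lambda>\<tau>. if \<tau> \<in> basis_in Tay (Suc (Suc j)) \<and> z \<in> \<tau>
    then Poly_Mapping.single (\<mu> - lcmdeg \<tau>) (taylor_sign z (\<tau> - {z}) * strand \<mu> v (\<tau> - {z})) else 0)"
  have w: "w \<in> chains Tay (Suc (Suc j))"
    by (simp add: w_def chains_def)
  have w_hom: "homogeneous Tay \<mu> w"
    unfolding homogeneous_entry taylor_simps
  proof
    fix \<tau>
    show "entry (lcmdeg \<tau>) \<mu> (w \<tau>)"
    proof (cases "\<tau> \<in> basis_in Tay (Suc (Suc j)) \<and> z \<in> \<tau> \<and> v (\<tau> - {z}) \<noteq> 0")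
      case True
      then have "finite \<tau>"
        using finite_index by blast
      with True dvd[of "\<tau> - {z}"] z_dvd have "lcmdeg \<tau> mdvd \<mu>"
        by (auto simp: taylor_mdeg_mdvd_iff)
      from mdvd_add_diff[OF this] show ?thesis
        by (auto simp: w_def entry_def lookup_single when_def)
    qed (auto simp: w_def)
  qed
  have strand_w: "strand \<mu> w \<tau> = (if z \<in> \<tau> then taylor_sign z (\<tau> - {z}) * strand \<mu> v (\<tau> - {z}) else 0)"
    if "\<tau> \<in> basis_in Tay (Suc (Suc j))" for \<tau>
    using that by (simp add: w_def)
  have "diff Tay (Suc (Suc j)) w \<tau> = v \<tau>" for \<tau>
  proof (cases "\<tau> \<in> basis_in Tay (Suc j)")
    case \<tau>: True
    note fin = finite_index[OF \<tau>]
    have ins: "insert r \<tau> \<in> basis_in Tay (Suc (Suc j))" if "r \<in> {..<length ls} - \<tau>" for r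
      using \<tau> that fin by (auto simp: basis_in_taylor)
    have "(\<Sum>r\<in>{..<length ls} - \<tau>. taylor_sign r \<tau> * strand \<mu> w (insert r \<tau>)) = strand \<mu> v \<tau>"
    proof (cases "z \<in> \<tau>")
      case False
      have "(\<Sum>r\<in>{..<length ls} - \<tau>. taylor_sign r \<tau> * strand \<mu> w (insert r \<tau>)) =
          (\<Sum>r\<in>{..<length ls} - \<tau>. if r = z then strand \<mu> v \<tau> else 0)"
        using False by (intro sum.cong refl) (auto simp: strand_w ins taylor_sign_square)
      also have "\<dots> = strand \<mu> v \<tau>"
        using False z by simp
      finally show ?thesis .
    next
      case True
      define \<rho> where "\<rho> = \<tau> - {z}"
      have \<tau>_eq: "\<tau> = insert z \<rho>" and z\<rho>: "z \<notin> \<rho>"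
        using True by (auto simp: \<rho>_def)
      have \<rho>: "\<rho> \<in> basis_in Tay j" "finite \<rho>"
        using \<tau> True fin by (auto simp: basis_in_taylor \<rho>_def)
      let ?R = "\<Sum>r\<in>{..<length ls} - \<tau>. taylor_sign r \<rho> * strand \<mu> v (insert r \<rho>)"
      have "Poly_Mapping.single (\<mu> - lcmdeg \<rho>) (\<Sum>r\<in>{..<length ls} - \<rho>. taylor_sign r \<rho> * strand \<mu> v (insert r \<rho>)) = 0"
        using diff_strand[OF v(2) \<rho>(1)] cycle by simp
      then have "(\<Sum>r\<in>{..<length ls} - \<rho>. taylor_sign r \<rho> * strand \<mu> v (insert r \<rho>)) = 0"
        by (subst lookup_single_eq[of "\<mu> - lcmdeg \<rho>", symmetric]) (simp only: lookup_zero)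
      moreover have "{..<length ls} - \<rho> = insert z ({..<length ls} - \<tau>)"
        unfolding \<rho>_def using z(2) by blast
      moreover have "finite ({..<length ls} - \<tau>)" "z \<notin> {..<length ls} - \<tau>"
        using True by auto
      ultimately have "taylor_sign z \<rho> * strand \<mu> v (insert z \<rho>) + ?R = 0"
        by (simp only: sum.insert not_False_eq_True)
      then have R: "?R = - (taylor_sign z \<rho> * strand \<mu> v \<tau>)"
        unfolding \<tau>_eq[symmetric] by (simp only: eq_neg_iff_add_eq_0 add.commute)
      have "taylor_sign r \<tau> * strand \<mu> w (insert r \<tau>) =
          - (taylor_sign z \<rho> * (taylor_sign r \<rho> * strand \<mu> v (insert r \<rho>)))"
        if r: "r \<in> {..<length ls} - \<tau>" for r
      proof -
        have eq: "insert r \<tau> - {z} = insert r \<rho>" and "r \<noteq> z" "r \<notin> \<rho>"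
          using r True by (auto simp: \<rho>_def)
        have s: "strand \<mu> w (insert r \<tau>) = taylor_sign z (insert r \<rho>) * strand \<mu> v (insert r \<rho>)"
          unfolding strand_w[OF ins[OF r]] eq using True by simp
        have "taylor_sign r (insert z \<rho>) * taylor_sign z (insert r \<rho>) =
            - (taylor_sign z \<rho> * taylor_sign r \<rho> :: 'k)"
          using \<rho>(2) z\<rho> \<open>r \<noteq> z\<close> \<open>r \<notin> \<rho>\<close>
          by (cases "r < z") (simp_all add: taylor_sign_insert mult.commute)
        then have "taylor_sign r \<tau> * taylor_sign z (insert r \<rho>) = - (taylor_sign z \<rho> * taylor_sign r \<rho> :: 'k)"
          by (simp only: \<tau>_eq[symmetric])
        then show ?thesis
          unfolding s mult.assoc[symmetric] by (simp only: mult_minus_left)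
      qed
      then have "(\<Sum>r\<in>{..<length ls} - \<tau>. taylor_sign r \<tau> * strand \<mu> w (insert r \<tau>)) =
          - (taylor_sign z \<rho> * ?R)"
        unfolding sum_distrib_left sum_negf[symmetric] by (rule sum.cong[OF refl])
      then show ?thesis
        unfolding R by (simp add: taylor_sign_square)
    qed
    moreover have "entry (lcmdeg \<tau>) \<mu> (v \<tau>)"
      using v(2) by (simp add: homogeneous_entry)
    ultimately show ?thesis
      unfolding diff_strand[OF w_hom \<tau>] by (simp only: entry_eq_single[symmetric])
  next
    case False
    then show ?thesis
      using chains_eq_0[OF v(1) False] by (simp add: diff_def)
  qed
  then have "diff Tay (Suc (Suc j)) w = v" ..
  with w show ?thesis by blast
qed

lemma exact_taylor: "exact_complex Tay"
proof (rule exact_complexI_homogeneous[OF multigraded_taylor])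
  fix j d and v :: "nat set \<Rightarrow> ('v, 'k) mpol"
  assume v: "homogeneous Tay d v"
  then show "diff Tay (Suc j) (diff Tay (Suc (Suc j)) v) = (\<lambda>_. 0)"
    by (rule taylor_boundary_squared)
  assume "v \<in> chains Tay (Suc j)" "diff Tay (Suc j) v = (\<lambda>_. 0)"
  with v show "v \<in> boundaries Tay (Suc j)"
    by (intro taylor_cycle_is_boundary)
qed

lemma ideal_gen_list:
  "ideal_gen (monom ` set ls) = {\<Sum>r<length ls. monom (ls ! r) * f r | f. True}"
proof (intro equalityI subsetI)
  fix p assume "p \<in> ideal_gen (monom ` set ls)"
  then show "p \<in> {\<Sum>r<length ls. monom (ls ! r) * f r | f. True}"
  proof (induction rule: ideal.span_induct_alt)
    case base
    show ?case
      unfolding mem_Collect_eq by (intro exI[of _ "\<lambda>_. 0"] conjI TrueI) simp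
  next
    case (step c x y)
    from step(1) obtain i where i: "i < length ls" "x = monom (ls ! i)"
      by (auto simp: in_set_conv_nth)
    from step(2) obtain f where f: "y = (\<Sum>r<length ls. monom (ls ! r) * f r)"
      unfolding mem_Collect_eq by (elim exE conjE)
    have "(\<Sum>r<length ls. monom (ls ! r) * (if r = i then c else 0)) =
        (\<Sum>r<length ls. if r = i then monom (ls ! r) * c else 0)"
      by (rule sum.cong) auto
    also have "\<dots> = c * x"
      using i by (simp add: mult.commute)
    finally have "c * x + y = (\<Sum>r<length ls. monom (ls ! r) * (f r + (if r = i then c else 0)))"
      unfolding f distrib_left sum.distrib by (simp only: add.commute)
    then show ?case
      unfolding mem_Collect_eq by (intro exI[of _ "\<lambda>r. f r + (if r = i then c else 0)"] conjI TrueI)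
  qed
next
  fix p assume "p \<in> {\<Sum>r<length ls. monom (ls ! r) * f r | f. True}"
  then obtain f where p: "p = (\<Sum>r<length ls. monom (ls ! r) * f r)"
    unfolding mem_Collect_eq by (elim exE conjE)
  show "p \<in> ideal_gen (monom ` set ls)"
    unfolding p
  proof (rule ideal.span_sum)
    fix r assume "r \<in> {..<length ls}"
    then have "f r * monom (ls ! r) \<in> ideal_gen (monom ` set ls)"
      by (intro ideal.span_scale ideal.span_base) simp
    then show "monom (ls ! r) * f r \<in> ideal_gen (monom ` set ls)"
      by (simp only: mult.commute)
  qed
qed

text \<open>In degree 0 there is only the empty symbol, and the boundary of a chain \<open>v\<close> of degree 1 is the
  combination of the generators with coefficients \<open>v {r}\<close>.\<close>

lemma augmentation_taylor: "augmentation Tay (ideal_gen (monom ` set ls)) (\<lambda>_. 1)"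
proof -
  let ?M = "ideal_gen (monom ` set ls)"
  have b0: "basis_in Tay 0 = {{}}"
  proof (intro equalityI subsetI)
    fix \<sigma> assume \<sigma>: "\<sigma> \<in> basis_in Tay 0"
    from finite_index[OF this] \<sigma> show "\<sigma> \<in> {{}}"
      by (simp add: basis_in_taylor)
  qed (simp add: basis_in_taylor)
  have md0: "lcmdeg {} = 0"
    by (rule poly_mapping_eqI) (simp add: taylor_mdeg_def lookup_lcm_mon)
  have md1: "lcmdeg {r} = ls ! r" for r
    by (rule poly_mapping_eqI) (simp add: taylor_mdeg_def lookup_lcm_mon)
  have aug: "augment Tay (\<lambda>_. 1) v = v {}" for v
    by (simp add: augment_def b0)
  have coef1: "coef Tay {} {r} = monom (ls ! r)" for r
    using taylor_coef_insert[of r "{}"] by (simp add: md0 md1 taylor_sign_def)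
  have d1: "diff Tay (Suc 0) v {} = (\<Sum>r<length ls. monom (ls ! r) * v {r})" for v
    using diff_taylor[of "{}" 0 v] by (simp add: b0 coef1)
  show ?thesis
    unfolding augmentation_def
  proof (intro conjI allI)
    show "\<forall>b\<in>basis_in Tay 0. entry 0 (mdeg Tay b) 1"
      by (simp add: b0 md0)
    show "\<exists>v\<in>chains Tay 0. s - augment Tay (\<lambda>_. 1) v \<in> ?M" for s
      by (rule bexI[of _ "\<lambda>b. if b = {} then s else 0"])
        (auto simp: aug ideal.span_zero chains_def b0)
    show "{v \<in> chains Tay 0. augment Tay (\<lambda>_. 1) v \<in> ?M} = boundaries Tay 0"
      unfolding aug ideal_gen_list
    proof (intro equalityI subsetI)
      fix v assume "v \<in> {v \<in> chains Tay 0. v {} \<in> {\<Sum>r<length ls. monom (ls ! r) * f r | f. True}}"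
      then obtain f where v: "v \<in> chains Tay 0" and f: "v {} = (\<Sum>r<length ls. monom (ls ! r) * f r)"
        unfolding mem_Collect_eq by (elim conjE exE)
      define w where "w = (\<lambda>\<sigma>. if \<sigma> \<in> basis_in Tay (Suc 0) then f (the_elem \<sigma>) else 0)"
      have "w {r} = f r" if "r < length ls" for r
        using that by (simp add: w_def basis_in_taylor)
      then have "diff Tay (Suc 0) w {} = v {}"
        by (simp add: d1 f)
      then have "diff Tay (Suc 0) w b = v b" for b
        using chains_eq_0[OF v, of b] by (cases "b = {}") (auto simp: b0 diff_def)
      then have "v = diff Tay (Suc 0) w" by auto
      moreover have "w \<in> chains Tay (Suc 0)"
        by (simp add: w_def chains_def)
      ultimately show "v \<in> boundaries Tay 0"
        by blast
    next
      fix v assume "v \<in> boundaries Tay 0"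
      then obtain w where "v = diff Tay (Suc 0) w"
        by blast
      then have "v \<in> chains Tay 0" "v {} = (\<Sum>r<length ls. monom (ls ! r) * w {r})"
        by (simp_all only: diff_in_chains d1)
      then show "v \<in> {v \<in> chains Tay 0. v {} \<in> {\<Sum>r<length ls. monom (ls ! r) * f r | f. True}}"
        unfolding mem_Collect_eq by (intro conjI exI[of _ "\<lambda>r. w {r}"] TrueI)
    qed
  qed
qed

end


section \<open>Semidominant ideals\<close>

lemma const_term_entry: "entry x y p \<Longrightarrow> const_term p \<noteq> 0 \<Longrightarrow> x = y"
  by (auto simp: entry_def const_term_def)

lemma single_mdvd_iff: "Poly_Mapping.single x k mdvd m \<longleftrightarrow> k \<le> Poly_Mapping.lookup m x"
  by (auto simp: mdvd_iff lookup_single when_def)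

lemma not_single_mdvd_lcm_mon:
  assumes "finite X" "k \<ge> 1" "\<And>m. m \<in> X \<Longrightarrow> \<not> Poly_Mapping.single x k mdvd m"
  shows "\<not> Poly_Mapping.single x k mdvd lcm_mon X"
proof -
  have "Poly_Mapping.lookup m x \<le> k - 1" if "m \<in> X" for m
    using assms(3)[OF that] assms(2) unfolding single_mdvd_iff by linarith
  then have "Poly_Mapping.lookup (lcm_mon X) x \<le> k - 1"
    by (simp add: lookup_lcm_mon_le_iff[OF assms(1)])
  then show ?thesis
    using assms(2) unfolding single_mdvd_iff by linarith
qed

text \<open>The dominant generators come first and \<open>n\<close> comes last, at position \<open>q\<close>.  As above, \<open>K\<close> pins down the
  coefficient field.\<close>

locale dominant_and_one =
  fixes ms :: "('v::finite) mon list" and n :: "'v mon" and K :: "'k::field itself"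
  assumes distinct: "distinct (ms @ [n])"
    and dominant: "\<forall>m\<in>set ms. dominant (set (ms @ [n])) m"
begin

abbreviation (input) "ls \<equiv> ms @ [n]"
abbreviation (input) "q \<equiv> length ms"
abbreviation (input) "TR \<equiv> taylor ls :: (nat set, 'v, 'k) mgcomplex"

definition cancelled_pairs :: "(nat set \<times> nat set) set" where
  "cancelled_pairs = {(insert q U, U) | U. U \<subseteq> {..<q} \<and> n mdvd lcm_mon ((\<lambda>i. ms ! i) ` U)}"

lemma cancelled_pairs_cases:
  assumes "(\<sigma>, \<tau>) \<in> cancelled_pairs"
  shows "\<sigma> = insert q \<tau>" "\<tau> \<subseteq> {..<q}" "n mdvd taylor_mdeg ls \<tau>"
proof -
  show \<tau>: "\<sigma> = insert q \<tau>" "\<tau> \<subseteq> {..<q}"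
    using assms by (auto simp: cancelled_pairs_def)
  have "(!) ls ` \<tau> = (!) ms ` \<tau>"
    using \<tau>(2) by (intro image_cong) (auto simp: nth_append)
  then show "n mdvd taylor_mdeg ls \<tau>"
    using assms by (auto simp: cancelled_pairs_def taylor_mdeg_def)
qed

lemma cancelled_pairs_intro:
  assumes "\<tau> \<subseteq> {..<q}" "n mdvd taylor_mdeg ls \<tau>"
  shows "(insert q \<tau>, \<tau>) \<in> cancelled_pairs"
proof -
  have "(!) ls ` \<tau> = (!) ms ` \<tau>"
    using assms(1) by (intro image_cong) (auto simp: nth_append)
  then show ?thesis
    using assms by (auto simp: cancelled_pairs_def taylor_mdeg_def)
qed

lemma finite_cancelled_pairs: "finite cancelled_pairs"
proof (rule finite_subset)
  show "cancelled_pairs \<subseteq> (\<lambda>U. (insert q U, U)) ` Pow {..<q}"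
    by (auto simp: cancelled_pairs_def)
qed simp

lemma cancelled_pairs_mdeg:
  assumes "(\<sigma>, \<tau>) \<in> cancelled_pairs"
  shows "taylor_mdeg ls \<sigma> = taylor_mdeg ls \<tau>"
proof -
  note pair = cancelled_pairs_cases[OF assms]
  have fin: "finite \<tau>"
    using pair(2) finite_subset by blast
  have "taylor_mdeg ls \<sigma> mdvd taylor_mdeg ls \<tau>"
    unfolding taylor_mdeg_mdvd_iff[OF finite.insertI[OF fin], of ls q] pair(1)
    using pair(3) mdvd_refl[of "taylor_mdeg ls \<tau>"] fin by (simp add: taylor_mdeg_mdvd_iff)
  moreover have "taylor_mdeg ls \<tau> mdvd taylor_mdeg ls \<sigma>"
    using pair(1) fin by (intro taylor_mdeg_mono) auto
  ultimately show ?thesis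
    unfolding mdvd_iff by (intro poly_mapping_eqI) (simp add: order.antisym)
qed

text \<open>By dominance some power of a variable divides the generator at \<open>r\<close> and no other one, hence it
  divides the least common multiple over \<open>\<sigma>\<close> and not the one over \<open>\<tau>\<close>.\<close>

lemma dominant_mdeg:
  assumes r: "r < q" "r \<in> \<sigma>" and \<sigma>: "\<sigma> \<subseteq> {..q}" and \<tau>: "\<tau> \<subseteq> {..q} - {r}"
  shows "taylor_mdeg ls \<sigma> \<noteq> taylor_mdeg ls \<tau>"
proof
  assume eq: "taylor_mdeg ls \<sigma> = taylor_mdeg ls \<tau>"
  have "ls ! r \<in> set ms"
    using r(1) by (simp add: nth_append)
  then obtain x k where k: "k \<ge> 1" "Poly_Mapping.single x k mdvd ls ! r"
    "\<forall>m'\<in>set ls - {ls ! r}. \<not> Poly_Mapping.single x k mdvd m'"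
    using dominant unfolding dominant_def by blast
  have fin: "finite \<sigma>" "finite \<tau>"
    using \<sigma> \<tau> by (auto intro: finite_subset)
  have "ls ! r mdvd taylor_mdeg ls \<sigma>"
    unfolding taylor_mdeg_def using r(2) fin by (intro mdvd_lcm_mon) auto
  then have "Poly_Mapping.single x k mdvd lcm_mon ((\<lambda>i. ls ! i) ` \<tau>)"
    using k(2) mdvd_trans eq unfolding taylor_mdeg_def by metis
  moreover have "\<not> Poly_Mapping.single x k mdvd m" if m: "m \<in> (\<lambda>i. ls ! i) ` \<tau>" for m
  proof -
    obtain s where s: "s \<in> \<tau>" "m = ls ! s"
      using m by blast
    then have "s < length ls" "s \<noteq> r"
      using \<tau> by auto
    moreover have "r < length ls"
      using r(1) by simp
    ultimately have "ls ! s \<in> set ls - {ls ! r}"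
      using distinct by (simp only: nth_eq_iff_index_eq nth_mem Diff_iff singleton_iff) simp
    then show ?thesis
      using k(3) s(2) by blast
  qed
  ultimately show False
    using not_single_mdvd_lcm_mon[of "(\<lambda>i. ls ! i) ` \<tau>" k x] fin(2) k(1) by blast
qed

text \<open>A nonzero entry belongs to the removal of one generator, and a nonzero constant term forces equal
  multidegrees.  By \<open>dominant_mdeg\<close> the generator removed is then \<open>n\<close>, and it divides the least common multiple
  of the others.\<close>

lemma TR_const_term:
  assumes \<sigma>: "\<sigma> \<subseteq> {..q}" and nz: "const_term (coef TR \<tau> \<sigma>) \<noteq> 0"
  shows "(\<sigma>, \<tau>) \<in> cancelled_pairs"
proof -
  have "coef TR \<tau> \<sigma> \<noteq> 0"
    using nz by auto
  then obtain r where r: "r \<in> \<sigma>" "\<tau> = \<sigma> - {r}"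
    using taylor_coef_eq_0[of \<sigma> \<tau> ls] by blast
  have fin: "finite \<sigma>"
    using \<sigma> finite_subset by blast
  have "\<sigma> \<in> basis_in TR (Suc (card \<tau>))" "\<tau> \<in> basis_in TR (card \<tau>)"
    using r \<sigma> card_Suc_Diff1[OF fin r(1)] by (auto simp: basis_in_taylor)
  from multigradedD(2)[OF multigraded_taylor this]
  have "entry (taylor_mdeg ls \<tau>) (taylor_mdeg ls \<sigma>) (coef TR \<tau> \<sigma>)"
    by simp
  then have eq: "taylor_mdeg ls \<tau> = taylor_mdeg ls \<sigma>"
    using nz by (rule const_term_entry)
  have "r \<le> q"
    using r \<sigma> by auto
  moreover have "\<not> r < q"
    using dominant_mdeg[of r \<sigma> \<tau>] r \<sigma> eq by auto
  ultimately have "r = q"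
    by simp
  have "\<tau> \<subseteq> {..<q}"
    using r \<sigma> \<open>r = q\<close> by (auto simp: le_less)
  moreover have "n mdvd taylor_mdeg ls \<tau>"
    unfolding eq unfolding taylor_mdeg_def using r(1) \<open>r = q\<close> fin
    by (intro mdvd_lcm_mon) (auto intro!: image_eqI[of _ _ q])
  ultimately have "(insert q \<tau>, \<tau>) \<in> cancelled_pairs"
    by (rule cancelled_pairs_intro)
  moreover have "insert q \<tau> = \<sigma>"
    using r \<open>r = q\<close> by auto
  ultimately show ?thesis by simp
qed

lemma TR_coef_q:
  assumes "q \<notin> \<tau>" "q \<in> \<theta>" "\<theta> \<noteq> insert q \<tau>"
  shows "coef TR \<tau> \<theta> = 0"
  using assms by (intro taylor_coef_eq_0) auto

text \<open>What survives every cancellation at a pair in \<open>cancelled_pairs\<close>: of the four blocks of the differential, three still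
  agree with the Taylor differential, and the fourth, from symbols without \<open>q\<close> to symbols with \<open>q\<close>, has
  acquired corrections without constant term.\<close>

definition partly_cancelled :: "(nat set, 'v, 'k) mgcomplex \<Rightarrow> bool" where
  "partly_cancelled F \<longleftrightarrow> basis F \<subseteq> Pow {..q} \<and> hdeg F = card \<and> mdeg F = taylor_mdeg ls \<and>
     (\<forall>\<pi>\<in>basis F. \<forall>\<theta>\<in>basis F. q \<in> \<theta> \<or> q \<notin> \<pi> \<longrightarrow> coef F \<pi> \<theta> = coef TR \<pi> \<theta>) \<and>
     (\<forall>\<pi>\<in>basis F. \<forall>\<theta>\<in>basis F. q \<notin> \<theta> \<and> q \<in> \<pi> \<longrightarrow> const_term (coef F \<pi> \<theta>) = 0)"

lemma partly_cancelledD: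
  assumes "partly_cancelled F"
  shows "basis F \<subseteq> Pow {..q}" "hdeg F = card" "mdeg F = taylor_mdeg ls"
    and "\<pi> \<in> basis F \<Longrightarrow> \<theta> \<in> basis F \<Longrightarrow> q \<in> \<theta> \<or> q \<notin> \<pi> \<Longrightarrow> coef F \<pi> \<theta> = coef TR \<pi> \<theta>"
    and "\<pi> \<in> basis F \<Longrightarrow> \<theta> \<in> basis F \<Longrightarrow> q \<notin> \<theta> \<Longrightarrow> q \<in> \<pi> \<Longrightarrow> const_term (coef F \<pi> \<theta>) = 0"
  using assms unfolding partly_cancelled_def by blast+

lemma partly_cancelled_taylor: "partly_cancelled TR"
proof -
  have "{..<length ls} = {..q}"
    by auto
  moreover have "coef TR \<pi> \<theta> = 0" if "q \<notin> \<theta>" "q \<in> \<pi>" for \<pi> \<theta>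
    using that by (intro taylor_coef_eq_0) auto
  ultimately show ?thesis
    by (simp add: partly_cancelled_def)
qed

text \<open>The correction \<open>a\<^sub>\<pi>\<^sub>\<sigma> u a\<^sub>\<tau>\<^sub>\<theta>\<close> has two factors.  If \<open>q \<in> \<theta>\<close>, the second lies in the diagonal block and
  off its diagonal; if \<open>q \<notin> \<pi>\<close>, so does the first.  In the remaining block the second factor joins two
  symbols without \<open>q\<close>, so its constant term vanishes by dominance.\<close>

lemma partly_cancelled_cancel:
  assumes F: "partly_cancelled F" and p: "(\<sigma>, \<tau>) \<in> cancelled_pairs" and in_F: "\<sigma> \<in> basis F" "\<tau> \<in> basis F"
  shows "partly_cancelled (cancel F \<sigma> \<tau> u)"
proof -
  note FD = partly_cancelledD[OF F]
  have \<sigma>: "\<sigma> = insert q \<tau>" and q\<tau>: "q \<notin> \<tau>"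
    using cancelled_pairs_cases[OF p] by auto
  have "coef F \<pi> \<sigma> * u * coef F \<tau> \<theta> = 0"
    if "\<pi> \<in> basis F" "\<theta> \<in> basis F" "\<pi> \<noteq> \<tau>" "\<theta> \<noteq> \<sigma>" "q \<in> \<theta> \<or> q \<notin> \<pi>" for \<pi> \<theta>
  proof (cases "q \<in> \<theta>")
    case True
    then have "coef F \<tau> \<theta> = 0"
      using FD(4)[OF in_F(2) that(2)] TR_coef_q[OF q\<tau> True] that(4) \<sigma> by simp
    then show ?thesis by simp
  next
    case False
    then have q: "q \<notin> \<pi>"
      using that by blast
    have "\<sigma> \<noteq> insert q \<pi>"
      using that(3) q q\<tau> \<sigma> by (metis insert_ident)
    then have "coef F \<pi> \<sigma> = 0"
      using FD(4)[OF that(1) in_F(1)] TR_coef_q[OF q, of \<sigma>] \<sigma> by simp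
    then show ?thesis by simp
  qed
  moreover have "const_term (coef F \<tau> \<theta>) = 0" if "\<theta> \<in> basis F" "q \<notin> \<theta>" for \<theta>
  proof (rule ccontr)
    assume "const_term (coef F \<tau> \<theta>) \<noteq> 0"
    then have "const_term (coef TR \<tau> \<theta>) \<noteq> 0"
      using FD(4)[OF in_F(2) that(1)] q\<tau> by simp
    then have "(\<theta>, \<tau>) \<in> cancelled_pairs"
      using FD(1) that(1) by (intro TR_const_term) auto
    then show False
      using cancelled_pairs_cases(1) that(2) by blast
  qed
  ultimately show ?thesis
    using FD unfolding partly_cancelled_def by (auto simp: cancel_def)
qed

text \<open>A cancellation does not remove basis elements that later cancellations need.\<close>

lemma cancelled_pairs_disjoint:
  assumes "(\<sigma>, \<tau>) \<in> cancelled_pairs" "(\<sigma>', \<tau>') \<in> cancelled_pairs" "(\<sigma>, \<tau>) \<noteq> (\<sigma>', \<tau>')"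
  shows "\<sigma>' \<notin> {\<sigma>, \<tau>}" "\<tau>' \<notin> {\<sigma>, \<tau>}"
proof -
  note pair = cancelled_pairs_cases(1,2)[OF assms(1)] cancelled_pairs_cases(1,2)[OF assms(2)]
  then have q: "q \<notin> \<tau>" "q \<notin> \<tau>'"
    by auto
  then have "\<tau> \<noteq> \<tau>'"
    using pair(1,3) assms(3) by auto
  then show "\<sigma>' \<notin> {\<sigma>, \<tau>}" "\<tau>' \<notin> {\<sigma>, \<tau>}"
    unfolding pair(1,3) using q by (auto dest: insert_ident[THEN iffD1, rotated 2])
qed

text \<open>Each pivot lies in the block that still agrees with the Taylor differential; there it is a sign,
  because both symbols of the pair have the same multidegree, and so it is its own inverse.\<close>

lemma cancel_all:
  fixes F :: "(nat set, 'v, 'k) mgcomplex"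
  assumes M: "M = ideal_gen (monom ` X)"
    and "partly_cancelled F" "multigraded F" "exact_complex F" "augmentation F M e"
    and "distinct ps" "set ps \<subseteq> cancelled_pairs" "\<forall>(\<sigma>, \<tau>)\<in>set ps. \<sigma> \<in> basis F \<and> \<tau> \<in> basis F"
  shows "\<exists>F'. std_cancellations F ps F' \<and> partly_cancelled F' \<and> multigraded F' \<and> exact_complex F' \<and>
    augmentation F' M e \<and> basis F' = basis F - (\<Union>(\<sigma>, \<tau>)\<in>set ps. {\<sigma>, \<tau>}) \<and>
    F \<cong>\<^sub>m dsum F' (big_dsum (set ps) (short_complex TR))"
  using assms(2-)
proof (induction ps arbitrary: F)
  case Nil
  then show ?case
    using dsum_empty_iso[of F] by (auto intro!: exI[of _ F] std_cancellations.Nil)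
next
  case (Cons p ps)
  obtain \<sigma> \<tau> where p: "p = (\<sigma>, \<tau>)"
    by (cases p)
  note FD = partly_cancelledD[OF Cons.prems(1)]
  have pA: "(\<sigma>, \<tau>) \<in> cancelled_pairs" and in_F: "\<sigma> \<in> basis F" "\<tau> \<in> basis F"
    using Cons.prems(6,7) by (auto simp: p)
  have \<sigma>: "\<sigma> = insert q \<tau>" and q\<tau>: "q \<notin> \<tau>" and fin\<tau>: "finite \<tau>"
    using cancelled_pairs_cases[OF pA] by (auto intro: finite_subset)
  define u :: "('v, 'k) mpol" where "u = taylor_sign q \<tau>"
  have "coef F \<tau> \<sigma> = coef TR \<tau> \<sigma>"
    using in_F q\<tau> by (intro FD(4)) auto
  also have "\<dots> = u * monom (taylor_mdeg ls \<sigma> - taylor_mdeg ls \<tau>)"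
    unfolding \<sigma> u_def by (rule taylor_coef_insert[OF q\<tau>])
  also have "\<dots> = u"
    by (simp add: cancelled_pairs_mdeg[OF pA] monom_def)
  finally have coef: "coef F \<tau> \<sigma> = u" .
  interpret c: cancellation F \<sigma> \<tau> u M e X
  proof
    show "coef F \<tau> \<sigma> * u = 1"
      unfolding coef u_def using taylor_sign_square[of q \<tau> "1 :: ('v, 'k) mpol"] by simp
    show "entry 0 0 u"
      by (simp add: u_def taylor_sign_def)
    show "hdeg F \<sigma> = Suc (hdeg F \<tau>)"
      using FD(2) \<sigma> q\<tau> fin\<tau> by simp
  qed (use M Cons.prems FD(3) cancelled_pairs_mdeg[OF pA] in_F in simp_all)
  let ?F = "cancel F \<sigma> \<tau> u"
  have notin: "p \<notin> set ps"
    using Cons.prems(5) by simp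
  have "\<forall>(\<sigma>', \<tau>')\<in>set ps. \<sigma>' \<in> basis ?F \<and> \<tau>' \<in> basis ?F"
  proof safe
    fix \<sigma>' \<tau>' assume p': "(\<sigma>', \<tau>') \<in> set ps"
    then have "(\<sigma>', \<tau>') \<in> cancelled_pairs" "(\<sigma>, \<tau>) \<noteq> (\<sigma>', \<tau>')"
      using Cons.prems(6) notin p by auto
    from cancelled_pairs_disjoint[OF pA this] p' Cons.prems(7) show "\<sigma>' \<in> basis ?F" "\<tau>' \<in> basis ?F"
      by auto
  qed
  then obtain F' where F': "std_cancellations ?F ps F'" "partly_cancelled F'" "multigraded F'"
    "exact_complex F'" "augmentation F' M e" "basis F' = basis ?F - (\<Union>(\<sigma>, \<tau>)\<in>set ps. {\<sigma>, \<tau>})"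
    "?F \<cong>\<^sub>m dsum F' (big_dsum (set ps) (short_complex TR))"
    using Cons.IH[OF partly_cancelled_cancel[OF Cons.prems(1) pA in_F] c.multigraded_F' c.exact_F'
        c.augmentation_F'] Cons.prems(5,6) by auto
  have S: "short_complex F (\<sigma>, \<tau>) = short_complex TR p"
    unfolding p short_complex_def using FD(2,3) by (intro mgcomplex.equality) simp_all
  let ?B = "big_dsum (set ps) (short_complex TR)"
  have finS: "finite (basis_in (short_complex TR p) j)" for j
    by (simp add: basis_in_def short_complex_def p)
  have finB: "finite (basis_in ?B j)" for j
    by (rule finite_basis_big_dsum) (auto simp: short_complex_def)
  have "F \<cong>\<^sub>m dsum ?F (short_complex TR p)"
    using c.iso by (simp only: S)
  also have "\<dots> \<cong>\<^sub>m dsum (dsum F' ?B) (short_complex TR p)"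
    by (rule mg_iso_dsum_left[OF F'(7)])
      (simp_all add: c.fin' basis_in_dsum finB finS multigradedD(1)[OF F'(3)])
  also have "\<dots> \<cong>\<^sub>m dsum F' (big_dsum (set (p # ps)) (short_complex TR))"
    using big_dsum_insert_iso[OF notin, of F' "short_complex TR"] by simp
  finally have iso: "F \<cong>\<^sub>m dsum F' (big_dsum (set (p # ps)) (short_complex TR))" .
  have "std_cancellations F (p # ps) F'"
    unfolding p by (rule std_cancellations.Cons[OF c.std_cancellation F'(1)])
  moreover have "basis F' = basis F - (\<Union>(\<sigma>, \<tau>)\<in>set (p # ps). {\<sigma>, \<tau>})"
    unfolding F'(6) by (auto simp: p)
  ultimately show ?case
    using F' iso by blast
qed

text \<open>A surviving unit would be a unit of the Taylor differential at a pair in \<open>cancelled_pairs\<close>, and both members of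
  such a pair are gone.\<close>

lemma minimal_after_cancel_all:
  assumes F: "partly_cancelled F" "basis F = basis TR - (\<Union>(\<sigma>, \<tau>)\<in>cancelled_pairs. {\<sigma>, \<tau>})"
    and v: "v \<in> chains F (Suc j)"
  shows "diff F (Suc j) v \<tau> \<in> max_ideal"
proof -
  note FD = partly_cancelledD[OF F(1)]
  have "const_term (coef F \<pi> \<theta>) = 0" if "\<pi> \<in> basis F" "\<theta> \<in> basis F" for \<pi> \<theta>
  proof (rule ccontr)
    assume nz: "const_term (coef F \<pi> \<theta>) \<noteq> 0"
    then have "coef F \<pi> \<theta> = coef TR \<pi> \<theta>"
      using FD(4,5)[OF that] by blast
    then have "(\<theta>, \<pi>) \<in> cancelled_pairs"
      using nz FD(1) that(2) by (intro TR_const_term) auto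
    then show False
      using F(2) that by blast
  qed
  then show ?thesis
    by (auto simp: in_max_ideal_iff diff_def basis_in_def intro!: sum.neutral)
qed

end

theorem theorem5p8:
  fixes M :: "('v::finite, 'k::field) mpol set"
    and ms :: "'v mon list" and n :: "'v mon"
    and A :: "(nat set \<times> nat set) set"
  assumes "semidominant_ideal M"
    and "distinct (ms @ [n])" and "min_gen_set M (set (ms @ [n]))"
    and "\<forall>m\<in>set ms. dominant (set (ms @ [n])) m"
    and "\<not> dominant (set (ms @ [n])) n"
    and "A = {(insert (length ms) U, U) | U.
                U \<subseteq> {..<length ms} \<and> n mdvd lcm_mon ((\<lambda>i. ms ! i) ` U)}"
  shows "(\<forall>ps. distinct ps \<and> set ps = A \<longrightarrow>
            (\<exists>F. std_cancellations (taylor (ms @ [n])) ps F \<and> minimal_free_resolution F M)) \<and>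
         (\<forall>F :: ('l, 'v, 'k) mgcomplex. minimal_free_resolution F M \<longrightarrow>
            taylor (ms @ [n]) \<cong>\<^sub>m dsum F (big_dsum A (short_complex (taylor (ms @ [n])))))"
proof -
  interpret dominant_and_one ms n "TYPE('k)"
    using assms(2,4) by unfold_locales
  have A: "A = dominant_and_one.cancelled_pairs ms n"
    unfolding assms(6) cancelled_pairs_def ..
  have M: "M = ideal_gen (monom ` set (ms @ [n]))"
    using assms(3) by (simp add: min_gen_set_def)
  have aug: "augmentation TR M (\<lambda>_. 1)"
    unfolding M by (rule augmentation_taylor)
  have main: "\<exists>F. std_cancellations TR ps F \<and> minimal_free_resolution F M \<and>
      TR \<cong>\<^sub>m dsum F (big_dsum A (short_complex TR))"
    if ps: "distinct ps" "set ps = A" for ps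
  proof -
    have in_TR: "\<forall>(\<sigma>, \<tau>)\<in>set ps. \<sigma> \<in> basis TR \<and> \<tau> \<in> basis TR"
      unfolding ps(2) A
    proof safe
      fix \<sigma> \<tau> assume "(\<sigma>, \<tau>) \<in> dominant_and_one.cancelled_pairs ms n"
      from cancelled_pairs_cases[OF this] show "\<sigma> \<in> basis TR" "\<tau> \<in> basis TR"
        by auto
    qed
    obtain F where F: "std_cancellations TR ps F" "partly_cancelled F" "multigraded F"
      "exact_complex F" "augmentation F M (\<lambda>_. 1)" "basis F = basis TR - (\<Union>(\<sigma>, \<tau>)\<in>A. {\<sigma>, \<tau>})"
      "TR \<cong>\<^sub>m dsum F (big_dsum A (short_complex TR))"
      using cancel_all[OF M partly_cancelled_taylor multigraded_taylor exact_taylor aug ps(1) _ in_TR]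
        ps(2) A by auto
    then have "minimal_free_resolution F M"
      unfolding minimal_free_resolution_def free_resolution_iff
      using minimal_after_cancel_all[OF F(2)] A by blast
    with F show ?thesis by blast
  qed
  have "taylor (ms @ [n]) \<cong>\<^sub>m dsum F (big_dsum A (short_complex (taylor (ms @ [n]))))"
    if F: "minimal_free_resolution F M" for F :: "('l, 'v, 'k) mgcomplex"
  proof -
    obtain ps where ps: "distinct ps" "set ps = A"
      using finite_distinct_list[OF finite_cancelled_pairs] A by blast
    obtain F0 :: "(nat set, 'v, 'k) mgcomplex" where F0: "minimal_free_resolution F0 M" "TR \<cong>\<^sub>m dsum F0 (big_dsum A (short_complex TR))"
      using main[OF ps] by (elim exE conjE) (rule that)
    note F0(2)
    also have "dsum F0 (big_dsum A (short_complex TR)) \<cong>\<^sub>m dsum F (big_dsum A (short_complex TR))"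
    proof (rule mg_iso_dsum_left[OF minimal_free_resolution_unique[OF M F0(1) F]])
      show "finite (basis_in F0 j)" "finite (basis_in F j)" for j
        using F F0(1) by (auto simp: minimal_free_resolution_def free_resolution_def multigraded_def)
      show "finite (basis_in (big_dsum A (short_complex TR)) j)" for j
        by (rule finite_basis_big_dsum) (auto simp: A finite_cancelled_pairs short_complex_def)
    qed
    finally show ?thesis .
  qed
  with main show ?thesis by blast
qed

end
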